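(* Let $k$ be a field and let $A$ be a finite-dimensional local $k$-algebra with radical $J$ and simple module $S=A/J$. Then $\gamma_A\le |{}_AJ|$, and for every $A$-module $M$ one has $\gamma(M)=\gamma(\Omega M)\le\gamma_A$. If $M$ is an $A$-module such that $S$ is (isomorphic to) a direct summand of $\Omega^nM$ for some $n\ge 0$, then $\gamma(M)=\gamma_A$.
   Context: Modules are left modules of finite length, $|M|$ denotes the length of $M$, and $|{}_AJ|$ is the length of $J$ as a left $A$-module. $P(M)$ is a projective cover of $M$, $\Omega M$ is the first syzygy module (the kernel of a projective cover $P(M)\to M$), $\Omega^0M=M$ and $\Omega^{n+1}M=\Omega(\Omega^nM)$. Put $t(M)=|\operatorname{top}M|$ with $\operatorname{top}M=M/JM$, and $t_n(M)=t(\Omega^nM)$ for $n\ge 0$. The $\Omega$-growth of $M$ is $\gamma(M)=\limsup_n\sqrt[n]{t_n(M)}$. For a local algebra $A$ with simple module $S$, put $\gamma_A=\gamma(S)$. *)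

theory Defs
  imports "HOL-Library.Extended_Real" "HOL-Algebra.Module" "HOL-Algebra.AbelCoset"
begin

section \<open>Finite-dimensional associative algebras\<close>

text \<open>The library locale \<open>algebra\<close> requires a commutative multiplication, hence this variant.\<close>

locale fd_algebra = Module.module R M + field R + ring M for R (structure) and M (structure) +
  assumes smult_assoc_left:
      "\<lbrakk>a \<in> carrier R; x \<in> carrier M; y \<in> carrier M\<rbrakk> \<Longrightarrow>
        (a \<odot>\<^bsub>M\<^esub> x) \<otimes>\<^bsub>M\<^esub> y = a \<odot>\<^bsub>M\<^esub> (x \<otimes>\<^bsub>M\<^esub> y)"
    and smult_assoc_right:
      "\<lbrakk>a \<in> carrier R; x \<in> carrier M; y \<in> carrier M\<rbrakk> \<Longrightarrow>
        x \<otimes>\<^bsub>M\<^esub> (a \<odot>\<^bsub>M\<^esub> y) = a \<odot>\<^bsub>M\<^esub> (x \<otimes>\<^bsub>M\<^esub> y)"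
    and finite_dim:
      "\<exists>B. finite B \<and> B \<subseteq> carrier M \<and>
        (\<forall>x\<in>carrier M. \<exists>c\<in>B \<rightarrow> carrier R. x = (\<Oplus>\<^bsub>M\<^esub>b\<in>B. c b \<odot>\<^bsub>M\<^esub> b))"


section \<open>Left modules over a ring\<close>

text \<open>
  The library locale \<open>module\<close> requires a commutative ring of scalars. As there, modules are
  \<open>module\<close> records whose \<open>mult\<close> and \<open>one\<close> fields play no role. The locale \<open>submodule\<close> of the
  library makes no commutativity assumption and is used as it stands; a submodule \<open>N\<close>, regarded
  as a module, is \<open>M\<lparr>carrier := N\<rparr>\<close>.
\<close>

locale left_module = R?: ring R + M?: abelian_group M for R (structure) and M (structure) +
  assumes smult_closed:
      "\<lbrakk>a \<in> carrier R; x \<in> carrier M\<rbrakk> \<Longrightarrow> a \<odot>\<^bsub>M\<^esub> x \<in> carrier M"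
    and smult_l_distr:
      "\<lbrakk>a \<in> carrier R; b \<in> carrier R; x \<in> carrier M\<rbrakk> \<Longrightarrow>
        (a \<oplus>\<^bsub>R\<^esub> b) \<odot>\<^bsub>M\<^esub> x = a \<odot>\<^bsub>M\<^esub> x \<oplus>\<^bsub>M\<^esub> b \<odot>\<^bsub>M\<^esub> x"
    and smult_r_distr:
      "\<lbrakk>a \<in> carrier R; x \<in> carrier M; y \<in> carrier M\<rbrakk> \<Longrightarrow>
        a \<odot>\<^bsub>M\<^esub> (x \<oplus>\<^bsub>M\<^esub> y) = a \<odot>\<^bsub>M\<^esub> x \<oplus>\<^bsub>M\<^esub> a \<odot>\<^bsub>M\<^esub> y"
    and smult_assoc:
      "\<lbrakk>a \<in> carrier R; b \<in> carrier R; x \<in> carrier M\<rbrakk> \<Longrightarrow>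
        (a \<otimes>\<^bsub>R\<^esub> b) \<odot>\<^bsub>M\<^esub> x = a \<odot>\<^bsub>M\<^esub> (b \<odot>\<^bsub>M\<^esub> x)"
    and smult_one:
      "x \<in> carrier M \<Longrightarrow> \<one>\<^bsub>R\<^esub> \<odot>\<^bsub>M\<^esub> x = x"

definition lmod_hom ::
    "('a, 'r) ring_scheme \<Rightarrow> ('a, 'm) module \<Rightarrow> ('a, 'n) module \<Rightarrow> ('m \<Rightarrow> 'n) set" where
  "lmod_hom R M N = {f \<in> carrier M \<rightarrow> carrier N.
     (\<forall>x\<in>carrier M. \<forall>y\<in>carrier M. f (x \<oplus>\<^bsub>M\<^esub> y) = f x \<oplus>\<^bsub>N\<^esub> f y) \<and>
     (\<forall>a\<in>carrier R. \<forall>x\<in>carrier M. f (a \<odot>\<^bsub>M\<^esub> x) = a \<odot>\<^bsub>N\<^esub> f x)}"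

definition lmod_iso ::
    "('a, 'r) ring_scheme \<Rightarrow> ('a, 'm) module \<Rightarrow> ('a, 'n) module \<Rightarrow> bool" where
  "lmod_iso R M N \<longleftrightarrow> (\<exists>f\<in>lmod_hom R M N. bij_betw f (carrier M) (carrier N))"

definition quotient_module :: "('a, 'm) module \<Rightarrow> 'm set \<Rightarrow> ('a, 'm set) module" where
  "quotient_module M N =
     \<lparr>carrier = a_rcosets\<^bsub>M\<^esub> N, mult = undefined, one = undefined, zero = N, add = set_add M,
      smult = (\<lambda>a X. \<Union>x\<in>X. N +>\<^bsub>M\<^esub> (a \<odot>\<^bsub>M\<^esub> x))\<rparr>"

text \<open>The ring as a left module over itself; its submodules are the left ideals.\<close>

definition regular_module :: "('a, 'r) ring_scheme \<Rightarrow> ('a, 'a) module" where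
  "regular_module R =
     \<lparr>carrier = carrier R, mult = undefined, one = undefined, zero = \<zero>\<^bsub>R\<^esub>, add = add R,
      smult = mult R\<rparr>"

text \<open>\<open>N\<close> is isomorphic to a direct summand of \<open>M\<close>.\<close>

definition is_summand ::
    "('a, 'r) ring_scheme \<Rightarrow> ('a, 'n) module \<Rightarrow> ('a, 'm) module \<Rightarrow> bool" where
  "is_summand R N M \<longleftrightarrow>
     (\<exists>X Y. submodule X R M \<and> submodule Y R M \<and> X \<inter> Y = {\<zero>\<^bsub>M\<^esub>} \<and>
        X <+>\<^bsub>M\<^esub> Y = carrier M \<and> lmod_iso R N (M\<lparr>carrier := X\<rparr>))"

text \<open>The length is the supremum of the lengths of chains of submodules.\<close>

definition module_length :: "('a, 'r) ring_scheme \<Rightarrow> ('a, 'm) module \<Rightarrow> enat" where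
  "module_length R M =
     Sup {enat n | n. \<exists>N :: nat \<Rightarrow> 'm set.
            (\<forall>i\<le>n. submodule (N i) R M) \<and> (\<forall>i<n. N i \<subset> N (Suc i))}"

definition finite_length_module :: "('a, 'r) ring_scheme \<Rightarrow> ('a, 'm) module \<Rightarrow> bool" where
  "finite_length_module R M \<longleftrightarrow> left_module R M \<and> module_length R M < \<infinity>"


section \<open>Radical, local rings, top\<close>

definition maximal_left_ideal :: "('a, 'r) ring_scheme \<Rightarrow> 'a set \<Rightarrow> bool" where
  "maximal_left_ideal R I \<longleftrightarrow>
     submodule I R (regular_module R) \<and> I \<noteq> carrier R \<and>
     (\<forall>I'. submodule I' R (regular_module R) \<and> I \<subseteq> I' \<longrightarrow> I' = I \<or> I' = carrier R)"

definition jacobson_radical :: "('a, 'r) ring_scheme \<Rightarrow> 'a set" where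
  "jacobson_radical R = carrier R \<inter> \<Inter>{I. maximal_left_ideal R I}"

definition local_ring :: "('a, 'r) ring_scheme \<Rightarrow> bool" where
  "local_ring R \<longleftrightarrow> ring R \<and> (\<exists>!I. maximal_left_ideal R I)"

text \<open>\<open>J M\<close>, the submodule generated by the products \<open>j \<odot> x\<close> with \<open>j\<close> in the radical.\<close>

definition radical_mult :: "('a, 'r) ring_scheme \<Rightarrow> ('a, 'm) module \<Rightarrow> 'm set" where
  "radical_mult R M =
     \<Inter>{N. submodule N R M \<and> (\<forall>j\<in>jacobson_radical R. \<forall>x\<in>carrier M. j \<odot>\<^bsub>M\<^esub> x \<in> N)}"

definition top_module :: "('a, 'r) ring_scheme \<Rightarrow> ('a, 'm) module \<Rightarrow> ('a, 'm set) module" where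
  "top_module R M = quotient_module M (radical_mult R M)"

text \<open>Meaningful when the top has finite length, since \<open>the_enat \<infinity>\<close> is unspecified.\<close>

definition top_length :: "('a, 'r) ring_scheme \<Rightarrow> ('a, 'm) module \<Rightarrow> nat" where
  "top_length R M = the_enat (module_length R (top_module R M))"

text \<open>For a local ring this is its simple module.\<close>

definition residue_module :: "('a, 'r) ring_scheme \<Rightarrow> ('a, 'a set) module" where
  "residue_module R = quotient_module (regular_module R) (jacobson_radical R)"


section \<open>Projective covers and syzygies\<close>

text \<open>
  Projectivity is the lifting property. A definition cannot quantify over types, so the test
  modules live in two fixed types. This loses nothing: the test modules include \<open>Y = P\<close> and, as
  \<open>X\<close>, the free module on the set \<open>carrier P\<close> (finitely supported functions); lifting the identity
  of \<open>P\<close> along \<open>X \<rightarrow> P\<close> shows that \<open>P\<close> is a direct summand of a free module, and hence has the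
  lifting property with respect to modules in all types.
\<close>

definition projective_module :: "('a, 'r) ring_scheme \<Rightarrow> ('a, 'p) module \<Rightarrow> bool" where
  "projective_module R P \<longleftrightarrow> left_module R P \<and>
     (\<forall>(X :: ('a, 'p \<Rightarrow> 'a) module) (Y :: ('a, 'p) module) g f.
        left_module R X \<and> left_module R Y \<and>
        g \<in> lmod_hom R X Y \<and> g ` carrier X = carrier Y \<and> f \<in> lmod_hom R P Y \<longrightarrow>
        (\<exists>h\<in>lmod_hom R P X. \<forall>x\<in>carrier P. g (h x) = f x))"

definition superfluous ::
    "('a, 'r) ring_scheme \<Rightarrow> ('a, 'm) module \<Rightarrow> 'm set \<Rightarrow> bool" where
  "superfluous R M U \<longleftrightarrow> submodule U R M \<and>
     (\<forall>N. submodule N R M \<and> U <+>\<^bsub>M\<^esub> N = carrier M \<longrightarrow> N = carrier M)"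

definition projective_cover ::
    "('a, 'r) ring_scheme \<Rightarrow> ('a, 'p) module \<Rightarrow> ('p \<Rightarrow> 'm) \<Rightarrow> ('a, 'm) module \<Rightarrow> bool" where
  "projective_cover R P p M \<longleftrightarrow>
     projective_module R P \<and> p \<in> lmod_hom R P M \<and> p ` carrier P = carrier M \<and>
     superfluous R P (a_kernel P M p)"

text \<open>
  Projective covers are unique up to isomorphism when they exist, so the choice is immaterial up to
  isomorphism. The projective cover is taken in the type \<open>nat \<Rightarrow> 'a\<close>, which contains a copy of
  every finitely generated free module and its submodules, hence of the projective cover of each
  finite-length module over a finite-dimensional algebra.
\<close>

definition syzygy ::
    "('a, 'r) ring_scheme \<Rightarrow> ('a, 'm) module \<Rightarrow> ('a, nat \<Rightarrow> 'a) module" where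
  "syzygy R M =
     (SOME N. \<exists>P p. projective_cover R P p M \<and> N = P\<lparr>carrier := a_kernel P M p\<rparr>)"

text \<open>
  The zeroth syzygy \<open>M\<close> lives in an arbitrary type, the higher ones in \<open>nat \<Rightarrow> 'a\<close>. Therefore the
  two notions below that refer to the \<open>n\<close>-th syzygy distinguish the case \<open>n = 0\<close>.
\<close>

definition syzygy_top_length ::
    "('a, 'r) ring_scheme \<Rightarrow> nat \<Rightarrow> ('a, 'm) module \<Rightarrow> nat" where
  "syzygy_top_length R n M =
     (case n of 0 \<Rightarrow> top_length R M
      | Suc m \<Rightarrow> top_length R ((syzygy R ^^ m) (syzygy R M)))"

definition is_summand_of_syzygy ::
    "('a, 'r) ring_scheme \<Rightarrow> ('a, 's) module \<Rightarrow> nat \<Rightarrow> ('a, 'm) module \<Rightarrow> bool" where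
  "is_summand_of_syzygy R S n M \<longleftrightarrow>
     (case n of 0 \<Rightarrow> is_summand R S M
      | Suc m \<Rightarrow> is_summand R S ((syzygy R ^^ m) (syzygy R M)))"

definition omega_growth :: "('a, 'r) ring_scheme \<Rightarrow> ('a, 'm) module \<Rightarrow> ereal" where
  "omega_growth R M = limsup (\<lambda>n. ereal (root n (real (syzygy_top_length R n M))))"

definition local_growth :: "('a, 'r) ring_scheme \<Rightarrow> ereal" where
  "local_growth R = omega_growth R (residue_module R)"

end

theory Submission
  imports Defs "HOL-Analysis.Extended_Real_Limits"
begin

text \<open>
  Over a local ring of finite length, the length of the top of a finitely generated module is its
  minimal number of generators, and a minimal generating set gives a free projective cover. So
  \<open>\<Omega> M\<close> lies in \<open>J P(M)\<close>, whose length is at most \<open>t(M)\<close> times that of \<open>J\<close>; hence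
  \<open>t\<^sub>n(M)\<close> grows at most like \<open>|J|\<^sup>n\<close>.

  Isomorphisms and stable cancellation are avoided by working with retracts: if \<open>X\<close> is a retract
  of \<open>Y\<close>, then \<open>\<Omega> X\<close> is a retract of the kernel of any epimorphism onto \<open>Y\<close> along which the two
  maps lift, and in particular \<open>t\<^sub>n(X) \<le> t\<^sub>n(Y)\<close>. With the horseshoe construction this makes
  \<open>t\<^sub>n\<close> subadditive on short exact sequences, and a composition series gives
  \<open>t\<^sub>n(M) \<le> |M| t\<^sub>n(S)\<close>. If \<open>S\<close> is a summand of \<open>\<Omega>\<^sup>n M\<close>, then conversely
  \<open>t\<^sub>i(S) \<le> t\<^sub>n\<^sub>+\<^sub>i(M)\<close>.
\<close>

section \<open>Submodules, homomorphisms and quotients\<close>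

text \<open>Generators and length control each other: a module needs at most as many generators as
  its length, and its length is at most \<open>d\<close> times its number of generators. The first
  estimate turns a bound on the length of the syzygy into a bound on its top; the second lets bounds
  pass to submodules. The definition of \<open>syzygy\<close> picks an unknown projective cover, so
  all estimates hold for an arbitrary cover, and a free cover is built only to show that one exists.
  The sum of covers of the ends of a short exact sequence is in general larger than a cover of the
  middle term; this is why the horseshoe construction yields a retract and not an isomorphism.
  Syzygies live in the type \<open>nat \<Rightarrow> 'a\<close> whatever the type of the module, so
  inductions on n run in that type and one explicit step leads there from other types. For the
  equality of the growth of a module and of its syzygy, the sequence is shifted while the index of
  the root is not. The correcting factor is the n-th root of a bounded quantity and tends to 1;
  constant factors such as the length of M disappear for the same reason.\<close>

lemma lmod_homD:
  assumes "f \<in> lmod_hom R M N"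
  shows hom_closed: "x \<in> carrier M \<Longrightarrow> f x \<in> carrier N"
    and hom_add: "\<lbrakk>x \<in> carrier M; y \<in> carrier M\<rbrakk> \<Longrightarrow> f (x \<oplus>\<^bsub>M\<^esub> y) = f x \<oplus>\<^bsub>N\<^esub> f y"
    and hom_smult: "\<lbrakk>a \<in> carrier R; x \<in> carrier M\<rbrakk> \<Longrightarrow> f (a \<odot>\<^bsub>M\<^esub> x) = a \<odot>\<^bsub>N\<^esub> f x"
  using assms by (auto simp: lmod_hom_def)

lemma lmod_homI:
  assumes "\<And>x. x \<in> carrier M \<Longrightarrow> f x \<in> carrier N"
    and "\<And>x y. \<lbrakk>x \<in> carrier M; y \<in> carrier M\<rbrakk> \<Longrightarrow> f (x \<oplus>\<^bsub>M\<^esub> y) = f x \<oplus>\<^bsub>N\<^esub> f y"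
    and "\<And>a x. \<lbrakk>a \<in> carrier R; x \<in> carrier M\<rbrakk> \<Longrightarrow> f (a \<odot>\<^bsub>M\<^esub> x) = a \<odot>\<^bsub>N\<^esub> f x"
  shows "f \<in> lmod_hom R M N"
  using assms by (auto simp: lmod_hom_def)

lemma hom_id: "(\<lambda>x. x) \<in> lmod_hom R M M"
  by (auto intro!: lmod_homI)

lemma hom_comp:
  assumes "f \<in> lmod_hom R L M" "g \<in> lmod_hom R M N"
  shows "(\<lambda>x. g (f x)) \<in> lmod_hom R L N"
  using lmod_homD[OF assms(1)] lmod_homD[OF assms(2)] by (intro lmod_homI) auto

lemma mem_kernel_iff: "x \<in> a_kernel M N f \<longleftrightarrow> x \<in> carrier M \<and> f x = \<zero>\<^bsub>N\<^esub>"
  by (auto simp: a_kernel_def')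

lemma submodule_subset: "submodule N R M \<Longrightarrow> N \<subseteq> carrier M"
  unfolding submodule_def using subgroup.subset[of N "add_monoid M"] by auto

lemma submodule_zero: "submodule N R M \<Longrightarrow> \<zero>\<^bsub>M\<^esub> \<in> N"
  unfolding submodule_def using subgroup.one_closed[of N "add_monoid M"] by auto

lemma submodule_add: "\<lbrakk>submodule N R M; x \<in> N; y \<in> N\<rbrakk> \<Longrightarrow> x \<oplus>\<^bsub>M\<^esub> y \<in> N"
  unfolding submodule_def using subgroup.m_closed[of N "add_monoid M"] by auto

lemma submodule_neg: "\<lbrakk>submodule N R M; x \<in> N\<rbrakk> \<Longrightarrow> \<ominus>\<^bsub>M\<^esub> x \<in> N"
  unfolding submodule_def a_inv_def using subgroup.m_inv_closed[of N "add_monoid M"] by auto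

lemma submodule_minus: "\<lbrakk>submodule N R M; x \<in> N; y \<in> N\<rbrakk> \<Longrightarrow> x \<ominus>\<^bsub>M\<^esub> y \<in> N"
  unfolding a_minus_def by (intro submodule_add submodule_neg)

lemma submodule_smult: "\<lbrakk>submodule N R M; a \<in> carrier R; x \<in> N\<rbrakk> \<Longrightarrow> a \<odot>\<^bsub>M\<^esub> x \<in> N"
  by (rule submodule.smult_closed)

lemma mem_set_add_iff: "x \<in> X <+>\<^bsub>M\<^esub> Y \<longleftrightarrow> (\<exists>u\<in>X. \<exists>v\<in>Y. x = u \<oplus>\<^bsub>M\<^esub> v)"
  by (auto simp: set_add_def')

section \<open>Submodules of a fixed left module\<close>

context left_module
begin

lemma smult_l_null [simp]: "x \<in> carrier M \<Longrightarrow> \<zero> \<odot>\<^bsub>M\<^esub> x = \<zero>\<^bsub>M\<^esub>"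
proof -
  assume x: "x \<in> carrier M"
  have "\<zero> \<odot>\<^bsub>M\<^esub> x \<oplus>\<^bsub>M\<^esub> \<zero> \<odot>\<^bsub>M\<^esub> x = \<zero> \<odot>\<^bsub>M\<^esub> x"
    using smult_l_distr[of \<zero> \<zero> x] x by simp
  then show ?thesis
    using x by (metis M.add.l_cancel_one R.zero_closed smult_closed)
qed

lemma smult_r_null [simp]: "a \<in> carrier R \<Longrightarrow> a \<odot>\<^bsub>M\<^esub> \<zero>\<^bsub>M\<^esub> = \<zero>\<^bsub>M\<^esub>"
proof -
  assume a: "a \<in> carrier R"
  have "a \<odot>\<^bsub>M\<^esub> \<zero>\<^bsub>M\<^esub> \<oplus>\<^bsub>M\<^esub> a \<odot>\<^bsub>M\<^esub> \<zero>\<^bsub>M\<^esub> = a \<odot>\<^bsub>M\<^esub> \<zero>\<^bsub>M\<^esub>"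
    using smult_r_distr[of a "\<zero>\<^bsub>M\<^esub>" "\<zero>\<^bsub>M\<^esub>"] a by simp
  then show ?thesis
    using a by (metis M.add.l_cancel_one M.zero_closed smult_closed)
qed

lemma smult_l_minus:
  assumes "a \<in> carrier R" "x \<in> carrier M"
  shows "(\<ominus> a) \<odot>\<^bsub>M\<^esub> x = \<ominus>\<^bsub>M\<^esub> (a \<odot>\<^bsub>M\<^esub> x)"
proof -
  have "(\<ominus> a) \<odot>\<^bsub>M\<^esub> x \<oplus>\<^bsub>M\<^esub> a \<odot>\<^bsub>M\<^esub> x = \<zero>\<^bsub>M\<^esub>"
    using smult_l_distr[of "\<ominus> a" a x] assms by (simp add: R.l_neg)
  then show ?thesis
    using assms by (metis M.minus_equality R.a_inv_closed smult_closed)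
qed

lemma submoduleI:
  assumes "N \<subseteq> carrier M" "\<zero>\<^bsub>M\<^esub> \<in> N"
    and "\<And>x y. \<lbrakk>x \<in> N; y \<in> N\<rbrakk> \<Longrightarrow> x \<oplus>\<^bsub>M\<^esub> y \<in> N"
    and "\<And>a x. \<lbrakk>a \<in> carrier R; x \<in> N\<rbrakk> \<Longrightarrow> a \<odot>\<^bsub>M\<^esub> x \<in> N"
  shows "submodule N R M"
proof -
  have neg: "\<ominus>\<^bsub>M\<^esub> x \<in> N" if "x \<in> N" for x
  proof -
    have "(\<ominus> \<one>) \<odot>\<^bsub>M\<^esub> x = \<ominus>\<^bsub>M\<^esub> x"
      using that assms(1) smult_l_minus[of \<one> x] smult_one[of x] by auto
    then show ?thesis using assms(4)[of "\<ominus> \<one>" x] that by simp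
  qed
  show ?thesis
    using assms neg
    by (intro submodule.intro subgroup.intro) (auto simp: submodule_axioms_def a_inv_def)
qed

lemma carrier_submodule: "submodule (carrier M) R M"
  by (rule submoduleI) (auto intro: smult_closed)

lemma zero_submodule: "submodule {\<zero>\<^bsub>M\<^esub>} R M"
  by (rule submoduleI) auto

lemma inter_submodule:
  assumes "submodule X R M" "submodule Y R M" shows "submodule (X \<inter> Y) R M"
  using submodule_subset[OF assms(1)]
  by (intro submoduleI) (auto intro: submodule_zero submodule_add submodule_smult assms)

lemma Inter_submodule:
  assumes "\<And>X. X \<in> F \<Longrightarrow> submodule X R M" "F \<noteq> {}"
  shows "submodule (\<Inter>F) R M"
proof -
  obtain X where X: "X \<in> F" using assms(2) by blast
  show ?thesis using submodule_subset[OF assms(1)[OF X]] X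
    by (intro submoduleI) (auto intro: submodule_zero submodule_add submodule_smult assms)
qed

lemma sum_submodule:
  assumes X: "submodule X R M" and Y: "submodule Y R M"
  shows "submodule (X <+>\<^bsub>M\<^esub> Y) R M"
proof (rule submoduleI)
  note XM = submodule_subset[OF X] and YM = submodule_subset[OF Y]
  show "X <+>\<^bsub>M\<^esub> Y \<subseteq> carrier M"
    using XM YM by (auto simp: mem_set_add_iff subset_iff)
  show "\<zero>\<^bsub>M\<^esub> \<in> X <+>\<^bsub>M\<^esub> Y"
    unfolding mem_set_add_iff
    by (intro bexI[of _ "\<zero>\<^bsub>M\<^esub>"]) (auto intro: submodule_zero X Y)
  fix x y assume "x \<in> X <+>\<^bsub>M\<^esub> Y" "y \<in> X <+>\<^bsub>M\<^esub> Y"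
  then obtain u v u' v' where uv: "u \<in> X" "v \<in> Y" "x = u \<oplus>\<^bsub>M\<^esub> v"
      and uv': "u' \<in> X" "v' \<in> Y" "y = u' \<oplus>\<^bsub>M\<^esub> v'"
    unfolding mem_set_add_iff by blast
  have "x \<oplus>\<^bsub>M\<^esub> y = (u \<oplus>\<^bsub>M\<^esub> u') \<oplus>\<^bsub>M\<^esub> (v \<oplus>\<^bsub>M\<^esub> v')"
    using uv uv' XM YM by (simp add: subset_iff M.a_ac)
  then show "x \<oplus>\<^bsub>M\<^esub> y \<in> X <+>\<^bsub>M\<^esub> Y"
    unfolding mem_set_add_iff using uv uv' submodule_add[OF X] submodule_add[OF Y] by blast
next
  note XM = submodule_subset[OF X] and YM = submodule_subset[OF Y]
  fix a x assume a: "a \<in> carrier R" and "x \<in> X <+>\<^bsub>M\<^esub> Y"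
  then obtain u v where uv: "u \<in> X" "v \<in> Y" "x = u \<oplus>\<^bsub>M\<^esub> v"
    unfolding mem_set_add_iff by blast
  then have "a \<odot>\<^bsub>M\<^esub> x = a \<odot>\<^bsub>M\<^esub> u \<oplus>\<^bsub>M\<^esub> a \<odot>\<^bsub>M\<^esub> v"
    using a XM YM smult_r_distr by blast
  then show "a \<odot>\<^bsub>M\<^esub> x \<in> X <+>\<^bsub>M\<^esub> Y"
    unfolding mem_set_add_iff using uv a submodule_smult[OF X] submodule_smult[OF Y] by blast
qed

lemma sum_submodule_upper:
  assumes X: "submodule X R M" and Y: "submodule Y R M"
  shows "X \<subseteq> X <+>\<^bsub>M\<^esub> Y" "Y \<subseteq> X <+>\<^bsub>M\<^esub> Y"
proof -
  note XM = submodule_subset[OF X] and YM = submodule_subset[OF Y]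
  show "X \<subseteq> X <+>\<^bsub>M\<^esub> Y"
    unfolding mem_set_add_iff subset_iff using submodule_zero[OF Y] XM
    by (metis M.r_zero subset_iff)
  show "Y \<subseteq> X <+>\<^bsub>M\<^esub> Y"
    unfolding mem_set_add_iff subset_iff using submodule_zero[OF X] YM
    by (metis M.l_zero subset_iff)
qed

lemma submodule_left_module:
  assumes N: "submodule N R M"
  shows "left_module R (M\<lparr>carrier := N\<rparr>)"
proof -
  note NM = submodule_subset[OF N]
  have "abelian_group (M\<lparr>carrier := N\<rparr>)"
  proof (rule abelian_groupI)
    fix x assume x: "x \<in> carrier (M\<lparr>carrier := N\<rparr>)"
    show "\<exists>y\<in>carrier (M\<lparr>carrier := N\<rparr>). y \<oplus>\<^bsub>M\<lparr>carrier := N\<rparr>\<^esub> x = \<zero>\<^bsub>M\<lparr>carrier := N\<rparr>\<^esub>"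
      using x NM submodule_neg[OF N, of x] by (auto intro!: bexI[of _ "\<ominus>\<^bsub>M\<^esub> x"] M.l_neg)
  qed (use NM in \<open>auto intro: submodule_add[OF N] submodule_zero[OF N] M.a_ac\<close>)
  moreover have "left_module_axioms R (M\<lparr>carrier := N\<rparr>)"
    using NM by unfold_locales
      (auto intro: submodule_smult[OF N] smult_l_distr smult_r_distr smult_assoc smult_one)
  ultimately show ?thesis
    by (intro left_module.intro R.ring_axioms)
qed

lemma submodule_of_submodule_iff:
  assumes N: "submodule N R M"
  shows "submodule X R (M\<lparr>carrier := N\<rparr>) \<longleftrightarrow> submodule X R M \<and> X \<subseteq> N"
proof
  interpret N: left_module R "M\<lparr>carrier := N\<rparr>" by (rule submodule_left_module[OF N])
  note NM = submodule_subset[OF N]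
  {
    assume X: "submodule X R (M\<lparr>carrier := N\<rparr>)"
    show "submodule X R M \<and> X \<subseteq> N"
      using submodule_subset[OF X] NM submodule_zero[OF X] submodule_add[OF X] submodule_smult[OF X]
      by (auto intro!: submoduleI)
  }
  {
    assume X: "submodule X R M \<and> X \<subseteq> N"
    show "submodule X R (M\<lparr>carrier := N\<rparr>)"
      using X by (auto intro!: N.submoduleI intro: submodule_zero submodule_add submodule_smult)
  }
qed

end

section \<open>Homomorphisms, images, preimages and kernels\<close>

lemma hom_zero:
  assumes "left_module R M" "left_module R N" "f \<in> lmod_hom R M N"
  shows "f \<zero>\<^bsub>M\<^esub> = \<zero>\<^bsub>N\<^esub>"
proof -
  interpret M: left_module R M by fact
  interpret N: left_module R N by fact
  have "f (\<zero>\<^bsub>R\<^esub> \<odot>\<^bsub>M\<^esub> \<zero>\<^bsub>M\<^esub>) = \<zero>\<^bsub>R\<^esub> \<odot>\<^bsub>N\<^esub> f \<zero>\<^bsub>M\<^esub>"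
    by (rule hom_smult[OF assms(3)]) auto
  then show ?thesis
    using hom_closed[OF assms(3), of "\<zero>\<^bsub>M\<^esub>"] by simp
qed

lemma hom_neg:
  assumes "left_module R M" "left_module R N" "f \<in> lmod_hom R M N" "x \<in> carrier M"
  shows "f (\<ominus>\<^bsub>M\<^esub> x) = \<ominus>\<^bsub>N\<^esub> f x"
proof -
  interpret M: left_module R M by fact
  interpret N: left_module R N by fact
  have "f (\<ominus>\<^bsub>M\<^esub> x) \<oplus>\<^bsub>N\<^esub> f x = \<zero>\<^bsub>N\<^esub>"
    using hom_add[OF assms(3), of "\<ominus>\<^bsub>M\<^esub> x" x] hom_zero[OF assms(1-3)] assms(4)
    by (simp add: M.M.l_neg)
  then show ?thesis
    using hom_closed[OF assms(3)] assms(4) by (metis M.M.a_inv_closed N.M.minus_equality)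
qed

lemma hom_minus:
  assumes "left_module R M" "left_module R N" "f \<in> lmod_hom R M N" "x \<in> carrier M" "y \<in> carrier M"
  shows "f (x \<ominus>\<^bsub>M\<^esub> y) = f x \<ominus>\<^bsub>N\<^esub> f y"
proof -
  interpret M: left_module R M by fact
  show ?thesis unfolding a_minus_def
    using hom_add[OF assms(3), of x "\<ominus>\<^bsub>M\<^esub> y"] hom_neg[OF assms(1-3), of y] assms(4,5) by simp
qed

lemma vimage_submodule:
  assumes M: "left_module R M" and N: "left_module R N" and f: "f \<in> lmod_hom R M N"
    and X: "submodule X R N"
  shows "submodule {x \<in> carrier M. f x \<in> X} R M"
proof -
  interpret M: left_module R M by fact
  show ?thesis
    using hom_zero[OF M N f] submodule_zero[OF X]
    by (intro M.submoduleI)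
       (auto simp: lmod_homD[OF f] intro: submodule_add[OF X] submodule_smult[OF X] M.smult_closed)
qed

lemma image_submodule:
  assumes M: "left_module R M" and N: "left_module R N" and f: "f \<in> lmod_hom R M N"
    and X: "submodule X R M"
  shows "submodule (f ` X) R N"
proof -
  interpret N: left_module R N by fact
  note XM = submodule_subset[OF X]
  show ?thesis
  proof (rule N.submoduleI)
    show "f ` X \<subseteq> carrier N" using XM hom_closed[OF f] by auto
    show "\<zero>\<^bsub>N\<^esub> \<in> f ` X" using hom_zero[OF M N f] submodule_zero[OF X] by (metis imageI)
    show "x \<oplus>\<^bsub>N\<^esub> y \<in> f ` X" if "x \<in> f ` X" "y \<in> f ` X" for x y
    proof -
      from that obtain u v where "u \<in> X" "v \<in> X" "x = f u" "y = f v" by blast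
      then show ?thesis using hom_add[OF f, of u v] submodule_add[OF X, of u v] XM
        by (metis imageI subsetD)
    qed
    show "a \<odot>\<^bsub>N\<^esub> x \<in> f ` X" if "a \<in> carrier R" "x \<in> f ` X" for a x
    proof -
      from that obtain u where "u \<in> X" "x = f u" by blast
      then show ?thesis using hom_smult[OF f, of a u] submodule_smult[OF X, of a u] XM that(1)
        by (metis imageI subsetD)
    qed
  qed
qed

lemma kernel_submodule:
  assumes "left_module R M" "left_module R N" "f \<in> lmod_hom R M N"
  shows "submodule (a_kernel M N f) R M"
proof -
  interpret N: left_module R N by fact
  have "a_kernel M N f = {x \<in> carrier M. f x \<in> {\<zero>\<^bsub>N\<^esub>}}" by (auto simp: mem_kernel_iff)
  then show ?thesis using vimage_submodule[OF assms N.zero_submodule] by simp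
qed

lemma hom_restrict:
  "\<lbrakk>f \<in> lmod_hom R M N; X \<subseteq> carrier M; \<And>x. x \<in> X \<Longrightarrow> f x \<in> Y\<rbrakk>
    \<Longrightarrow> f \<in> lmod_hom R (M\<lparr>carrier := X\<rparr>) (N\<lparr>carrier := Y\<rparr>)"
  by (rule lmod_homI) (auto simp: lmod_homD subset_iff)

lemma hom_inclusion: "X \<subseteq> carrier M \<Longrightarrow> (\<lambda>x. x) \<in> lmod_hom R (M\<lparr>carrier := X\<rparr>) M"
  by (auto simp: lmod_hom_def)

section \<open>The regular module and quotient modules\<close>

lemma regular_left_module: "ring R \<Longrightarrow> left_module R (regular_module R)"
proof -
  assume "ring R"
  then interpret ring R .
  have "abelian_group (regular_module R)"
    by (rule abelian_groupI) (auto simp: regular_module_def a_ac intro: l_neg)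
  then show ?thesis
    by (intro left_module.intro ring_axioms)
       (auto simp: left_module_axioms_def regular_module_def l_distr r_distr m_assoc)
qed

lemma regular_simps [simp]:
  "carrier (regular_module R) = carrier R"
  "add (regular_module R) = add R"
  "zero (regular_module R) = zero R"
  "smult (regular_module R) = mult R"
  by (auto simp: regular_module_def)

lemma smult_hom:
  assumes "left_module R M" "x \<in> carrier M"
  shows "(\<lambda>a. a \<odot>\<^bsub>M\<^esub> x) \<in> lmod_hom R (regular_module R) M"
proof -
  interpret left_module R M by fact
  show ?thesis
    using assms(2) by (intro lmod_homI) (auto intro: smult_closed smult_l_distr smult_assoc)
qed

lemma
  assumes M: "left_module R M" and N: "submodule N R M"
  shows quotient_left_module: "left_module R (quotient_module M N)"
    and coset_hom: "(\<lambda>x. N +>\<^bsub>M\<^esub> x) \<in> lmod_hom R M (quotient_module M N)"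
    and coset_surj: "(\<lambda>x. N +>\<^bsub>M\<^esub> x) ` carrier M = carrier (quotient_module M N)"
    and coset_zero_iff: "x \<in> carrier M \<Longrightarrow> N +>\<^bsub>M\<^esub> x = \<zero>\<^bsub>quotient_module M N\<^esub> \<longleftrightarrow> x \<in> N"
proof -
  interpret left_module R M by (rule M)
  let ?Q = "quotient_module M N" and ?p = "\<lambda>x. N +>\<^bsub>M\<^esub> x"
  note NM = submodule_subset[OF N]
  have "additive_subgroup N M"
    using N by (intro additive_subgroupI) (simp add: submodule_def)
  then interpret S: abelian_subgroup N M
    by (intro abelian_subgroupI3 M.abelian_group_axioms)
  have car: "carrier ?Q = ?p ` carrier M"
    by (auto simp: quotient_module_def A_RCOSETS_def')
  show surj: "?p ` carrier M = carrier ?Q" by (simp add: car)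
  have addp: "?p x \<oplus>\<^bsub>?Q\<^esub> ?p y = ?p (x \<oplus>\<^bsub>M\<^esub> y)" if "x \<in> carrier M" "y \<in> carrier M" for x y
    using S.a_rcos_sum[OF that] by (simp add: quotient_module_def)
  have mem: "x \<in> ?p x" if "x \<in> carrier M" for x
    using S.a_rcos_self[OF that] .
  have smp: "a \<odot>\<^bsub>?Q\<^esub> ?p x = ?p (a \<odot>\<^bsub>M\<^esub> x)" if a: "a \<in> carrier R" and x: "x \<in> carrier M" for a x
  proof -
    \<comment> \<open>The scalar action on cosets is a union over representatives. It is a single
      coset because another representative \<open>n + x\<close> changes the product by
      \<open>a n\<close>, which lies in \<open>N\<close>.\<close>
    have eq: "?p (a \<odot>\<^bsub>M\<^esub> y) = ?p (a \<odot>\<^bsub>M\<^esub> x)" if "y \<in> ?p x" for y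
    proof -
      from that obtain n where n: "n \<in> N" "y = n \<oplus>\<^bsub>M\<^esub> x" by (auto simp: a_r_coset_def')
      have "a \<odot>\<^bsub>M\<^esub> y = a \<odot>\<^bsub>M\<^esub> n \<oplus>\<^bsub>M\<^esub> a \<odot>\<^bsub>M\<^esub> x"
        using n NM a x smult_r_distr by blast
      moreover have "a \<odot>\<^bsub>M\<^esub> n \<in> N" using submodule_smult[OF N a] n by blast
      ultimately have "a \<odot>\<^bsub>M\<^esub> y \<in> ?p (a \<odot>\<^bsub>M\<^esub> x)" by (auto simp: a_r_coset_def')
      then show ?thesis using S.a_repr_independence'[of "a \<odot>\<^bsub>M\<^esub> y" "a \<odot>\<^bsub>M\<^esub> x"] a x smult_closed by simp
    qed
    have "(\<Union>y\<in>?p x. ?p (a \<odot>\<^bsub>M\<^esub> y)) = ?p (a \<odot>\<^bsub>M\<^esub> x)"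
    proof (intro equalityI UN_least)
      show "?p (a \<odot>\<^bsub>M\<^esub> y) \<subseteq> ?p (a \<odot>\<^bsub>M\<^esub> x)" if "y \<in> ?p x" for y
        using eq[OF that] by simp
      show "?p (a \<odot>\<^bsub>M\<^esub> x) \<subseteq> (\<Union>y\<in>?p x. ?p (a \<odot>\<^bsub>M\<^esub> y))"
        by (rule UN_upper[OF mem[OF x]])
    qed
    then show ?thesis by (simp add: quotient_module_def)
  qed
  have z: "\<zero>\<^bsub>?Q\<^esub> = ?p \<zero>\<^bsub>M\<^esub>"
    using NM by (simp add: quotient_module_def)
  show hom: "?p \<in> lmod_hom R M ?Q"
    by (rule lmod_homI) (auto simp: addp smp car)
  have ag: "abelian_group ?Q"
  proof (rule abelian_groupI)
    fix X assume "X \<in> carrier ?Q"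
    then obtain x where x: "x \<in> carrier M" "X = ?p x" by (auto simp: car)
    show "\<exists>Y\<in>carrier ?Q. Y \<oplus>\<^bsub>?Q\<^esub> X = \<zero>\<^bsub>?Q\<^esub>"
      using x by (intro bexI[of _ "?p (\<ominus>\<^bsub>M\<^esub> x)"]) (auto simp: addp z car M.l_neg)
  qed (auto simp: car addp z M.a_ac)
  show "left_module R ?Q"
    by (intro left_module.intro R.ring_axioms ag)
       (auto simp: left_module_axioms_def car addp smp smult_closed smult_l_distr smult_r_distr
         smult_assoc smult_one)
  show "?p x = \<zero>\<^bsub>?Q\<^esub> \<longleftrightarrow> x \<in> N" if x: "x \<in> carrier M" for x
    using x NM mem[OF x] M.a_coset_join2[OF x, of N] N
    by (auto simp: quotient_module_def submodule_def)
qed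

section \<open>Linear combinations and free modules\<close>

text \<open>The coefficients come last so that \<open>lcomb M G m\<close> is itself the homomorphism
  from the free module on \<open>G\<close>. The family \<open>m\<close> may be the identity on a
  generating set or an enumeration of it.\<close>

definition lcomb :: "('a, 'm, 's) module_scheme \<Rightarrow> 'i set \<Rightarrow> ('i \<Rightarrow> 'm) \<Rightarrow> ('i \<Rightarrow> 'a) \<Rightarrow> 'm" where
  "lcomb M G m c = (\<Oplus>\<^bsub>M\<^esub>b\<in>G. c b \<odot>\<^bsub>M\<^esub> m b)"

context left_module
begin

lemma lcomb_empty [simp]: "lcomb M {} m c = \<zero>\<^bsub>M\<^esub>"
  by (simp add: lcomb_def)

lemma lcomb_insert:
  assumes "finite G" "b \<notin> G" "m \<in> insert b G \<rightarrow> carrier M" "c \<in> insert b G \<rightarrow> carrier R"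
  shows "lcomb M (insert b G) m c = c b \<odot>\<^bsub>M\<^esub> m b \<oplus>\<^bsub>M\<^esub> lcomb M G m c"
  unfolding lcomb_def using assms
  by (subst M.finsum_insert) (auto intro!: smult_closed simp: Pi_iff)

lemma lcomb_closed:
  assumes "m \<in> G \<rightarrow> carrier M" "c \<in> G \<rightarrow> carrier R"
  shows "lcomb M G m c \<in> carrier M"
  unfolding lcomb_def using assms by (intro M.finsum_closed) (auto intro!: smult_closed simp: Pi_iff)

lemma lcomb_cong:
  assumes "m \<in> G \<rightarrow> carrier M" "c \<in> G \<rightarrow> carrier R" "\<And>b. b \<in> G \<Longrightarrow> c' b = c b"
    and "\<And>b. b \<in> G \<Longrightarrow> m' b = m b"
  shows "lcomb M G m' c' = lcomb M G m c"
  unfolding lcomb_def using assms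
  by (intro M.finsum_cong') (auto intro!: smult_closed simp: Pi_iff)

lemma lcomb_add:
  assumes "finite G" "m \<in> G \<rightarrow> carrier M" "c \<in> G \<rightarrow> carrier R" "d \<in> G \<rightarrow> carrier R"
  shows "lcomb M G m (\<lambda>b. c b \<oplus> d b) = lcomb M G m c \<oplus>\<^bsub>M\<^esub> lcomb M G m d"
  using assms
proof (induction G rule: finite_induct)
  case (insert b G)
  have "lcomb M G m c \<in> carrier M" "lcomb M G m d \<in> carrier M"
    using insert by (auto intro!: lcomb_closed)
  then show ?case
    using insert by (simp add: lcomb_insert smult_l_distr smult_closed M.a_ac Pi_iff)
qed simp

lemma lcomb_smult:
  assumes "finite G" "m \<in> G \<rightarrow> carrier M" "c \<in> G \<rightarrow> carrier R" "a \<in> carrier R"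
  shows "lcomb M G m (\<lambda>b. a \<otimes> c b) = a \<odot>\<^bsub>M\<^esub> lcomb M G m c"
  using assms
proof (induction G rule: finite_induct)
  case (insert b G)
  have "lcomb M G m c \<in> carrier M"
    using insert by (auto intro!: lcomb_closed)
  then show ?case
    using insert by (simp add: lcomb_insert smult_r_distr smult_assoc smult_closed Pi_iff)
qed simp

lemma lcomb_mem:
  assumes "finite G" "m \<in> G \<rightarrow> carrier M" "c \<in> G \<rightarrow> carrier R"
    and "submodule N R M" "\<And>b. b \<in> G \<Longrightarrow> c b \<odot>\<^bsub>M\<^esub> m b \<in> N"
  shows "lcomb M G m c \<in> N"
  using assms
proof (induction G rule: finite_induct)
  case (insert b G)
  then show ?case
    by (simp add: lcomb_insert submodule_add)
qed (auto intro: submodule_zero)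

lemma lcomb_remove:
  assumes "finite G" "b \<in> G" "m \<in> G \<rightarrow> carrier M" "c \<in> G \<rightarrow> carrier R"
  shows "lcomb M G m c = c b \<odot>\<^bsub>M\<^esub> m b \<oplus>\<^bsub>M\<^esub> lcomb M (G - {b}) m c"
  using lcomb_insert[of "G - {b}" b m c] assms by (simp add: insert_absorb)

lemma lcomb_zero:
  assumes "finite G" "m \<in> G \<rightarrow> carrier M"
  shows "lcomb M G m (\<lambda>_. \<zero>) = \<zero>\<^bsub>M\<^esub>"
  using assms by (induction G rule: finite_induct) (auto simp: lcomb_insert)

lemma lcomb_unit:
  assumes "finite G" "b \<in> G" "m \<in> G \<rightarrow> carrier M"
  shows "lcomb M G m (\<lambda>i. if i = b then \<one> else \<zero>) = m b"
proof -
  have "lcomb M (G - {b}) m (\<lambda>i. if i = b then \<one> else \<zero>) = lcomb M (G - {b}) m (\<lambda>_. \<zero>)"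
    using assms by (intro lcomb_cong) auto
  then show ?thesis
    using assms lcomb_remove[OF assms, of "\<lambda>i. if i = b then \<one> else \<zero>"]
    by (auto simp: lcomb_zero smult_one Pi_iff)
qed

lemma lcomb_submodule:
  assumes G: "finite G" "m \<in> G \<rightarrow> carrier M" and I: "submodule I R (regular_module R)"
  shows "submodule (lcomb M G m ` (G \<rightarrow> I)) R M"
proof (rule submoduleI)
  have IR: "I \<subseteq> carrier R" using submodule_subset[OF I] by simp
  then have P: "c \<in> G \<rightarrow> carrier R" if "c \<in> G \<rightarrow> I" for c using that by auto
  show "lcomb M G m ` (G \<rightarrow> I) \<subseteq> carrier M"
    using G P by (auto intro!: lcomb_closed)
  show "\<zero>\<^bsub>M\<^esub> \<in> lcomb M G m ` (G \<rightarrow> I)"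
    using lcomb_zero[OF G] submodule_zero[OF I] by (intro image_eqI[of _ _ "\<lambda>_. \<zero>"]) auto
  fix x y assume "x \<in> lcomb M G m ` (G \<rightarrow> I)" "y \<in> lcomb M G m ` (G \<rightarrow> I)"
  then obtain c d where c: "c \<in> G \<rightarrow> I" "x = lcomb M G m c" and d: "d \<in> G \<rightarrow> I" "y = lcomb M G m d"
    by blast
  show "x \<oplus>\<^bsub>M\<^esub> y \<in> lcomb M G m ` (G \<rightarrow> I)"
    using lcomb_add[OF G, of c d] c d P submodule_add[OF I]
    by (intro image_eqI[of _ _ "\<lambda>b. c b \<oplus> d b"]) (auto simp: Pi_iff)
next
  have IR: "I \<subseteq> carrier R" using submodule_subset[OF I] by simp
  fix a x assume a: "a \<in> carrier R" and "x \<in> lcomb M G m ` (G \<rightarrow> I)"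
  then obtain c where c: "c \<in> G \<rightarrow> I" "x = lcomb M G m c" by blast
  then show "a \<odot>\<^bsub>M\<^esub> x \<in> lcomb M G m ` (G \<rightarrow> I)"
    using lcomb_smult[OF G, of c a] a IR submodule_smult[OF I a]
    by (intro image_eqI[of _ _ "\<lambda>b. a \<otimes> c b"]) (auto simp: Pi_iff subset_iff)
qed

end

lemma hom_lcomb:
  assumes "left_module R M" "left_module R N" "f \<in> lmod_hom R M N"
    and "finite G" "m \<in> G \<rightarrow> carrier M" "c \<in> G \<rightarrow> carrier R"
  shows "f (lcomb M G m c) = lcomb N G (\<lambda>b. f (m b)) c"
proof -
  interpret M: left_module R M by fact
  interpret N: left_module R N by fact
  show ?thesis using assms(4-6)
  proof (induction G rule: finite_induct)
    case empty
    then show ?case using hom_zero[OF assms(1-3)] by simp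
  next
    case (insert b G)
    have "lcomb M G m c \<in> carrier M"
      using insert by (auto intro!: M.lcomb_closed)
    moreover have "(\<lambda>b. f (m b)) \<in> insert b G \<rightarrow> carrier N"
      using insert lmod_homD(1)[OF assms(3)] by auto
    ultimately show ?case
      using insert by (simp add: M.lcomb_insert N.lcomb_insert lmod_homD[OF assms(3)] M.smult_closed)
  qed
qed

text \<open>Coefficients vanish outside \<open>G\<close>, so elements are equal exactly when they
  agree on \<open>G\<close>. The index type is left open: lifting needs the type of the projective
  module, projective covers need \<open>nat\<close>.\<close>

definition free_module :: "('a, 'r) ring_scheme \<Rightarrow> 'i set \<Rightarrow> ('a, 'i \<Rightarrow> 'a) module" where
  "free_module R G =
     \<lparr>carrier = {c. (\<forall>b\<in>G. c b \<in> carrier R) \<and> (\<forall>b. b \<notin> G \<longrightarrow> c b = \<zero>\<^bsub>R\<^esub>)},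
      mult = undefined, one = undefined, zero = (\<lambda>_. \<zero>\<^bsub>R\<^esub>), add = (\<lambda>c d b. c b \<oplus>\<^bsub>R\<^esub> d b),
      smult = (\<lambda>a c b. a \<otimes>\<^bsub>R\<^esub> c b)\<rparr>"

lemma free_module_simps [simp]:
  "add (free_module R G) = (\<lambda>c d b. c b \<oplus>\<^bsub>R\<^esub> d b)"
  "zero (free_module R G) = (\<lambda>_. \<zero>\<^bsub>R\<^esub>)"
  "smult (free_module R G) = (\<lambda>a c b. a \<otimes>\<^bsub>R\<^esub> c b)"
  "c \<in> carrier (free_module R G) \<longleftrightarrow> (\<forall>b\<in>G. c b \<in> carrier R) \<and> (\<forall>b. b \<notin> G \<longrightarrow> c b = \<zero>\<^bsub>R\<^esub>)"
  by (auto simp: free_module_def)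

context ring
begin

abbreviation unit_vec :: "'i \<Rightarrow> 'i \<Rightarrow> 'a" where
  "unit_vec b \<equiv> (\<lambda>i. if i = b then \<one> else \<zero>)"

lemma free_module_mem_iff:
  "c \<in> carrier (free_module R G) \<longleftrightarrow> (\<forall>b. c b \<in> carrier R) \<and> (\<forall>b. b \<notin> G \<longrightarrow> c b = \<zero>)"
  by (metis free_module_simps(4) zero_closed)

lemma free_left_module: "left_module R (free_module R G)"
proof -
  have ag: "abelian_group (free_module R G)"
  proof (rule abelian_groupI)
    fix c assume "c \<in> carrier (free_module R G)"
    then show "\<exists>d\<in>carrier (free_module R G). d \<oplus>\<^bsub>free_module R G\<^esub> c = \<zero>\<^bsub>free_module R G\<^esub>"
      by (intro bexI[of _ "\<lambda>b. \<ominus> c b"])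
        (auto simp del: free_module_simps(4) simp: free_module_mem_iff l_neg)
  qed (auto simp del: free_module_simps(4) simp: free_module_mem_iff fun_eq_iff a_assoc intro: a_comm)
  show ?thesis
    by (intro left_module.intro ring_axioms ag left_module_axioms.intro)
       (auto simp del: free_module_simps(4) simp: free_module_mem_iff l_distr r_distr m_assoc)
qed

lemma free_module_expand:
  assumes "finite G" "c \<in> carrier (free_module R G)"
  shows "lcomb (free_module R G) G unit_vec c = c"
proof -
  interpret F: left_module R "free_module R G" by (rule free_left_module)
  \<comment> \<open>The induction runs over subsets \<open>H\<close> while the module stays
    \<open>free_module R G\<close>; a partial sum is \<open>c\<close> cut off outside
    \<open>H\<close>.\<close>
  have "lcomb (free_module R G) H unit_vec c = (\<lambda>i. if i \<in> H then c i else \<zero>)" if "H \<subseteq> G" for H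
    using finite_subset[OF that assms(1)] that
  proof (induction H rule: finite_induct)
    case (insert b H)
    then have "unit_vec \<in> insert b H \<rightarrow> carrier (free_module R G)" "c \<in> insert b H \<rightarrow> carrier R"
      using assms by auto
    with insert show ?case
      using assms(2) by (subst F.lcomb_insert) (auto simp: fun_eq_iff)
  qed simp
  from this[of G] show ?thesis using assms by (auto simp: fun_eq_iff)
qed

end

lemma lcomb_hom:
  assumes "left_module R M" "finite G" "m \<in> G \<rightarrow> carrier M"
  shows "lcomb M G m \<in> lmod_hom R (free_module R G) M"
proof -
  interpret left_module R M by fact
  show ?thesis
    using assms(2,3) by (intro lmod_homI) (auto intro!: lcomb_closed lcomb_add lcomb_smult)
qed

section \<open>Generating sets\<close>

text \<open>Generation is phrased through submodules, not linear combinations, because this passes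
  along homomorphisms by taking images and preimages of submodules.\<close>

definition gens :: "('a, 'r) ring_scheme \<Rightarrow> ('a, 'm, 's) module_scheme \<Rightarrow> 'm set \<Rightarrow> bool" where
  "gens R M G \<longleftrightarrow> finite G \<and> G \<subseteq> carrier M \<and> (\<forall>N. submodule N R M \<and> G \<subseteq> N \<longrightarrow> N = carrier M)"

lemma gensD: "\<lbrakk>gens R M G; submodule N R M; G \<subseteq> N\<rbrakk> \<Longrightarrow> N = carrier M"
  by (auto simp: gens_def)

definition fg_module :: "('a, 'r) ring_scheme \<Rightarrow> ('a, 'm) module \<Rightarrow> bool" where
  "fg_module R M \<longleftrightarrow> left_module R M \<and> (\<exists>G. gens R M G)"

definition num_gens :: "('a, 'r) ring_scheme \<Rightarrow> ('a, 'm) module \<Rightarrow> nat" where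
  "num_gens R M = (LEAST n. \<exists>G. gens R M G \<and> card G = n)"

lemma num_gens_le: "gens R M G \<Longrightarrow> num_gens R M \<le> card G"
  unfolding num_gens_def by (rule Least_le) blast

lemma minimal_gens:
  assumes "fg_module R M"
  obtains G where "gens R M G" "card G = num_gens R M" "\<And>b. b \<in> G \<Longrightarrow> \<not> gens R M (G - {b})"
proof -
  have "\<exists>n G. gens R M G \<and> card G = n" using assms by (auto simp: fg_module_def)
  then have "\<exists>G. gens R M G \<and> card G = num_gens R M"
    unfolding num_gens_def by (rule LeastI_ex)
  then obtain G where G: "gens R M G" "card G = num_gens R M" by blast
  moreover have "\<not> gens R M (G - {b})" if "b \<in> G" for b
  proof
    assume "gens R M (G - {b})"
    then have "num_gens R M \<le> card (G - {b})" by (rule num_gens_le)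
    moreover have "card (G - {b}) < card G"
      using G that by (intro psubset_card_mono) (auto simp: gens_def)
    ultimately show False using G by simp
  qed
  ultimately show thesis by (rule that)
qed

lemma (in left_module) lcomb_gens:
  assumes "finite G" "m \<in> G \<rightarrow> carrier M" "\<And>N. \<lbrakk>submodule N R M; m ` G \<subseteq> N\<rbrakk> \<Longrightarrow> N = carrier M"
    and "x \<in> carrier M"
  obtains c where "c \<in> G \<rightarrow> carrier R" "x = lcomb M G m c"
proof -
  have "submodule (carrier R) R (regular_module R)"
    using left_module.carrier_submodule[OF regular_left_module[OF R.ring_axioms]] by simp
  then have "submodule (lcomb M G m ` (G \<rightarrow> carrier R)) R M"
    using assms by (intro lcomb_submodule)
  moreover have "m ` G \<subseteq> lcomb M G m ` (G \<rightarrow> carrier R)"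
  proof
    fix y assume "y \<in> m ` G"
    then obtain b where "b \<in> G" "y = m b" by blast
    then have "y = lcomb M G m (unit_vec b)" using lcomb_unit[OF assms(1) _ assms(2)] by simp
    then show "y \<in> lcomb M G m ` (G \<rightarrow> carrier R)" by auto
  qed
  ultimately have "lcomb M G m ` (G \<rightarrow> carrier R) = carrier M" by (rule assms(3))
  then show thesis using assms(4) that by blast
qed

lemma (in left_module) gens_lcomb:
  assumes "gens R M G" "x \<in> carrier M"
  obtains c where "c \<in> G \<rightarrow> carrier R" "x = lcomb M G (\<lambda>b. b) c"
  by (rule lcomb_gens[of G "\<lambda>b. b" x]) (use assms in \<open>auto simp: gens_def\<close>)

lemma gens_image:
  assumes M: "left_module R M" and N: "left_module R N" and f: "f \<in> lmod_hom R M N"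
    and s: "f ` carrier M = carrier N" and G: "gens R M G"
  shows "gens R N (f ` G)"
  unfolding gens_def
proof (intro conjI allI impI)
  show "finite (f ` G)" "f ` G \<subseteq> carrier N" using G s by (auto simp: gens_def)
  fix X assume X: "submodule X R N \<and> f ` G \<subseteq> X"
  then have "{x \<in> carrier M. f x \<in> X} = carrier M"
    using G by (intro gensD[OF G vimage_submodule[OF M N f]]) (auto simp: gens_def)
  then have "f ` carrier M \<subseteq> X" by blast
  then show "X = carrier N" using X s submodule_subset[of X R N] by simp
qed

lemma num_gens_epi:
  assumes "fg_module R M" "left_module R N" "f \<in> lmod_hom R M N" "f ` carrier M = carrier N"
  shows "fg_module R N" "num_gens R N \<le> num_gens R M"
proof -
  obtain G where G: "gens R M G" "card G = num_gens R M" using minimal_gens[OF assms(1)] .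
  have g: "gens R N (f ` G)" using assms G by (auto simp: fg_module_def intro: gens_image)
  show "fg_module R N" using g assms by (auto simp: fg_module_def)
  show "num_gens R N \<le> num_gens R M"
    using num_gens_le[OF g] card_image_le[of G f] G by (auto simp: gens_def)
qed

lemma gens_lift:
  assumes s: "f ` carrier M = carrier N" and H: "gens R N H"
  obtains G where "finite G" "G \<subseteq> carrier M" "f ` G = H" "card G = card H"
proof -
  have "\<forall>h\<in>H. \<exists>x\<in>carrier M. f x = h"
  proof
    fix h assume "h \<in> H"
    then have "h \<in> f ` carrier M" using s H by (auto simp: gens_def)
    then show "\<exists>x\<in>carrier M. f x = h" by auto
  qed
  then obtain g where g: "\<And>h. h \<in> H \<Longrightarrow> g h \<in> carrier M \<and> f (g h) = h" by metis
  have "inj_on g H" using g by (metis inj_onI)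
  then show thesis using g H by (intro that[of "g ` H"]) (force simp: gens_def card_image)+
qed

text \<open>Generators of \<open>L\<close> and lifts of generators of \<open>N\<close> suffice: a
  submodule \<open>X\<close> containing them contains the kernel of \<open>g\<close> and maps onto
  \<open>N\<close>, so every element differs from one of \<open>X\<close> by an element of the
  kernel.\<close>

lemma num_gens_extension:
  assumes L: "fg_module R L" and N: "fg_module R N" and M: "left_module R M"
    and f: "f \<in> lmod_hom R L M" and g: "g \<in> lmod_hom R M N" and s: "g ` carrier M = carrier N"
    and ex: "f ` carrier L = a_kernel M N g"
  shows "fg_module R M" "num_gens R M \<le> num_gens R L + num_gens R N"
proof -
  interpret M: left_module R M by (rule M)
  have L': "left_module R L" and N': "left_module R N" using L N by (auto simp: fg_module_def)
  interpret N: left_module R N by (rule N')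
  obtain G where G: "gens R L G" "card G = num_gens R L" using minimal_gens[OF L] .
  obtain H where H: "gens R N H" "card H = num_gens R N" using minimal_gens[OF N] .
  obtain H' where H': "finite H'" "H' \<subseteq> carrier M" "g ` H' = H" "card H' = card H"
    using gens_lift[OF s H(1)] .
  have gG: "gens R M (f ` G \<union> H')"
    unfolding gens_def
  proof (intro conjI allI impI)
    show "finite (f ` G \<union> H')" "f ` G \<union> H' \<subseteq> carrier M"
      using G H' lmod_homD(1)[OF f] by (auto simp: gens_def)
    fix X assume X: "submodule X R M \<and> f ` G \<union> H' \<subseteq> X"
    then have XM: "submodule X R M" "X \<subseteq> carrier M" by (auto dest: submodule_subset)
    have "{x \<in> carrier L. f x \<in> X} = carrier L"
      using gensD[OF G(1) vimage_submodule[OF L' M f XM(1)]] X G by (auto simp: gens_def)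
    then have "f ` carrier L \<subseteq> X" by blast
    then have ker: "a_kernel M N g \<subseteq> X" using ex by simp
    have "g ` X = carrier N"
      using gensD[OF H(1) image_submodule[OF M N' g XM(1)]] X H'(3) by blast
    have "x \<in> X" if x: "x \<in> carrier M" for x
    proof -
      obtain y where y: "y \<in> X" "g y = g x"
        using \<open>g ` X = carrier N\<close> lmod_homD(1)[OF g x] by (metis imageE)
      have yM: "y \<in> carrier M" using y XM by blast
      have "g (x \<ominus>\<^bsub>M\<^esub> y) = \<zero>\<^bsub>N\<^esub>"
        using hom_minus[OF M N' g x yM] y lmod_homD(1)[OF g x] by (simp add: N.M.r_neg a_minus_def)
      then have "x \<ominus>\<^bsub>M\<^esub> y \<in> X" using ker x yM by (auto simp: mem_kernel_iff)
      then have "(x \<ominus>\<^bsub>M\<^esub> y) \<oplus>\<^bsub>M\<^esub> y \<in> X" using submodule_add[OF XM(1)] y by blast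
      then show ?thesis using x yM by (simp add: a_minus_def M.M.a_assoc M.M.l_neg)
    qed
    then show "X = carrier M" using XM by blast
  qed
  show "fg_module R M" using gG M by (auto simp: fg_module_def)
  have "card (f ` G \<union> H') \<le> card G + card H'"
    using card_Un_le[of "f ` G" H'] card_image_le[of G f] G by (auto simp: gens_def)
  then show "num_gens R M \<le> num_gens R L + num_gens R N"
    using num_gens_le[OF gG] G H H' by simp
qed

section \<open>Length\<close>

text \<open>A natural bound on chains inside a subset of a fixed module. It passes to smaller sets
  and to images without changing the module record, and avoids arithmetic with
  \<open>enat\<close>.\<close>

definition len_le :: "('a, 'r) ring_scheme \<Rightarrow> ('a, 'm, 's) module_scheme \<Rightarrow> 'm set \<Rightarrow> nat \<Rightarrow> bool" where
  "len_le R M X l \<longleftrightarrow>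
     (\<forall>n N. (\<forall>i\<le>n. submodule (N i) R M \<and> N i \<subseteq> X) \<and> (\<forall>i<n. N i \<subset> N (Suc i)) \<longrightarrow> n \<le> l)"

lemma len_leI:
  assumes "\<And>n N. \<lbrakk>\<And>i. i \<le> n \<Longrightarrow> submodule (N i) R M; \<And>i. i \<le> n \<Longrightarrow> N i \<subseteq> X;
      \<And>i. i < n \<Longrightarrow> N i \<subset> N (Suc i)\<rbrakk> \<Longrightarrow> n \<le> l"
  shows "len_le R M X l"
  unfolding len_le_def using assms by blast

lemma len_leD:
  assumes "len_le R M X l" "\<And>i. i \<le> n \<Longrightarrow> submodule (N i) R M" "\<And>i. i \<le> n \<Longrightarrow> N i \<subseteq> X"
    and "\<And>i. i < n \<Longrightarrow> N i \<subset> N (Suc i)"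
  shows "n \<le> l"
  using assms unfolding len_le_def by blast

lemma len_le_mono: "\<lbrakk>len_le R M X l; Y \<subseteq> X; l \<le> l'\<rbrakk> \<Longrightarrow> len_le R M Y l'"
  unfolding len_le_def by (meson order_trans)

lemma module_length_le_iff:
  "module_length R M \<le> enat l \<longleftrightarrow> len_le R M (carrier M) l"
proof -
  have sup: "Sup {enat n |n. P n} \<le> enat l \<longleftrightarrow> (\<forall>n. P n \<longrightarrow> n \<le> l)" for P
    by (auto simp: Sup_le_iff)
  have *: "(\<forall>i\<le>n. submodule (N i) R M \<and> N i \<subseteq> carrier M) \<longleftrightarrow> (\<forall>i\<le>n. submodule (N i) R M)" for n N
    by (auto dest: submodule_subset)
  show ?thesis
    unfolding module_length_def sup len_le_def * by blast
qed

lemma module_length_submodule_le_iff: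
  assumes "left_module R M" "submodule X R M"
  shows "module_length R (M\<lparr>carrier := X\<rparr>) \<le> enat l \<longleftrightarrow> len_le R M X l"
  unfolding module_length_le_iff len_le_def
  using left_module.submodule_of_submodule_iff[OF assms] by auto

text \<open>Preimages, cut down to \<open>X\<close>, turn a chain in the image into a chain in
  \<open>X\<close>; it stays strict because every element of the image comes from
  \<open>X\<close>.\<close>

lemma len_le_image:
  assumes M: "left_module R M" and N: "left_module R N" and f: "f \<in> lmod_hom R M N"
    and X: "submodule X R M" and l: "len_le R M X l"
  shows "len_le R N (f ` X) l"
proof (rule len_leI)
  interpret M: left_module R M by (rule M)
  fix n C
  assume C: "\<And>i. i \<le> n \<Longrightarrow> submodule (C i) R N" "\<And>i. i \<le> n \<Longrightarrow> C i \<subseteq> f ` X"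
    "\<And>i. i < n \<Longrightarrow> C i \<subset> C (Suc i)"
  show "n \<le> l"
  proof (rule len_leD[OF l, of n "\<lambda>i. X \<inter> {x \<in> carrier M. f x \<in> C i}"])
    show "submodule (X \<inter> {x \<in> carrier M. f x \<in> C i}) R M" if "i \<le> n" for i
      using M.inter_submodule[OF X vimage_submodule[OF M N f C(1)[OF that]]] .
    show "X \<inter> {x \<in> carrier M. f x \<in> C i} \<subset> X \<inter> {x \<in> carrier M. f x \<in> C (Suc i)}" if i: "i < n" for i
    proof -
      obtain y where y: "y \<in> C (Suc i)" "y \<notin> C i" using C(3)[OF i] by blast
      then obtain x where "x \<in> X" "y = f x" using C(2)[of "Suc i"] i by auto
      then have "x \<in> X \<inter> {x \<in> carrier M. f x \<in> C (Suc i)}" "x \<notin> X \<inter> {x \<in> carrier M. f x \<in> C i}"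
        using y submodule_subset[OF X] by auto
      then show ?thesis using C(3)[OF i] by blast
    qed
  qed auto
qed

text \<open>Deleting the repetitions of a weakly increasing chain leaves a strict chain with as many
  steps as the original had proper ones.\<close>

lemma len_le_steps:
  assumes l: "len_le R M X l" and W: "\<And>i. i \<le> n \<Longrightarrow> submodule (W i) R M" "\<And>i. i \<le> n \<Longrightarrow> W i \<subseteq> X"
    and inc: "\<And>i. i < n \<Longrightarrow> W i \<subseteq> W (Suc i)"
  shows "card {i. i < n \<and> W i \<noteq> W (Suc i)} \<le> l"
proof -
  define c where "c k = card {i. i < k \<and> W i \<noteq> W (Suc i)}" for k
  have c0: "c 0 = 0" by (simp add: c_def)
  have cSuc: "c (Suc k) = (if W k = W (Suc k) then c k else Suc (c k))" for k
  proof -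
    have "{i. i < Suc k \<and> W i \<noteq> W (Suc i)} =
        (if W k = W (Suc k) then {} else {k}) \<union> {i. i < k \<and> W i \<noteq> W (Suc i)}"
      by (auto simp: less_Suc_eq)
    then show ?thesis by (auto simp: c_def)
  qed
  \<comment> \<open>\<open>V\<close> is the chain thinned to its distinct members, indexed by the
    number of proper steps; it ends in \<open>W k\<close>, ready to be extended by
    \<open>W (Suc k)\<close>.\<close>
  have "\<exists>V. (\<forall>j\<le>c k. \<exists>i\<le>k. V j = W i) \<and> V (c k) = W k \<and> (\<forall>j<c k. V j \<subset> V (Suc j))" if "k \<le> n" for k
    using that
  proof (induction k)
    case 0
    show ?case by (intro exI[of _ W]) (auto simp: c0)
  next
    case (Suc k)
    obtain V where V: "\<And>j. j \<le> c k \<Longrightarrow> \<exists>i\<le>k. V j = W i" "V (c k) = W k" "\<And>j. j < c k \<Longrightarrow> V j \<subset> V (Suc j)"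
      using Suc.IH[OF Suc_leD[OF Suc.prems]] by blast
    show ?case
    proof (cases "W k = W (Suc k)")
      case True
      have "\<exists>i\<le>Suc k. V j = W i" if "j \<le> c k" for j
        using V(1)[OF that] le_SucI by blast
      then show ?thesis using V True cSuc by (intro exI[of _ V]) simp
    next
      case False
      have WW: "W k \<subset> W (Suc k)" using inc[of k] False Suc.prems by auto
      define V' where "V' = V(Suc (c k) := W (Suc k))"
      have "\<exists>i\<le>Suc k. V' j = W i" if "j \<le> Suc (c k)" for j
      proof (cases "j = Suc (c k)")
        case False
        then have "V' j = V j" "j \<le> c k" using that by (auto simp: V'_def)
        then show ?thesis using V(1)[of j] le_SucI by metis
      qed (auto simp: V'_def)
      moreover have "V' j \<subset> V' (Suc j)" if "j < Suc (c k)" for j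
        using that V(2) V(3)[of j] WW unfolding V'_def by (cases "j = c k") auto
      ultimately show ?thesis
        using cSuc False by (intro exI[of _ V']) (simp add: V'_def)
    qed
  qed
  from this[of n] obtain V where
    V: "\<And>j. j \<le> c n \<Longrightarrow> \<exists>i\<le>n. V j = W i" "\<And>j. j < c n \<Longrightarrow> V j \<subset> V (Suc j)" by blast
  have "c n \<le> l"
  proof (rule len_leD[OF l, of _ V])
    show "submodule (V j) R M" "V j \<subseteq> X" if "j \<le> c n" for j
      using V(1)[OF that] W by metis+
  qed (use V(2) in blast)
  then show ?thesis by (simp add: c_def)
qed

text \<open>Subadditivity of length. A submodule of the sum leaves two traces: its intersection with
  \<open>X\<close>, and in \<open>Y\<close> the intersection with \<open>C i + X\<close>, which
  stands for its image modulo \<open>X\<close>. Nested submodules with equal traces coincide, so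
  every step of a chain is proper in at least one trace.\<close>

lemma (in left_module) len_le_sum:
  assumes X: "submodule X R M" and Y: "submodule Y R M"
    and l: "len_le R M X l" and l': "len_le R M Y l'"
  shows "len_le R M (X <+>\<^bsub>M\<^esub> Y) (l + l')"
proof (rule len_leI)
  fix n C
  assume C: "\<And>i. i \<le> n \<Longrightarrow> submodule (C i) R M" "\<And>i. i \<le> n \<Longrightarrow> C i \<subseteq> X <+>\<^bsub>M\<^esub> Y"
    "\<And>i. i < n \<Longrightarrow> C i \<subset> C (Suc i)"
  define W where "W i = C i \<inter> X" for i
  define W' where "W' i = (C i <+>\<^bsub>M\<^esub> X) \<inter> Y" for i
  note XM = submodule_subset[OF X] and YM = submodule_subset[OF Y]
  have strict: "W i \<noteq> W (Suc i) \<or> W' i \<noteq> W' (Suc i)" if i: "i < n" for i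
  proof (rule ccontr)
    assume "\<not> (W i \<noteq> W (Suc i) \<or> W' i \<noteq> W' (Suc i))"
    then have eq: "W (Suc i) = W i" "W' (Suc i) = W' i" by auto
    have Ci: "submodule (C i) R M" and Cs: "submodule (C (Suc i)) R M" using C(1) i by auto
    note CiM = submodule_subset[OF Ci] and CsM = submodule_subset[OF Cs]
    have sub: "C i \<subseteq> C (Suc i)" using C(3)[OF i] by blast
    \<comment> \<open>The modular law by elements. Write \<open>z = x + y\<close>. Then
      \<open>y\<close> lies in the second trace of \<open>C (Suc i)\<close>, hence in that of
      \<open>C i\<close>, so \<open>y = n' + x'\<close>. Now \<open>z - n' = x + x'\<close> lies in
      the first trace of \<open>C (Suc i)\<close>, hence in \<open>C i\<close>.\<close>
    have "z \<in> C i" if z: "z \<in> C (Suc i)" for z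
    proof -
      obtain x y where xy: "x \<in> X" "y \<in> Y" "z = x \<oplus>\<^bsub>M\<^esub> y"
        using C(2)[of "Suc i"] i z unfolding subset_iff mem_set_add_iff by (metis Suc_leI)
      have mem: "x \<in> carrier M" "y \<in> carrier M" "z \<in> carrier M" using xy z XM YM CsM by auto
      have "y = z \<oplus>\<^bsub>M\<^esub> (\<ominus>\<^bsub>M\<^esub> x)" using xy(3) mem by (simp add: M.a_comm[of x y] M.a_assoc M.r_neg)
      then have "y \<in> W' (Suc i)"
        unfolding W'_def using xy z submodule_neg[OF X] by (auto simp: mem_set_add_iff)
      then have "y \<in> W' i" using eq by simp
      then obtain n' x' where n': "n' \<in> C i" "x' \<in> X" "y = n' \<oplus>\<^bsub>M\<^esub> x'"
        unfolding W'_def by (auto simp: mem_set_add_iff)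
      have mem': "n' \<in> carrier M" "x' \<in> carrier M" using n' XM CiM by auto
      have "z = (x \<oplus>\<^bsub>M\<^esub> x') \<oplus>\<^bsub>M\<^esub> n'" using xy(3) n'(3) mem mem' by (simp add: M.a_ac)
      then have e: "z \<ominus>\<^bsub>M\<^esub> n' = x \<oplus>\<^bsub>M\<^esub> x'"
        using mem mem' by (simp add: a_minus_def M.a_assoc M.r_neg)
      have "z \<ominus>\<^bsub>M\<^esub> n' \<in> C (Suc i)" using submodule_minus[OF Cs z] n' sub by blast
      moreover have "z \<ominus>\<^bsub>M\<^esub> n' \<in> X" unfolding e using submodule_add[OF X] xy n' by blast
      ultimately have "z \<ominus>\<^bsub>M\<^esub> n' \<in> C i" using eq unfolding W_def by blast
      then have "(z \<ominus>\<^bsub>M\<^esub> n') \<oplus>\<^bsub>M\<^esub> n' \<in> C i" using submodule_add[OF Ci] n' by blast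
      then show ?thesis using mem mem' by (simp add: a_minus_def M.a_assoc M.l_neg)
    qed
    then show False using C(3)[OF i] by blast
  qed
  have "{..<n} = {i. i < n \<and> W i \<noteq> W (Suc i)} \<union> {i. i < n \<and> W' i \<noteq> W' (Suc i)}"
    using strict by auto
  then have "n = card ({i. i < n \<and> W i \<noteq> W (Suc i)} \<union> {i. i < n \<and> W' i \<noteq> W' (Suc i)})"
    using card_lessThan[of n] by simp
  then have "n \<le> card {i. i < n \<and> W i \<noteq> W (Suc i)} + card {i. i < n \<and> W' i \<noteq> W' (Suc i)}"
    using card_Un_le[of "{i. i < n \<and> W i \<noteq> W (Suc i)}" "{i. i < n \<and> W' i \<noteq> W' (Suc i)}"] by simp
  moreover have "card {i. i < n \<and> W i \<noteq> W (Suc i)} \<le> l"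
  proof (rule len_le_steps[OF l])
    show "submodule (W i) R M" if "i \<le> n" for i
      unfolding W_def using inter_submodule[OF C(1)[OF that] X] .
    show "W i \<subseteq> W (Suc i)" if "i < n" for i using C(3)[OF that] unfolding W_def by blast
  qed (simp add: W_def)
  moreover have "card {i. i < n \<and> W' i \<noteq> W' (Suc i)} \<le> l'"
  proof (rule len_le_steps[OF l'])
    show "submodule (W' i) R M" if "i \<le> n" for i
      unfolding W'_def using inter_submodule[OF sum_submodule[OF C(1)[OF that] X] Y] .
    show "W' i \<subseteq> W' (Suc i)" if "i < n" for i
    proof
      fix y assume "y \<in> W' i"
      moreover have "C i \<subseteq> C (Suc i)" using C(3)[OF that] by blast
      ultimately show "y \<in> W' (Suc i)" unfolding W'_def Int_iff mem_set_add_iff by blast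
    qed
  qed (simp add: W'_def)
  ultimately show "n \<le> l + l'" by linarith
qed

lemma (in left_module) len_le_zero: "len_le R M {\<zero>\<^bsub>M\<^esub>} 0"
proof (rule len_leI)
  fix n C
  assume C: "\<And>i. i \<le> n \<Longrightarrow> submodule (C i) R M" "\<And>i. i \<le> n \<Longrightarrow> C i \<subseteq> {\<zero>\<^bsub>M\<^esub>}"
    "\<And>i. i < n \<Longrightarrow> C i \<subset> C (Suc i)"
  show "n \<le> 0"
  proof (rule ccontr)
    assume "\<not> n \<le> 0"
    then show False using C(3)[of 0] C(2)[of 1] submodule_zero[OF C(1)[of 0]] by auto
  qed
qed

text \<open>The combinations lie in the sum of the images of \<open>I\<close> under right
  multiplication onto the single members of \<open>G\<close>, so the bounds add up by
  \<open>len_le_sum\<close>.\<close>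

lemma len_le_lcomb:
  fixes R :: "('a, 'r) ring_scheme" (structure) and M :: "('a, 'm) module"
  assumes M: "left_module R M" and I: "submodule I R (regular_module R)"
    and G: "finite G" "G \<subseteq> carrier M"
    and l: "\<And>b. b \<in> G \<Longrightarrow> len_le R M ((\<lambda>a. a \<odot>\<^bsub>M\<^esub> b) ` I) l"
  shows "len_le R M (lcomb M G (\<lambda>b. b) ` (G \<rightarrow> I)) (card G * l)"
proof -
  interpret left_module R M by (rule M)
  have IR: "I \<subseteq> carrier R" using submodule_subset[OF I] by simp
  show ?thesis using G l
  proof (induction G rule: finite_induct)
    case empty
    then show ?case using len_le_zero by (auto intro: len_le_mono)
  next
    case (insert b G)
    have 1: "submodule ((\<lambda>a. a \<odot>\<^bsub>M\<^esub> b) ` I) R M"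
      by (rule image_submodule[OF regular_left_module[OF R.ring_axioms] M smult_hom[OF M] I])
         (use insert in auto)
    have 2: "submodule (lcomb M G (\<lambda>b. b) ` (G \<rightarrow> I)) R M"
      by (rule lcomb_submodule[OF _ _ I]) (use insert in auto)
    have "lcomb M (insert b G) (\<lambda>b. b) ` (insert b G \<rightarrow> I)
        \<subseteq> (\<lambda>a. a \<odot>\<^bsub>M\<^esub> b) ` I <+>\<^bsub>M\<^esub> lcomb M G (\<lambda>b. b) ` (G \<rightarrow> I)"
    proof
      fix x assume "x \<in> lcomb M (insert b G) (\<lambda>b. b) ` (insert b G \<rightarrow> I)"
      then obtain c where c: "c \<in> insert b G \<rightarrow> I" "x = lcomb M (insert b G) (\<lambda>b. b) c" by blast
      have "x = c b \<odot>\<^bsub>M\<^esub> b \<oplus>\<^bsub>M\<^esub> lcomb M G (\<lambda>b. b) c"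
        unfolding c(2) by (rule lcomb_insert) (use insert c(1) IR in auto)
      moreover have "c \<in> G \<rightarrow> I" "c b \<in> I" using c(1) by auto
      ultimately show "x \<in> (\<lambda>a. a \<odot>\<^bsub>M\<^esub> b) ` I <+>\<^bsub>M\<^esub> lcomb M G (\<lambda>b. b) ` (G \<rightarrow> I)"
        unfolding mem_set_add_iff by blast
    qed
    moreover have "len_le R M ((\<lambda>a. a \<odot>\<^bsub>M\<^esub> b) ` I <+>\<^bsub>M\<^esub> lcomb M G (\<lambda>b. b) ` (G \<rightarrow> I)) (l + card G * l)"
      by (rule len_le_sum[OF 1 2]) (use insert in auto)
    ultimately show ?case
      using insert by (auto intro: len_le_mono)
  qed
qed

text \<open>A nonzero element \<open>a b\<close> gives back \<open>b\<close> through a left inverse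
  of \<open>a\<close>, so the cyclic module is zero or simple. This serves both for lines over a
  field and for cyclic submodules of the top over a local ring.\<close>

lemma len_le_cyclic:
  fixes R :: "('a, 'r) ring_scheme" (structure) and M :: "('a, 'm) module"
  assumes M: "left_module R M" and b: "b \<in> carrier M"
    and inv: "\<And>a. \<lbrakk>a \<in> carrier R; a \<odot>\<^bsub>M\<^esub> b \<noteq> \<zero>\<^bsub>M\<^esub>\<rbrakk> \<Longrightarrow> \<exists>a'\<in>carrier R. a' \<otimes>\<^bsub>R\<^esub> a = \<one>\<^bsub>R\<^esub>"
  shows "len_le R M ((\<lambda>a. a \<odot>\<^bsub>M\<^esub> b) ` carrier R) 1"
proof (rule len_leI)
  interpret left_module R M by (rule M)
  fix n C
  assume C: "\<And>i. i \<le> n \<Longrightarrow> submodule (C i) R M" "\<And>i. i \<le> n \<Longrightarrow> C i \<subseteq> (\<lambda>a. a \<odot>\<^bsub>M\<^esub> b) ` carrier R"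
    "\<And>i. i < n \<Longrightarrow> C i \<subset> C (Suc i)"
  show "n \<le> 1"
  proof (rule ccontr)
    assume n: "\<not> n \<le> 1"
    then obtain x where x: "x \<in> C 1" "x \<notin> C 0" using C(3)[of 0] by auto
    then have "x \<noteq> \<zero>\<^bsub>M\<^esub>" using submodule_zero[OF C(1)[of 0]] by auto
    moreover obtain a where a: "a \<in> carrier R" "x = a \<odot>\<^bsub>M\<^esub> b" using C(2)[of 1] x n by auto
    ultimately obtain a' where a': "a' \<in> carrier R" "a' \<otimes> a = \<one>" using inv by blast
    have "a' \<odot>\<^bsub>M\<^esub> x \<in> C 1" using submodule_smult[OF C(1)[of 1] a'(1) x(1)] n by simp
    moreover have "a' \<odot>\<^bsub>M\<^esub> x = b"
      using a a' b smult_assoc[of a' a b] by (simp add: smult_one)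
    ultimately have bC: "b \<in> C 1" by simp
    have "C 2 \<subseteq> C 1"
    proof
      fix y assume "y \<in> C 2"
      then obtain d where "d \<in> carrier R" "y = d \<odot>\<^bsub>M\<^esub> b" using C(2)[of 2] n by auto
      then show "y \<in> C 1" using submodule_smult[OF C(1)[of 1] _ bC] n by simp
    qed
    then show False using C(3)[of 1] n by (auto simp: numeral_2_eq_2)
  qed
qed

lemma (in left_module) len_le_psubset:
  assumes l: "len_le R M X l" and X: "submodule X R M" and Y: "submodule Y R M" and YX: "Y \<subset> X"
  shows "l > 0" "len_le R M Y (l - 1)"
proof -
  have *: "Suc n \<le> l" if C: "\<And>i. i \<le> n \<Longrightarrow> submodule (C i) R M" "\<And>i. i \<le> n \<Longrightarrow> C i \<subseteq> Y"
    "\<And>i. i < n \<Longrightarrow> C i \<subset> C (Suc i)" for n C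
  proof (rule len_leD[OF l, of "Suc n" "C(Suc n := X)"])
    show "submodule ((C(Suc n := X)) i) R M" "(C(Suc n := X)) i \<subseteq> X" if "i \<le> Suc n" for i
      using that C(1)[of i] C(2)[of i] X YX by (auto simp: le_Suc_eq)
    show "(C(Suc n := X)) i \<subset> (C(Suc n := X)) (Suc i)" if "i < Suc n" for i
      using that C(2)[of i] C(3)[of i] YX by (auto simp: less_Suc_eq)
  qed
  show "l > 0" using *[of 0 "\<lambda>_. Y"] Y by simp
  show "len_le R M Y (l - 1)"
  proof (rule len_leI)
    fix n C
    assume "\<And>i. i \<le> n \<Longrightarrow> submodule (C i) R M" "\<And>i. i \<le> n \<Longrightarrow> C i \<subseteq> Y"
      "\<And>i. i < n \<Longrightarrow> C i \<subset> C (Suc i)"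
    then show "n \<le> l - 1" using *[of n C] by fastforce
  qed
qed

lemma (in left_module) span_submodule:
  assumes "H \<subseteq> carrier M"
  defines "X \<equiv> \<Inter>{N. submodule N R M \<and> H \<subseteq> N}"
  shows "submodule X R M" "H \<subseteq> X" "\<And>N. \<lbrakk>submodule N R M; H \<subseteq> N\<rbrakk> \<Longrightarrow> X \<subseteq> N"
proof -
  show "submodule X R M" unfolding X_def
    by (rule Inter_submodule) (use carrier_submodule assms(1) in auto)
qed (auto simp: X_def)

text \<open>As long as the chosen elements do not generate, an element outside their span enlarges
  the span properly. The spans form a chain, so \<open>l\<close> choices are enough. This is the
  passage from length back to generators.\<close>

lemma (in left_module) len_le_gens:
  assumes l: "len_le R M (carrier M) l"
  obtains G where "gens R M G" "card G \<le> l"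
proof -
  define sp where "sp H = \<Inter>{N. submodule N R M \<and> H \<subseteq> N}" for H
  note sp = span_submodule[folded sp_def]
  \<comment> \<open>Invariant after \<open>k\<close> choices: either a generating set has been
    reached, or the spans form a chain of \<open>k\<close> proper steps ending in the span of the
    current set.\<close>
  have step: "\<exists>G C. gens R M G \<and> card G \<le> k \<or>
      finite G \<and> G \<subseteq> carrier M \<and> card G \<le> k \<and> C k = sp G \<and>
      (\<forall>i\<le>k. submodule (C i) R M) \<and> (\<forall>i<k. C i \<subset> C (Suc i))" for k
  proof (induction k)
    case 0
    show ?case
      using sp(1)[of "{}"] by (intro exI[of _ "{}"] exI[of _ "\<lambda>_. sp {}"]) auto
  next
    case (Suc k)
    then consider G where "gens R M G" "card G \<le> k"
      | G C where "finite G" "G \<subseteq> carrier M" "card G \<le> k" "C k = sp G"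
         "\<And>i. i \<le> k \<Longrightarrow> submodule (C i) R M" "\<And>i. i < k \<Longrightarrow> C i \<subset> C (Suc i)"
      by blast
    then show ?case
    proof cases
      case 1
      then show ?thesis by (intro exI[of _ G] exI disjI1) auto
    next
      case 2
      show ?thesis
      proof (cases "sp G = carrier M")
        case True
        have "N = carrier M" if "submodule N R M" "G \<subseteq> N" for N
          using sp(3)[OF 2(2) that] True submodule_subset[OF that(1)] by blast
        then have "gens R M G"
          using 2 by (auto simp: gens_def)
        then show ?thesis using 2 by (intro exI[of _ G] exI disjI1) auto
      next
        case False
        then obtain x where x: "x \<in> carrier M" "x \<notin> sp G"
          using submodule_subset[OF sp(1)[OF 2(2)]] by auto
        have xG: "insert x G \<subseteq> carrier M" using x 2 by auto
        have "sp G \<subset> sp (insert x G)"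
          using sp(3)[OF 2(2) sp(1)[OF xG]] sp(2)[OF xG] x by blast
        moreover have "card (insert x G) \<le> Suc k" using 2 by (simp add: card_insert_if)
        ultimately show ?thesis
          using 2 xG sp(1)[OF xG]
          by (intro exI[of _ "insert x G"] exI[of _ "C(Suc k := sp (insert x G))"] disjI2)
             (auto simp: less_Suc_eq le_Suc_eq)
      qed
    qed
  qed
  from step[of l] consider G where "gens R M G" "card G \<le> l"
      | G C where "finite G" "G \<subseteq> carrier M" "card G \<le> l" "C l = sp G"
         "\<And>i. i \<le> l \<Longrightarrow> submodule (C i) R M" "\<And>i. i < l \<Longrightarrow> C i \<subset> C (Suc i)"
      by blast
  then show thesis
  proof cases
    case 1
    then show ?thesis by (rule that)
  next
    case 2
    have "gens R M G"
    proof (rule ccontr)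
      assume "\<not> gens R M G"
      then obtain N where N: "submodule N R M" "G \<subseteq> N" "N \<noteq> carrier M" using 2 by (auto simp: gens_def)
      \<comment> \<open>Appending the whole module would give a chain with \<open>l + 1\<close>
        proper steps.\<close>
      then have "C l \<subset> carrier M"
        using sp(3)[OF 2(2) N(1,2)] submodule_subset[OF N(1)] unfolding 2(4) by blast
      then have "Suc l \<le> l"
        using 2(5) 2(6)[THEN less_imp_le] 2(6)[THEN less_imp_neq] carrier_submodule
        by (intro len_leD[OF l, of "Suc l" "C(Suc l := carrier M)"] submodule_subset)
           (auto simp: less_Suc_eq le_Suc_eq)
      then show False by simp
    qed
    then show ?thesis using 2 by (intro that)
  qed
qed

definition max_submodule :: "('a, 'r) ring_scheme \<Rightarrow> ('a, 'm, 's) module_scheme \<Rightarrow> 'm set \<Rightarrow> bool" where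
  "max_submodule R M N \<longleftrightarrow> submodule N R M \<and> N \<noteq> carrier M \<and>
     (\<forall>N'. submodule N' R M \<and> N \<subseteq> N' \<longrightarrow> N' = N \<or> N' = carrier M)"

text \<open>Bounded chains take the place of Zorn's lemma: if nothing above \<open>N\<close> were
  maximal, one could climb \<open>l + 1\<close> proper steps.\<close>

lemma (in left_module) max_submodule_exists:
  assumes l: "len_le R M (carrier M) l" and N: "submodule N R M" "N \<noteq> carrier M"
  obtains N' where "max_submodule R M N'" "N \<subseteq> N'"
proof -
  have "\<exists>N'. max_submodule R M N' \<and> N \<subseteq> N'"
  proof (rule ccontr)
    assume no: "\<nexists>N'. max_submodule R M N' \<and> N \<subseteq> N'"
    have "\<exists>C. (\<forall>i\<le>k. submodule (C i) R M) \<and> (\<forall>i<k. C i \<subset> C (Suc i)) \<and> N \<subseteq> C k \<and> C k \<noteq> carrier M" for k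
    proof (induction k)
      case 0
      show ?case using N by (intro exI[of _ "\<lambda>_. N"]) auto
    next
      case (Suc k)
      then obtain C where C: "\<forall>i\<le>k. submodule (C i) R M" "\<forall>i<k. C i \<subset> C (Suc i)"
        "N \<subseteq> C k" "C k \<noteq> carrier M" by blast
      have "\<not> max_submodule R M (C k)" using no C(3) by blast
      then obtain N' where "submodule N' R M" "C k \<subseteq> N'" "N' \<noteq> C k" "N' \<noteq> carrier M"
        using C unfolding max_submodule_def by blast
      then show ?case
        using C by (intro exI[of _ "C(Suc k := N')"]) (auto simp: less_Suc_eq le_Suc_eq)
    qed
    from this[of "Suc l"] obtain C where
      "\<forall>i\<le>Suc l. submodule (C i) R M" "\<forall>i<Suc l. C i \<subset> C (Suc i)" by blast
    then have "Suc l \<le> l" by (intro len_leD[OF l, of "Suc l" C]) (auto dest: submodule_subset)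
    then show False by simp
  qed
  then show thesis using that by blast
qed

section \<open>Local rings of finite length\<close>

text \<open>The ground field survives only through \<open>d\<close>, a bound on the chains of left
  ideals.\<close>

locale finite_length_local_ring = ring R for R :: "('a, 'r) ring_scheme" (structure) +
  fixes d :: nat
  assumes ex1_maximal: "\<exists>!I. maximal_left_ideal R I"
    and length_le: "len_le R (regular_module R) (carrier R) d"
begin

abbreviation J :: "'a set" where
  "J \<equiv> jacobson_radical R"

lemma maximal_left_ideal_iff: "maximal_left_ideal R I \<longleftrightarrow> I = J"
proof -
  obtain I0 where I0: "maximal_left_ideal R I0" "\<And>I. maximal_left_ideal R I \<Longrightarrow> I = I0"
    using ex1_maximal by blast
  then have "{I. maximal_left_ideal R I} = {I0}" by blast
  moreover have "I0 \<subseteq> carrier R"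
    using I0(1) submodule_subset[of I0 R "regular_module R"] by (auto simp: maximal_left_ideal_def)
  ultimately have "J = I0" by (auto simp: jacobson_radical_def)
  then show ?thesis using I0 by blast
qed

lemma regular: "left_module R (regular_module R)"
  by (rule regular_left_module[OF ring_axioms])

lemma J_submodule: "submodule J R (regular_module R)"
  using maximal_left_ideal_iff[of J] by (auto simp: maximal_left_ideal_def)

lemma J_subset: "j \<in> J \<Longrightarrow> j \<in> carrier R"
  using submodule_subset[OF J_submodule] by auto

text \<open>If \<open>R x\<close> were proper, it would lie in a maximal left ideal, hence in the
  radical, and so would \<open>x\<close>.\<close>

lemma left_inverse:
  assumes x: "x \<in> carrier R" "x \<notin> J"
  obtains y where "y \<in> carrier R" "y \<otimes> x = \<one>"
proof -
  interpret L: left_module R "regular_module R" by (rule regular)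
  let ?X = "(\<lambda>a. a \<otimes> x) ` carrier R"
  have X: "submodule ?X R (regular_module R)"
    using image_submodule[OF regular regular smult_hom[OF regular, of x] L.carrier_submodule] x by simp
  have "?X = carrier R"
  proof (rule ccontr)
    assume "?X \<noteq> carrier R"
    then obtain N where N: "max_submodule R (regular_module R) N" "?X \<subseteq> N"
      using L.max_submodule_exists[OF _ X] length_le by auto
    then have "maximal_left_ideal R N" by (auto simp: max_submodule_def maximal_left_ideal_def)
    then have "?X \<subseteq> J" using N maximal_left_ideal_iff by blast
    moreover have "x \<in> ?X" using x by (intro image_eqI[of _ _ \<one>]) auto
    ultimately show False using x by blast
  qed
  then have "\<one> \<in> ?X" by simp
  then show thesis using that by auto
qed

text \<open>The quotient by \<open>N\<close> is simple, so the annihilator of the class of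
  \<open>x\<close> is a maximal left ideal, and locality leaves only \<open>J\<close>. Consequently
  \<open>J\<close> maps \<open>M\<close> into every maximal submodule, and the residue module is the
  only simple quotient.\<close>

lemma max_submodule_annihilator:
  fixes M :: "('a, 'm) module"
  assumes M: "left_module R M" and N: "max_submodule R M N" and x: "x \<in> carrier M" "x \<notin> N"
  shows "{a \<in> carrier R. a \<odot>\<^bsub>M\<^esub> x \<in> N} = J"
proof -
  interpret M: left_module R M by (rule M)
  have N': "submodule N R M" using N by (simp add: max_submodule_def)
  let ?I = "{a \<in> carrier R. a \<odot>\<^bsub>M\<^esub> x \<in> N}"
  have I: "submodule ?I R (regular_module R)"
    using vimage_submodule[OF regular M smult_hom[OF M x(1)] N'] by simp
  have "maximal_left_ideal R ?I"
    unfolding maximal_left_ideal_def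
  proof (intro conjI allI impI I)
    have "\<one> \<notin> ?I" using x by (simp add: M.smult_one)
    then show "?I \<noteq> carrier R" by blast
    fix L assume L: "submodule L R (regular_module R) \<and> ?I \<subseteq> L"
    show "L = ?I \<or> L = carrier R"
    proof (rule disjCI)
      assume "L \<noteq> carrier R"
      have LR: "L \<subseteq> carrier R" using L submodule_subset[of L R "regular_module R"] by simp
      \<comment> \<open>If \<open>l x\<close> is outside \<open>N\<close>, maximality gives
        \<open>x = n + a l x\<close>, so \<open>1 - a l\<close> takes \<open>x\<close> into
        \<open>N\<close> and belongs to \<open>L\<close>; adding \<open>a l\<close> puts 1 into
        \<open>L\<close>.\<close>
      have "l \<in> ?I" if l: "l \<in> L" for l
      proof (rule ccontr)
        assume "l \<notin> ?I"
        have lR: "l \<in> carrier R" using l LR by blast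
        have lx: "l \<odot>\<^bsub>M\<^esub> x \<notin> N" "l \<odot>\<^bsub>M\<^esub> x \<in> carrier M"
          using \<open>l \<notin> ?I\<close> lR x by (auto intro: M.smult_closed)
        let ?Y = "(\<lambda>a. a \<odot>\<^bsub>M\<^esub> (l \<odot>\<^bsub>M\<^esub> x)) ` carrier R"
        have Y: "submodule ?Y R M"
          using image_submodule[OF regular M smult_hom[OF M lx(2)] left_module.carrier_submodule[OF regular]]
          by simp
        have "l \<odot>\<^bsub>M\<^esub> x \<in> ?Y" using lx by (intro image_eqI[of _ _ \<one>]) (auto simp: M.smult_one)
        then have "N <+>\<^bsub>M\<^esub> ?Y \<noteq> N" using M.sum_submodule_upper(2)[OF N' Y] lx by blast
        then have "N <+>\<^bsub>M\<^esub> ?Y = carrier M"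
          using N M.sum_submodule[OF N' Y] M.sum_submodule_upper(1)[OF N' Y]
          by (auto simp: max_submodule_def)
        then have "x \<in> N <+>\<^bsub>M\<^esub> ?Y" using x(1) by simp
        then obtain n a where na: "n \<in> N" "a \<in> carrier R" "x = n \<oplus>\<^bsub>M\<^esub> a \<odot>\<^bsub>M\<^esub> (l \<odot>\<^bsub>M\<^esub> x)"
          by (auto simp: mem_set_add_iff)
        have al: "a \<otimes> l \<in> L" using submodule_smult[of L R "regular_module R" a l] L na l by simp
        have nM: "n \<in> carrier M" using na submodule_subset[OF N'] by blast
        have "(\<one> \<ominus> a \<otimes> l) \<odot>\<^bsub>M\<^esub> x = x \<ominus>\<^bsub>M\<^esub> a \<odot>\<^bsub>M\<^esub> (l \<odot>\<^bsub>M\<^esub> x)"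
          using x na lR
          by (simp add: a_minus_def M.smult_l_distr M.smult_l_minus M.smult_one M.smult_assoc)
        also have "\<dots> = (n \<oplus>\<^bsub>M\<^esub> a \<odot>\<^bsub>M\<^esub> (l \<odot>\<^bsub>M\<^esub> x)) \<ominus>\<^bsub>M\<^esub> a \<odot>\<^bsub>M\<^esub> (l \<odot>\<^bsub>M\<^esub> x)"
          using na(3) by simp
        also have "\<dots> = n"
          using nM na(2) lx(2) by (simp add: a_minus_def M.M.a_assoc M.M.r_neg M.smult_closed)
        finally have "\<one> \<ominus> a \<otimes> l \<in> ?I" using na lR by simp
        then have "(\<one> \<ominus> a \<otimes> l) \<oplus> a \<otimes> l \<in> L"
          using submodule_add[of L R "regular_module R"] L al by auto
        then have "\<one> \<in> L" using na lR by (simp add: a_minus_def a_assoc l_neg)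
        then have "carrier R \<subseteq> L" using submodule_smult[of L R "regular_module R" _ \<one>] L by fastforce
        then show False using LR \<open>L \<noteq> carrier R\<close> by blast
      qed
      then show "L = ?I" using L by blast
    qed
  qed
  then show ?thesis by (rule maximal_left_ideal_iff[THEN iffD1])
qed

lemma fg_length:
  assumes "fg_module R M" shows "len_le R M (carrier M) (num_gens R M * d)"
proof -
  have M: "left_module R M" using assms by (simp add: fg_module_def)
  then interpret M: left_module R M .
  obtain G where G: "gens R M G" "card G = num_gens R M" using minimal_gens[OF assms] .
  have fin: "finite G" "G \<subseteq> carrier M" using G by (auto simp: gens_def)
  have sub: "submodule (carrier R) R (regular_module R)"
    using left_module.carrier_submodule[OF regular] by simp
  have "len_le R M (lcomb M G (\<lambda>b. b) ` (G \<rightarrow> carrier R)) (card G * d)"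
  proof (rule len_le_lcomb[OF M sub fin])
    fix b assume "b \<in> G"
    then show "len_le R M ((\<lambda>a. a \<odot>\<^bsub>M\<^esub> b) ` carrier R) d"
      using fin by (intro len_le_image[OF regular M smult_hom[OF M] sub length_le]) auto
  qed
  moreover have "carrier M \<subseteq> lcomb M G (\<lambda>b. b) ` (G \<rightarrow> carrier R)"
  proof
    fix x assume "x \<in> carrier M"
    then show "x \<in> lcomb M G (\<lambda>b. b) ` (G \<rightarrow> carrier R)" using M.gens_lcomb[OF G(1)] by blast
  qed
  ultimately show ?thesis using G(2) by (auto intro: len_le_mono)
qed

text \<open>A bound on the length passes to submodules, a bound on the number of generators does
  not. Hence the detour from generators to length, down to \<open>N\<close>, and back to
  generators.\<close>

lemma fg_submodule:
  assumes M: "fg_module R M" and N: "submodule N R M"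
  shows "fg_module R (M\<lparr>carrier := N\<rparr>)"
proof -
  interpret M: left_module R M using M by (simp add: fg_module_def)
  have N': "left_module R (M\<lparr>carrier := N\<rparr>)" by (rule M.submodule_left_module[OF N])
  have "len_le R M N (num_gens R M * d)"
    using len_le_mono[OF fg_length[OF M] submodule_subset[OF N]] by simp
  then have "len_le R (M\<lparr>carrier := N\<rparr>) N (num_gens R M * d)"
    unfolding len_le_def M.submodule_of_submodule_iff[OF N] by blast
  then obtain G where "gens R (M\<lparr>carrier := N\<rparr>) G"
    using left_module.len_le_gens[OF N', of "num_gens R M * d"] by auto
  then show ?thesis using N' by (auto simp: fg_module_def)
qed

lemma finite_length_imp_fg: "finite_length_module R M \<Longrightarrow> fg_module R M"
proof -
  assume M: "finite_length_module R M"
  then obtain l where "module_length R M = enat l" by (auto simp: finite_length_module_def)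
  then have "len_le R M (carrier M) l" using module_length_le_iff[of R M l] by simp
  then show ?thesis
    using M left_module.len_le_gens[of R M l] by (metis fg_module_def finite_length_module_def)
qed

lemma max_submodule_fg:
  assumes "fg_module R M" "submodule N R M" "N \<noteq> carrier M"
  obtains N' where "max_submodule R M N'" "N \<subseteq> N'"
  using left_module.max_submodule_exists[OF _ fg_length[OF assms(1)] assms(2,3)] assms(1)
  by (auto simp: fg_module_def)

text \<open>The last premise says that \<open>N\<close> and the products \<open>j x\<close> together
  generate \<open>M\<close>. A proper \<open>N\<close> would lie in a maximal submodule, which
  contains all these products by \<open>max_submodule_annihilator\<close>.\<close>

lemma nakayama:
  assumes M: "fg_module R M" and N: "submodule N R M"
    and all: "\<And>X. \<lbrakk>submodule X R M; N \<subseteq> X; \<And>j x. \<lbrakk>j \<in> J; x \<in> carrier M\<rbrakk> \<Longrightarrow> j \<odot>\<^bsub>M\<^esub> x \<in> X\<rbrakk>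
      \<Longrightarrow> X = carrier M"
  shows "N = carrier M"
proof (rule ccontr)
  have M': "left_module R M" using M by (simp add: fg_module_def)
  assume "N \<noteq> carrier M"
  then obtain X where X: "max_submodule R M X" "N \<subseteq> X" using max_submodule_fg[OF M N] by blast
  have X': "submodule X R M" using X by (simp add: max_submodule_def)
  have "j \<odot>\<^bsub>M\<^esub> x \<in> X" if "j \<in> J" "x \<in> carrier M" for j x
  proof (cases "x \<in> X")
    case True
    then show ?thesis using submodule_smult[OF X' J_subset] that by blast
  next
    case False
    then show ?thesis using max_submodule_annihilator[OF M' X(1) that(2)] that(1) by blast
  qed
  then have "X = carrier M" using all[OF X' X(2)] by blast
  then show False using X by (simp add: max_submodule_def)
qed

section \<open>The top\<close>

lemma radical_mult_properties:
  assumes M: "left_module R M"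
  shows radical_submodule: "submodule (radical_mult R M) R M"
    and radical_mem: "\<lbrakk>j \<in> J; x \<in> carrier M\<rbrakk> \<Longrightarrow> j \<odot>\<^bsub>M\<^esub> x \<in> radical_mult R M"
    and radical_least: "\<lbrakk>submodule N R M; \<And>j x. \<lbrakk>j \<in> J; x \<in> carrier M\<rbrakk> \<Longrightarrow> j \<odot>\<^bsub>M\<^esub> x \<in> N\<rbrakk>
      \<Longrightarrow> radical_mult R M \<subseteq> N"
proof -
  interpret M: left_module R M by (rule M)
  show "submodule (radical_mult R M) R M"
    unfolding radical_mult_def
    using M.carrier_submodule J_subset M.smult_closed by (intro M.Inter_submodule) blast+
qed (auto simp: radical_mult_def)

text \<open>Scalars outside \<open>J\<close> have left inverses, so every cyclic submodule of the
  top has length at most 1; this bounds the length by the number of generators. Conversely, a top of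
  length \<open>t\<close> has at most \<open>t\<close> generators, and by Nakayama's lemma their
  lifts generate \<open>M\<close>.\<close>

lemma top_length_eq:
  assumes M: "fg_module R M" shows "top_length R M = num_gens R M"
proof -
  have M': "left_module R M" using M by (simp add: fg_module_def)
  interpret M: left_module R M by (rule M')
  let ?T = "top_module R M" and ?N = "radical_mult R M" and ?p = "\<lambda>x. radical_mult R M +>\<^bsub>M\<^esub> x"
  note N = radical_submodule[OF M']
  have T: "left_module R ?T" and p: "?p \<in> lmod_hom R M ?T" and s: "?p ` carrier M = carrier ?T"
    and ker: "\<And>x. x \<in> carrier M \<Longrightarrow> ?p x = \<zero>\<^bsub>?T\<^esub> \<longleftrightarrow> x \<in> ?N"
    unfolding top_module_def
    using quotient_left_module[OF M' N] coset_hom[OF M' N] coset_surj[OF M' N] coset_zero_iff[OF M' N]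
    by blast+
  interpret T: left_module R ?T by (rule T)
  note fgT = num_gens_epi[OF M T p s]
  obtain H where H: "gens R ?T H" "card H = num_gens R ?T" using minimal_gens[OF fgT(1)] .
  have finH: "finite H" "H \<subseteq> carrier ?T" using H by (auto simp: gens_def)
  have sub: "submodule (carrier R) R (regular_module R)"
    using left_module.carrier_submodule[OF regular] by simp
  have "len_le R ?T (lcomb ?T H (\<lambda>b. b) ` (H \<rightarrow> carrier R)) (card H * 1)"
  proof (rule len_le_lcomb[OF T sub finH])
    fix b assume "b \<in> H"
    then have b: "b \<in> carrier ?T" using finH by blast
    then have "b \<in> ?p ` carrier M" using s by simp
    then obtain x where x: "x \<in> carrier M" "b = ?p x" by blast
    show "len_le R ?T ((\<lambda>a. a \<odot>\<^bsub>?T\<^esub> b) ` carrier R) 1"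
    proof (rule len_le_cyclic[OF T b])
      fix a assume a: "a \<in> carrier R" "a \<odot>\<^bsub>?T\<^esub> b \<noteq> \<zero>\<^bsub>?T\<^esub>"
      have "a \<odot>\<^bsub>?T\<^esub> b = ?p (a \<odot>\<^bsub>M\<^esub> x)" using lmod_homD(3)[OF p a(1) x(1)] x by simp
      then have "a \<odot>\<^bsub>M\<^esub> x \<notin> ?N" using ker[of "a \<odot>\<^bsub>M\<^esub> x"] a x M.smult_closed by simp
      then have "a \<notin> J" using radical_mem[OF M' _ x(1)] by blast
      then show "\<exists>a'\<in>carrier R. a' \<otimes> a = \<one>" using left_inverse[OF a(1)] by blast
    qed
  qed
  moreover have "carrier ?T \<subseteq> lcomb ?T H (\<lambda>b. b) ` (H \<rightarrow> carrier R)"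
  proof
    fix x assume "x \<in> carrier ?T"
    then show "x \<in> lcomb ?T H (\<lambda>b. b) ` (H \<rightarrow> carrier R)" using T.gens_lcomb[OF H(1)] by blast
  qed
  ultimately have "len_le R ?T (carrier ?T) (num_gens R M)"
    using len_le_mono fgT(2) H(2) by fastforce
  then have le: "module_length R ?T \<le> enat (num_gens R M)" by (simp add: module_length_le_iff)
  \<comment> \<open>The length of the top is finite, so \<open>the_enat\<close> in
    \<open>top_length\<close> returns it.\<close>
  then obtain t where t: "module_length R ?T = enat t" by (metis enat_ile)
  then have "len_le R ?T (carrier ?T) t" using module_length_le_iff[of R ?T t] by simp
  then obtain K where K: "gens R ?T K" "card K \<le> t" using T.len_le_gens by blast
  obtain G where G: "finite G" "G \<subseteq> carrier M" "?p ` G = K" "card G = card K"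
    using gens_lift[OF s K(1)] .
  have "gens R M G"
    unfolding gens_def
  proof (intro conjI allI impI G)
    fix X assume X: "submodule X R M \<and> G \<subseteq> X"
    show "X = carrier M"
    proof (rule nakayama[OF M])
      fix Y assume Y: "submodule Y R M" "X \<subseteq> Y" "\<And>j x. \<lbrakk>j \<in> J; x \<in> carrier M\<rbrakk> \<Longrightarrow> j \<odot>\<^bsub>M\<^esub> x \<in> Y"
      then have rad: "?N \<subseteq> Y" by (intro radical_least[OF M']) auto
      have "?p ` Y = carrier ?T"
        using gensD[OF K(1) image_submodule[OF M' T p Y(1)]] X Y(2) G(3) by blast
      have "y \<in> Y" if y: "y \<in> carrier M" for y
      proof -
        have "?p y \<in> ?p ` Y" using \<open>?p ` Y = carrier ?T\<close> lmod_homD(1)[OF p y] by simp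
        then obtain z where z: "z \<in> Y" "?p y = ?p z" by blast
        have zM: "z \<in> carrier M" using z submodule_subset[OF Y(1)] by blast
        have "?p (y \<ominus>\<^bsub>M\<^esub> z) = \<zero>\<^bsub>?T\<^esub>"
          using hom_minus[OF M' T p y zM] z lmod_homD(1)[OF p zM] by (simp add: a_minus_def T.M.r_neg)
        then have "y \<ominus>\<^bsub>M\<^esub> z \<in> Y" using ker[of "y \<ominus>\<^bsub>M\<^esub> z"] y zM rad by auto
        then have "(y \<ominus>\<^bsub>M\<^esub> z) \<oplus>\<^bsub>M\<^esub> z \<in> Y" using submodule_add[OF Y(1)] z by blast
        then show ?thesis using y zM by (simp add: a_minus_def M.M.a_assoc M.M.l_neg)
      qed
      then show "Y = carrier M" using submodule_subset[OF Y(1)] by blast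
    qed (use X in blast)
  qed
  then have "num_gens R M \<le> t" using num_gens_le G K by fastforce
  then have "t = num_gens R M" using le t by simp
  then show ?thesis using t by (simp add: top_length_def)
qed

section \<open>The residue module\<close>

lemma residue_properties:
  shows residue_left_module: "left_module R (residue_module R)"
    and residue_hom: "(\<lambda>a. J +>\<^bsub>regular_module R\<^esub> a) \<in> lmod_hom R (regular_module R) (residue_module R)"
    and residue_surj: "(\<lambda>a. J +>\<^bsub>regular_module R\<^esub> a) ` carrier R = carrier (residue_module R)"
    and residue_zero_iff: "a \<in> carrier R \<Longrightarrow> J +>\<^bsub>regular_module R\<^esub> a = \<zero>\<^bsub>residue_module R\<^esub> \<longleftrightarrow> a \<in> J"
  unfolding residue_module_def
  using quotient_left_module[OF regular J_submodule] coset_hom[OF regular J_submodule]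
    coset_surj[OF regular J_submodule] coset_zero_iff[OF regular J_submodule] by auto

lemma gens_regular: "gens R (regular_module R) {\<one>}"
  unfolding gens_def
proof (intro conjI allI impI)
  fix N assume N: "submodule N R (regular_module R) \<and> {\<one>} \<subseteq> N"
  then have "a \<in> N" if "a \<in> carrier R" for a
    using submodule_smult[of N R "regular_module R" a \<one>] that by simp
  then show "N = carrier (regular_module R)" using N submodule_subset[of N R "regular_module R"] by auto
qed auto

lemma fg_regular: "fg_module R (regular_module R)"
  using regular gens_regular by (auto simp: fg_module_def)

lemma fg_residue: "fg_module R (residue_module R)"
  and num_gens_residue: "num_gens R (residue_module R) \<le> 1"
  using num_gens_epi[OF fg_regular residue_left_module residue_hom] residue_surj
    num_gens_le[OF gens_regular] by auto

end

section \<open>Factorisation through epimorphisms and simple quotients\<close>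

lemma (in abelian_group) minus_eq_zeroD:
  assumes "x \<in> carrier G" "y \<in> carrier G" "x \<ominus> y = \<zero>"
  shows "x = y"
proof -
  have "(x \<ominus> y) \<oplus> y = y" using assms by simp
  then show ?thesis using assms(1,2) by (simp add: a_minus_def a_assoc l_neg)
qed

lemma hom_factor:
  assumes L: "left_module R L" and M: "left_module R M" and N: "left_module R N"
    and p: "p \<in> lmod_hom R L M" "p ` carrier L = carrier M" and q: "q \<in> lmod_hom R L N"
    and ker: "\<And>x. \<lbrakk>x \<in> carrier L; p x = \<zero>\<^bsub>M\<^esub>\<rbrakk> \<Longrightarrow> q x = \<zero>\<^bsub>N\<^esub>"
  obtains g where "g \<in> lmod_hom R M N" "\<And>x. x \<in> carrier L \<Longrightarrow> g (p x) = q x"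
proof -
  interpret L: left_module R L by (rule L)
  interpret M: left_module R M by (rule M)
  interpret N: left_module R N by (rule N)
  \<comment> \<open>The chosen preimage does not matter: two of them differ by an element of the
    kernel of \<open>p\<close>, on which \<open>q\<close> vanishes.\<close>
  define g where "g m = q (SOME x. x \<in> carrier L \<and> p x = m)" for m
  have g: "g (p x) = q x" if x: "x \<in> carrier L" for x
  proof -
    have "(SOME y. y \<in> carrier L \<and> p y = p x) \<in> carrier L \<and> p (SOME y. y \<in> carrier L \<and> p y = p x) = p x"
      by (rule someI[of _ x]) (use x in simp)
    then obtain y where gy: "g (p x) = q y" and y: "y \<in> carrier L" "p y = p x"
      unfolding g_def by blast
    then have "p (y \<ominus>\<^bsub>L\<^esub> x) = \<zero>\<^bsub>M\<^esub>"
      using hom_minus[OF L M p(1) y(1) x] lmod_homD(1)[OF p(1) x] by (simp add: a_minus_def M.M.r_neg)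
    then have "q (y \<ominus>\<^bsub>L\<^esub> x) = \<zero>\<^bsub>N\<^esub>" using ker y(1) x by simp
    then have "q y \<ominus>\<^bsub>N\<^esub> q x = \<zero>\<^bsub>N\<^esub>" using hom_minus[OF L N q y(1) x] by simp
    then show ?thesis
      unfolding gy by (rule N.M.minus_eq_zeroD[OF lmod_homD(1)[OF q y(1)] lmod_homD(1)[OF q x]])
  qed
  have "g \<in> lmod_hom R M N"
  proof (rule lmod_homI)
    fix m assume "m \<in> carrier M"
    then obtain x where x: "x \<in> carrier L" "m = p x" using p(2) by blast
    then show "g m \<in> carrier N" using g lmod_homD(1)[OF q] by simp
    fix a assume a: "a \<in> carrier R"
    show "g (a \<odot>\<^bsub>M\<^esub> m) = a \<odot>\<^bsub>N\<^esub> g m"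
      using g[of "a \<odot>\<^bsub>L\<^esub> x"] g[of x] x a lmod_homD(3)[OF p(1) a] lmod_homD(3)[OF q a] L.smult_closed by simp
  next
    fix m m' assume "m \<in> carrier M" "m' \<in> carrier M"
    then obtain x x' where x: "x \<in> carrier L" "m = p x" "x' \<in> carrier L" "m' = p x'" using p(2) by blast
    then show "g (m \<oplus>\<^bsub>M\<^esub> m') = g m \<oplus>\<^bsub>N\<^esub> g m'"
      using g[of "x \<oplus>\<^bsub>L\<^esub> x'"] g[of x] g[of x'] lmod_homD(2)[OF p(1)] lmod_homD(2)[OF q] by simp
  qed
  then show thesis using g that by blast
qed

text \<open>For \<open>x\<close> outside \<open>N\<close>, sending \<open>a\<close> to the class of
  \<open>a x\<close> maps the ring onto the simple quotient with kernel \<open>J\<close>. The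
  projection of the ring onto the residue module factors through this map, and the factor vanishes
  only at zero.\<close>

lemma (in finite_length_local_ring) max_submodule_quotient:
  assumes M: "left_module R M" and N: "max_submodule R M N"
  obtains g where "g \<in> lmod_hom R M (residue_module R)" "g ` carrier M = carrier (residue_module R)"
    "a_kernel M (residue_module R) g = N"
proof -
  interpret M: left_module R M by (rule M)
  let ?S = "residue_module R" and ?Q = "quotient_module M N" and ?p = "\<lambda>x. N +>\<^bsub>M\<^esub> x"
  have N': "submodule N R M" using N by (simp add: max_submodule_def)
  obtain x where x: "x \<in> carrier M" "x \<notin> N"
    using N submodule_subset[OF N'] by (auto simp: max_submodule_def)
  note Q = quotient_left_module[OF M N'] and p = coset_hom[OF M N'] and s = coset_surj[OF M N']
    and ker = coset_zero_iff[OF M N']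
  interpret Q: left_module R ?Q by (rule Q)
  define h where "h = (\<lambda>a. ?p (a \<odot>\<^bsub>M\<^esub> x))"
  have h: "h \<in> lmod_hom R (regular_module R) ?Q"
    unfolding h_def by (rule hom_comp[OF smult_hom[OF M x(1)] p])
  have hz: "h a = \<zero>\<^bsub>?Q\<^esub> \<longleftrightarrow> a \<in> J" if "a \<in> carrier R" for a
    using ker[of "a \<odot>\<^bsub>M\<^esub> x"] that x max_submodule_annihilator[OF M N x]
    by (auto simp: h_def M.smult_closed)
  let ?Y = "(\<lambda>a. a \<odot>\<^bsub>M\<^esub> x) ` carrier R"
  have Y: "submodule ?Y R M"
    using image_submodule[OF regular M smult_hom[OF M x(1)] left_module.carrier_submodule[OF regular]]
    by simp
  have "x \<in> ?Y" using x by (intro image_eqI[of _ _ \<one>]) (auto simp: M.smult_one)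
  then have "N <+>\<^bsub>M\<^esub> ?Y \<noteq> N" using M.sum_submodule_upper(2)[OF N' Y] x by blast
  then have sum: "N <+>\<^bsub>M\<^esub> ?Y = carrier M"
    using N M.sum_submodule[OF N' Y] M.sum_submodule_upper(1)[OF N' Y] by (auto simp: max_submodule_def)
  have "?p y \<in> h ` carrier R" if y: "y \<in> carrier M" for y
  proof -
    have "y \<in> N <+>\<^bsub>M\<^esub> ?Y" using y sum by simp
    then obtain n a where na: "n \<in> N" "a \<in> carrier R" "y = n \<oplus>\<^bsub>M\<^esub> a \<odot>\<^bsub>M\<^esub> x"
      by (auto simp: mem_set_add_iff)
    have nM: "n \<in> carrier M" using na submodule_subset[OF N'] by blast
    have "?p y = ?p n \<oplus>\<^bsub>?Q\<^esub> h a"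
      using lmod_homD(2)[OF p nM, of "a \<odot>\<^bsub>M\<^esub> x"] na x by (simp add: M.smult_closed h_def)
    also have "\<dots> = h a"
      using ker[OF nM] na lmod_homD(1)[OF h, of a] by simp
    finally show ?thesis using na by blast
  qed
  then have "carrier ?Q \<subseteq> h ` carrier R" unfolding s[symmetric] by blast
  then have hs: "h ` carrier (regular_module R) = carrier ?Q"
    using lmod_homD(1)[OF h] by auto
  obtain g where g: "g \<in> lmod_hom R ?Q ?S" "\<And>a. a \<in> carrier R \<Longrightarrow> g (h a) = J +>\<^bsub>regular_module R\<^esub> a"
    using hom_factor[OF regular Q residue_left_module h hs residue_hom] hz residue_zero_iff by auto
  let ?f = "\<lambda>y. g (?p y)"
  have f: "?f \<in> lmod_hom R M ?S" by (rule hom_comp[OF p g(1)])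
  have "?f ` carrier M = g ` carrier ?Q" unfolding s[symmetric] image_image ..
  also have "\<dots> = (\<lambda>a. g (h a)) ` carrier R" unfolding hs[symmetric] image_image by simp
  also have "\<dots> = (\<lambda>a. J +>\<^bsub>regular_module R\<^esub> a) ` carrier R"
    using g(2) by (intro image_cong) auto
  finally have fs: "?f ` carrier M = carrier ?S" using residue_surj by simp
  have "a_kernel M ?S ?f = N"
  proof (rule Set.set_eqI)
    fix y
    have "?f y = \<zero>\<^bsub>?S\<^esub> \<longleftrightarrow> y \<in> N" if y: "y \<in> carrier M"
    proof -
      have "?p y \<in> h ` carrier (regular_module R)" using hs lmod_homD(1)[OF p y] by simp
      then obtain a where a: "a \<in> carrier R" "?p y = h a" by auto
      then show ?thesis using g(2)[OF a(1)] residue_zero_iff[OF a(1)] hz[OF a(1)] ker[OF y] by simp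
    qed
    then show "y \<in> a_kernel M ?S ?f \<longleftrightarrow> y \<in> N"
      using submodule_subset[OF N'] by (auto simp: mem_kernel_iff)
  qed
  then show thesis using that f fs by blast
qed

section \<open>Projective covers\<close>

text \<open>Lifting against modules in arbitrary types: the identity of \<open>P\<close> is lifted to the free module
  on a finite generating set, which is one of the test modules of \<open>projective_module\<close>.\<close>

lemma projective_lift:
  fixes P :: "('a, 'p) module" and X :: "('a, 'm) module" and Y :: "('a, 'n) module"
  assumes P: "projective_module R P" "fg_module R P" and X: "left_module R X" and Y: "left_module R Y"
    and g: "g \<in> lmod_hom R X Y" "g ` carrier X = carrier Y" and f: "f \<in> lmod_hom R P Y"
  obtains h where "h \<in> lmod_hom R P X" "\<And>x. x \<in> carrier P \<Longrightarrow> g (h x) = f x"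
proof -
  have P': "left_module R P" using P by (simp add: fg_module_def)
  interpret P: left_module R P by (rule P')
  interpret X: left_module R X by (rule X)
  interpret Y: left_module R Y by (rule Y)
  obtain G where G: "gens R P G" using P by (auto simp: fg_module_def)
  have fin: "finite G" "G \<subseteq> carrier P" "(\<lambda>b. b) \<in> G \<rightarrow> carrier P" using G by (auto simp: gens_def)
  let ?F = "free_module R G :: ('a, 'p \<Rightarrow> 'a) module"
  have F: "left_module R ?F" by (rule P.R.free_left_module)
  let ?e = "lcomb P G (\<lambda>b. b)"
  have e: "?e \<in> lmod_hom R ?F P" by (rule lcomb_hom[OF P' fin(1,3)])
  have "y \<in> ?e ` carrier ?F" if y: "y \<in> carrier P" for y
  proof -
    obtain c where c: "c \<in> G \<rightarrow> carrier R" "y = ?e c" using P.gens_lcomb[OF G y] .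
    let ?c = "\<lambda>b. if b \<in> G then c b else \<zero>\<^bsub>R\<^esub>"
    have 1: "?e ?c = ?e c" using fin c by (intro P.lcomb_cong) auto
    have 2: "?c \<in> carrier ?F" using c by auto
    show ?thesis unfolding c(2) by (rule image_eqI[OF _ 2]) (rule 1[symmetric])
  qed
  then have es: "?e ` carrier ?F = carrier P" using lmod_homD(1)[OF e] by blast
  have "\<exists>s\<in>lmod_hom R P ?F. \<forall>x\<in>carrier P. ?e (s x) = (\<lambda>x. x) x"
    using P(1)[unfolded projective_module_def, THEN conjunct2, rule_format, of ?F P ?e "\<lambda>x. x"]
      F P' e es hom_id by blast
  then obtain s where s: "s \<in> lmod_hom R P ?F" "\<And>x. x \<in> carrier P \<Longrightarrow> ?e (s x) = x" by blast
  have "\<exists>x. x \<in> carrier X \<and> g x = f b" if "b \<in> G" for b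
  proof -
    have "f b \<in> g ` carrier X" using g(2) lmod_homD(1)[OF f] fin that by auto
    then show ?thesis by auto
  qed
  then obtain x where x: "\<And>b. b \<in> G \<Longrightarrow> x b \<in> carrier X" "\<And>b. b \<in> G \<Longrightarrow> g (x b) = f b" by metis
  then have xX: "x \<in> G \<rightarrow> carrier X" by auto
  have h: "lcomb X G x \<in> lmod_hom R ?F X" by (rule lcomb_hom[OF X fin(1) xX])
  have "g (lcomb X G x (s y)) = f y" if y: "y \<in> carrier P" for y
  proof -
    have sy: "s y \<in> G \<rightarrow> carrier R" using lmod_homD(1)[OF s(1) y] by auto
    have fG: "f \<in> G \<rightarrow> carrier Y" using lmod_homD(1)[OF f] fin by auto
    have "g (lcomb X G x (s y)) = lcomb Y G (\<lambda>b. g (x b)) (s y)"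
      by (rule hom_lcomb[OF X Y g(1) fin(1) xX sy])
    also have "\<dots> = lcomb Y G f (s y)"
      using x by (intro Y.lcomb_cong fG sy) auto
    also have "\<dots> = f (?e (s y))"
      using hom_lcomb[OF P' Y f fin(1,3) sy] by simp
    finally show ?thesis using s(2)[OF y] by simp
  qed
  then show thesis using that[OF hom_comp[OF s(1) h]] by blast
qed

lemma free_projective:
  assumes R: "ring R" and G: "finite G"
  shows "projective_module R (free_module R G)"
proof -
  interpret ring R by (rule R)
  have F: "left_module R (free_module R G)" by (rule free_left_module)
  have "\<exists>h\<in>lmod_hom R (free_module R G) X. \<forall>x\<in>carrier (free_module R G). g (h x) = f x"
    if X: "left_module R X" and Y: "left_module R Y" and g: "g \<in> lmod_hom R X Y" "g ` carrier X = carrier Y"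
      and f: "f \<in> lmod_hom R (free_module R G) Y"
    for X :: "('a, ('c \<Rightarrow> 'a) \<Rightarrow> 'a) module" and Y :: "('a, 'c \<Rightarrow> 'a) module" and g f
  proof -
    interpret X: left_module R X by (rule X)
    interpret Y: left_module R Y by (rule Y)
    have u: "unit_vec \<in> G \<rightarrow> carrier (free_module R G)" by auto
    have "\<exists>x. x \<in> carrier X \<and> g x = f (unit_vec b)" if "b \<in> G" for b
    proof -
      have "f (unit_vec b) \<in> g ` carrier X" using g(2) lmod_homD(1)[OF f] u that by blast
      then show ?thesis by auto
    qed
    then obtain x where x: "\<And>b. b \<in> G \<Longrightarrow> x b \<in> carrier X" "\<And>b. b \<in> G \<Longrightarrow> g (x b) = f (unit_vec b)" by metis
    then have xX: "x \<in> G \<rightarrow> carrier X" by auto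
    have "g (lcomb X G x c) = f c" if c: "c \<in> carrier (free_module R G)" for c
    proof -
      have cR: "c \<in> G \<rightarrow> carrier R" using c by auto
      have fG: "(\<lambda>b. f (unit_vec b)) \<in> G \<rightarrow> carrier Y" using lmod_homD(1)[OF f] u by blast
      have "g (lcomb X G x c) = lcomb Y G (\<lambda>b. g (x b)) c"
        by (rule hom_lcomb[OF X Y g(1) G xX cR])
      also have "\<dots> = lcomb Y G (\<lambda>b. f (unit_vec b)) c"
        using x by (intro Y.lcomb_cong fG cR) auto
      also have "\<dots> = f (lcomb (free_module R G) G unit_vec c)"
        using hom_lcomb[OF F Y f G u cR] by simp
      finally show ?thesis using free_module_expand[OF G c] by simp
    qed
    then show ?thesis using lcomb_hom[OF X G xX] by blast
  qed
  then show ?thesis unfolding projective_module_def using F by blast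
qed

lemma superfluousD:
  "\<lbrakk>superfluous R M U; submodule N R M; \<And>x. x \<in> carrier M \<Longrightarrow> \<exists>u\<in>U. \<exists>n\<in>N. x = u \<oplus>\<^bsub>M\<^esub> n\<rbrakk> \<Longrightarrow> N = carrier M"
  if "left_module R M"
proof -
  interpret left_module R M by (rule that)
  assume U: "superfluous R M U" and N: "submodule N R M"
    and *: "\<And>x. x \<in> carrier M \<Longrightarrow> \<exists>u\<in>U. \<exists>n\<in>N. x = u \<oplus>\<^bsub>M\<^esub> n"
  have US: "submodule U R M" using U by (simp add: superfluous_def)
  have "U <+>\<^bsub>M\<^esub> N = carrier M"
    using submodule_subset[OF sum_submodule[OF US N]] * by (auto simp: mem_set_add_iff)
  then show "N = carrier M" using U N by (simp add: superfluous_def)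
qed

lemma projective_coverD:
  assumes "projective_cover R P p M"
  shows "projective_module R P" "left_module R P" "p \<in> lmod_hom R P M" "p ` carrier P = carrier M"
    "superfluous R P (a_kernel P M p)"
  using assms by (auto simp: projective_cover_def projective_module_def)

text \<open>An element of \<open>P\<close> and an element of \<open>N\<close> with the same image
  differ by an element of the kernel, so \<open>N\<close> and the kernel together fill
  \<open>P\<close>. This is the form in which the minimality of a cover is used.\<close>

lemma projective_cover_superfluous:
  assumes M: "left_module R M" and P: "projective_cover R P p M"
    and N: "submodule N R P" "p ` N = carrier M"
  shows "N = carrier P"
proof (rule superfluousD[OF projective_coverD(2)[OF P] projective_coverD(5)[OF P] N(1)])
  note P' = projective_coverD[OF P]
  interpret M: left_module R M by (rule M)
  interpret P: left_module R P by (rule P'(2))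
  fix x assume x: "x \<in> carrier P"
  then have "p x \<in> p ` N" using N(2) lmod_homD(1)[OF P'(3)] by simp
  then obtain n where n: "n \<in> N" "p x = p n" by blast
  have nP: "n \<in> carrier P" using n submodule_subset[OF N(1)] by blast
  have "p (x \<ominus>\<^bsub>P\<^esub> n) = \<zero>\<^bsub>M\<^esub>"
    using hom_minus[OF P'(2) M P'(3) x nP] n lmod_homD(1)[OF P'(3) nP] by (simp add: a_minus_def M.M.r_neg)
  then have "x \<ominus>\<^bsub>P\<^esub> n \<in> a_kernel P M p" using x nP by (simp add: mem_kernel_iff)
  moreover have "x = (x \<ominus>\<^bsub>P\<^esub> n) \<oplus>\<^bsub>P\<^esub> n" using x nP by (simp add: a_minus_def P.M.a_assoc P.M.l_neg)
  ultimately show "\<exists>u\<in>a_kernel P M p. \<exists>n\<in>N. x = u \<oplus>\<^bsub>P\<^esub> n" using n by blast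
qed

text \<open>Lifts of minimal generators of \<open>M\<close> generate a submodule mapping onto
  \<open>M\<close>, which must be all of \<open>P\<close>. As this holds for every cover, the cover
  chosen in \<open>syzygy\<close> is never compared with another one.\<close>

lemma projective_cover_fg:
  assumes M: "fg_module R M" and P: "projective_cover R P p M"
  shows "fg_module R P" "num_gens R P \<le> num_gens R M"
proof -
  have M': "left_module R M" using M by (simp add: fg_module_def)
  note P' = projective_coverD[OF P]
  obtain H where H: "gens R M H" "card H = num_gens R M" using minimal_gens[OF M] .
  obtain G where G: "finite G" "G \<subseteq> carrier P" "p ` G = H" "card G = card H"
    using gens_lift[OF P'(4) H(1)] .
  have "N = carrier P" if N: "submodule N R P" "G \<subseteq> N" for N
  proof (rule projective_cover_superfluous[OF M' P N(1)])
    show "p ` N = carrier M"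
      using gensD[OF H(1) image_submodule[OF P'(2) M' P'(3) N(1)]] N(2) G(3) by blast
  qed
  then have g: "gens R P G" using G by (auto simp: gens_def)
  then show "fg_module R P" using P' by (auto simp: fg_module_def)
  show "num_gens R P \<le> num_gens R M" using num_gens_le[OF g] G H by simp
qed

context finite_length_local_ring
begin

lemma minimal_gens_relation:
  assumes M: "left_module R M" and G: "finite G" "m \<in> G \<rightarrow> carrier M"
    and U: "submodule U R M" and c: "c \<in> G \<rightarrow> carrier R" "lcomb M G m c \<in> U"
    and min: "b \<in> G" "submodule N R M" "m ` (G - {b}) \<subseteq> N" "U \<subseteq> N" "m b \<notin> N"
  shows "c b \<in> J"
proof (rule ccontr)
  interpret M: left_module R M by (rule M)
  assume "c b \<notin> J"
  then obtain a where a: "a \<in> carrier R" "a \<otimes> c b = \<one>" using left_inverse[of "c b"] c(1) min(1) by auto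
  have cb: "c b \<in> carrier R" "m b \<in> carrier M" using c(1) G min(1) by auto
  let ?r = "lcomb M (G - {b}) m c"
  have r: "?r \<in> N"
    using G c(1) min by (intro M.lcomb_mem) (auto intro!: submodule_smult[OF min(2)])
  have rM: "?r \<in> carrier M" using r submodule_subset[OF min(2)] by blast
  have "c b \<odot>\<^bsub>M\<^esub> m b \<oplus>\<^bsub>M\<^esub> ?r \<in> N"
    using M.lcomb_remove[OF G(1) min(1) G(2) c(1)] c(2) min(4) by auto
  then have "(c b \<odot>\<^bsub>M\<^esub> m b \<oplus>\<^bsub>M\<^esub> ?r) \<ominus>\<^bsub>M\<^esub> ?r \<in> N" using submodule_minus[OF min(2)] r by blast
  then have "c b \<odot>\<^bsub>M\<^esub> m b \<in> N"
    using cb rM by (simp add: a_minus_def M.M.a_assoc M.M.r_neg M.smult_closed)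
  then have "a \<odot>\<^bsub>M\<^esub> (c b \<odot>\<^bsub>M\<^esub> m b) \<in> N" by (rule submodule_smult[OF min(2) a(1)])
  then show False using min(5) a cb M.smult_assoc[of a "c b" "m b"] by (simp add: M.smult_one)
qed

lemma projective_cover_exists:
  fixes M :: "('a, 'm) module"
  assumes M: "fg_module R M"
  shows "\<exists>(P :: ('a, nat \<Rightarrow> 'a) module) p. projective_cover R P p M"
proof -
  have M': "left_module R M" using M by (simp add: fg_module_def)
  interpret M: left_module R M by (rule M')
  obtain H where H: "gens R M H" "\<And>b. b \<in> H \<Longrightarrow> \<not> gens R M (H - {b})" using minimal_gens[OF M] by metis
  have fin: "finite H" "H \<subseteq> carrier M" using H by (auto simp: gens_def)
  obtain m where m: "bij_betw m {..<card H} H"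
    using ex_bij_betw_nat_finite[OF fin(1)] by (auto simp: atLeast0LessThan)
  \<comment> \<open>The generators are indexed by natural numbers because \<open>syzygy\<close>
    admits only covers in the type \<open>nat \<Rightarrow> 'a\<close>.\<close>
  define G where "G = {..<card H}"
  have G: "finite G" "m ` G = H" "inj_on m G" using m by (auto simp: G_def bij_betw_def)
  have mM: "m \<in> G \<rightarrow> carrier M" using G fin by auto
  let ?F = "free_module R G :: ('a, nat \<Rightarrow> 'a) module" and ?p = "lcomb M G m"
  have F: "left_module R ?F" by (rule free_left_module)
  interpret F: left_module R ?F by (rule F)
  have p: "?p \<in> lmod_hom R ?F M" by (rule lcomb_hom[OF M' G(1) mM])
  have "y \<in> ?p ` carrier ?F" if y: "y \<in> carrier M" for y
  proof -
    obtain c where c: "c \<in> G \<rightarrow> carrier R" "y = ?p c"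
      using M.lcomb_gens[OF G(1) mM _ y] gensD[OF H(1)] G(2) by blast
    let ?c = "\<lambda>b. if b \<in> G then c b else \<zero>\<^bsub>R\<^esub>"
    have 1: "?p ?c = ?p c" using mM c by (intro M.lcomb_cong) auto
    have 2: "?c \<in> carrier ?F" using c by auto
    show ?thesis unfolding c(2) by (rule image_eqI[OF _ 2]) (rule 1[symmetric])
  qed
  then have s: "?p ` carrier ?F = carrier M" using lmod_homD(1)[OF p] by blast
  have u: "unit_vec \<in> G \<rightarrow> carrier ?F" by auto
  have fgF: "fg_module R ?F"
  proof -
    have "N = carrier ?F" if N: "submodule N R ?F" "unit_vec ` G \<subseteq> N" for N
    proof -
      have "c \<in> N" if c: "c \<in> carrier ?F" for c
      proof -
        have "lcomb ?F G unit_vec c \<in> N"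
          using c N(2) by (intro F.lcomb_mem[OF G(1) u _ N(1)] submodule_smult[OF N(1)]) auto
        then show ?thesis using free_module_expand[OF G(1) c] by simp
      qed
      then show ?thesis using submodule_subset[OF N(1)] by blast
    qed
    then have "gens R ?F (unit_vec ` G)" using G(1) u by (auto simp: gens_def)
    then show ?thesis using F by (auto simp: fg_module_def)
  qed
  let ?U = "a_kernel ?F M ?p"
  have U: "submodule ?U R ?F" by (rule kernel_submodule[OF F M' p])
  have UJ: "c b \<in> J" if c: "c \<in> ?U" and b: "b \<in> G" for c b
  proof -
    have "\<not> gens R M (H - {m b})" using H(2) G(2) b by blast
    then obtain N where N: "submodule N R M" "H - {m b} \<subseteq> N" "N \<noteq> carrier M"
      using fin by (auto simp: gens_def)
    have "m b \<notin> N" using gensD[OF H(1) N(1)] N by blast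
    moreover have "m ` (G - {b}) \<subseteq> N" using N(2) G(2,3) b by (auto simp: inj_on_def)
    ultimately show ?thesis
      using c submodule_zero[OF N(1)] minimal_gens_relation[OF M' G(1) mM M.zero_submodule _ _ b N(1), of c]
      by (auto simp: mem_kernel_iff)
  qed
  have "superfluous R ?F ?U"
    unfolding superfluous_def
  proof (intro conjI allI impI U)
    fix N assume N: "submodule N R ?F \<and> ?U <+>\<^bsub>?F\<^esub> N = carrier ?F"
    show "N = carrier ?F"
    proof (rule nakayama[OF fgF])
      fix X assume X: "submodule X R ?F" "N \<subseteq> X"
        "\<And>j x. \<lbrakk>j \<in> J; x \<in> carrier ?F\<rbrakk> \<Longrightarrow> j \<odot>\<^bsub>?F\<^esub> x \<in> X"
      have "?U \<subseteq> X"
      proof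
        fix c assume c: "c \<in> ?U"
        then have cF: "c \<in> carrier ?F" by (simp add: mem_kernel_iff)
        have "lcomb ?F G unit_vec c \<in> X"
          using UJ[OF c] cF u by (intro F.lcomb_mem[OF G(1) u _ X(1)] X(3)) auto
        then show "c \<in> X" using free_module_expand[OF G(1) cF] by simp
      qed
      then have "?U <+>\<^bsub>?F\<^esub> N \<subseteq> X"
        using X(2) submodule_add[OF X(1)] by (auto simp only: mem_set_add_iff subset_iff)
      then show "X = carrier ?F" using N submodule_subset[OF X(1)] by simp
    qed (use N in blast)
  qed
  then have "projective_cover R ?F ?p M"
    unfolding projective_cover_def using free_projective[OF ring_axioms G(1)] p s by blast
  then show ?thesis by blast
qed

lemma superfluous_length:
  assumes P: "fg_module R P" and U: "superfluous R P U"
    and q: "len_le R (regular_module R) J q"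
  shows "len_le R P U (num_gens R P * q)"
proof -
  have P': "left_module R P" using P by (simp add: fg_module_def)
  interpret P: left_module R P by (rule P')
  obtain G where G: "gens R P G" "card G = num_gens R P" "\<And>b. b \<in> G \<Longrightarrow> \<not> gens R P (G - {b})"
    using minimal_gens[OF P] by metis
  have fin: "finite G" "G \<subseteq> carrier P" "(\<lambda>b. b) \<in> G \<rightarrow> carrier P" using G by (auto simp: gens_def)
  have US: "submodule U R P" using U by (simp add: superfluous_def)
  have "len_le R P (lcomb P G (\<lambda>b. b) ` (G \<rightarrow> J)) (card G * q)"
  proof (rule len_le_lcomb[OF P' J_submodule fin(1,2)])
    fix b assume "b \<in> G"
    then show "len_le R P ((\<lambda>a. a \<odot>\<^bsub>P\<^esub> b) ` J) q"
      using fin by (intro len_le_image[OF regular P' smult_hom[OF P'] J_submodule q]) auto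
  qed
  moreover have "U \<subseteq> lcomb P G (\<lambda>b. b) ` (G \<rightarrow> J)"
  proof
    fix x assume x: "x \<in> U"
    then have "x \<in> carrier P" using submodule_subset[OF US] by blast
    then obtain c where c: "c \<in> G \<rightarrow> carrier R" "x = lcomb P G (\<lambda>b. b) c" using P.gens_lcomb[OF G(1)] by blast
    have "c b \<in> J" if b: "b \<in> G" for b
    proof -
      obtain N where N: "submodule N R P" "G - {b} \<subseteq> N" "N \<noteq> carrier P"
        using G(3)[OF b] fin by (auto simp: gens_def)
      let ?X = "U <+>\<^bsub>P\<^esub> N"
      have X: "submodule ?X R P" by (rule P.sum_submodule[OF US N(1)])
      have "?X \<noteq> carrier P" using U N by (auto simp: superfluous_def)
      moreover have "G - {b} \<subseteq> ?X" using N(2) P.sum_submodule_upper(2)[OF US N(1)] by blast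
      ultimately have "b \<notin> ?X" using gensD[OF G(1) X] by blast
      then show ?thesis
        using minimal_gens_relation[OF P' fin(1,3) US c(1) _ b X] x c(2) \<open>G - {b} \<subseteq> ?X\<close>
          P.sum_submodule_upper(1)[OF US N(1)] by simp
    qed
    then show "x \<in> lcomb P G (\<lambda>b. b) ` (G \<rightarrow> J)" using c(2) by blast
  qed
  ultimately show ?thesis using G(2) by (auto intro: len_le_mono)
qed

section \<open>Syzygies\<close>

text \<open>The only access to the choice made in \<open>syzygy\<close>: it is the kernel of some
  projective cover, and nothing else about it is used.\<close>

lemma syzygy_cover:
  fixes M :: "('a, 'm) module"
  assumes M: "fg_module R M"
  obtains P p where "projective_cover R P p M" "syzygy R M = P\<lparr>carrier := a_kernel P M p\<rparr>"
proof -
  obtain P :: "('a, nat \<Rightarrow> 'a) module" and p where "projective_cover R P p M"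
    using projective_cover_exists[OF M] by blast
  then have "\<exists>N. \<exists>(P :: ('a, nat \<Rightarrow> 'a) module) p. projective_cover R P p M \<and> N = P\<lparr>carrier := a_kernel P M p\<rparr>"
    by blast
  from someI_ex[OF this] show thesis using that unfolding syzygy_def by blast
qed

lemma fg_syzygy:
  assumes M: "fg_module R M" shows "fg_module R (syzygy R M)"
proof -
  obtain P p where P: "projective_cover R P p M" "syzygy R M = P\<lparr>carrier := a_kernel P M p\<rparr>"
    using syzygy_cover[OF M] .
  then show ?thesis
    using fg_submodule[OF projective_cover_fg(1)[OF M P(1)]] projective_coverD(5)[OF P(1)]
    by (simp add: superfluous_def)
qed

lemma num_gens_syzygy_le:
  assumes M: "fg_module R M" and q: "len_le R (regular_module R) J q"
  shows "num_gens R (syzygy R M) \<le> q * num_gens R M"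
proof -
  obtain P p where P: "projective_cover R P p M" "syzygy R M = P\<lparr>carrier := a_kernel P M p\<rparr>"
    using syzygy_cover[OF M] .
  let ?U = "a_kernel P M p"
  note fgP = projective_cover_fg[OF M P(1)] and P' = projective_coverD[OF P(1)]
  interpret P: left_module R P by (rule P'(2))
  have U: "submodule ?U R P" using P'(5) by (simp add: superfluous_def)
  have "len_le R P ?U (num_gens R P * q)" by (rule superfluous_length[OF fgP(1) P'(5) q])
  then have "len_le R (syzygy R M) (carrier (syzygy R M)) (num_gens R P * q)"
    unfolding P(2) len_le_def P.submodule_of_submodule_iff[OF U] by simp
  then obtain G where "gens R (syzygy R M) G" "card G \<le> num_gens R P * q"
    using left_module.len_le_gens fg_syzygy[OF M] unfolding fg_module_def by blast
  then have "num_gens R (syzygy R M) \<le> num_gens R P * q" using num_gens_le by fastforce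
  also have "\<dots> \<le> q * num_gens R M" using fgP(2) by simp
  finally show ?thesis .
qed

end

section \<open>Retracts and their syzygies\<close>

definition retract :: "('a, 'r) ring_scheme \<Rightarrow> ('a, 'm) module \<Rightarrow> ('a, 'n) module \<Rightarrow> bool" where
  "retract R X Y \<longleftrightarrow> (\<exists>i\<in>lmod_hom R X Y. \<exists>r\<in>lmod_hom R Y X. \<forall>x\<in>carrier X. r (i x) = x)"

lemma num_gens_retract:
  assumes Y: "fg_module R Y" and X: "left_module R X" and r: "retract R X Y"
  shows "num_gens R X \<le> num_gens R Y"
proof -
  obtain i r where i: "i \<in> lmod_hom R X Y" and r: "r \<in> lmod_hom R Y X"
    and ri: "\<And>x. x \<in> carrier X \<Longrightarrow> r (i x) = x" using r unfolding retract_def by blast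
  have "x \<in> r ` carrier Y" if "x \<in> carrier X" for x
    using ri[OF that] lmod_homD(1)[OF i that] by (metis imageI)
  then have "r ` carrier Y = carrier X" using lmod_homD(1)[OF r] by blast
  then show ?thesis using num_gens_epi(2)[OF Y X r] by blast
qed

text \<open>The composite \<open>v \<circ> u\<close> covers the identity of \<open>X\<close>, so it is onto because the kernel of \<open>p\<close> is
  superfluous, hence splits; its section is onto for the same reason.\<close>

lemma retract_kernel:
  assumes X: "fg_module R X" and Y: "left_module R Y" and F: "left_module R F"
    and P: "projective_cover R P p X" and q: "q \<in> lmod_hom R F Y"
    and i: "i \<in> lmod_hom R X Y" and r: "r \<in> lmod_hom R Y X" and ri: "\<And>x. x \<in> carrier X \<Longrightarrow> r (i x) = x"
    and u: "u \<in> lmod_hom R P F" "\<And>x. x \<in> carrier P \<Longrightarrow> q (u x) = i (p x)"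
    and v: "v \<in> lmod_hom R F P" "\<And>z. z \<in> carrier F \<Longrightarrow> p (v z) = r (q z)"
  shows "retract R (P\<lparr>carrier := a_kernel P X p\<rparr>) (F\<lparr>carrier := a_kernel F Y q\<rparr>)"
proof -
  note P' = projective_coverD[OF P]
  have X': "left_module R X" using X by (simp add: fg_module_def)
  have onto: "h ` carrier P = carrier P"
    if h: "h \<in> lmod_hom R P P" "\<And>x. x \<in> carrier P \<Longrightarrow> p (h x) = p x" for h
  proof (rule projective_cover_superfluous[OF X' P])
    show "submodule (h ` carrier P) R P"
      by (rule image_submodule[OF P'(2) P'(2) h(1) left_module.carrier_submodule[OF P'(2)]])
    show "p ` h ` carrier P = carrier X"
      unfolding image_image P'(4)[symmetric] using h(2) by (intro image_cong) auto
  qed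
  define e where "e = (\<lambda>x. v (u x))"
  have e: "e \<in> lmod_hom R P P" unfolding e_def by (rule hom_comp[OF u(1) v(1)])
  have pe: "p (e x) = p x" if "x \<in> carrier P" for x
    using that u(2) v(2) ri lmod_homD(1)[OF u(1)] lmod_homD(1)[OF P'(3)] by (simp add: e_def)
  obtain s where s: "s \<in> lmod_hom R P P" "\<And>x. x \<in> carrier P \<Longrightarrow> e (s x) = x"
    using projective_lift[OF P'(1) projective_cover_fg(1)[OF X P] P'(2) P'(2) e onto[OF e pe] hom_id] by blast
  have ps: "p (s x) = p x" if "x \<in> carrier P" for x
    using pe[of "s x"] s(2)[OF that] lmod_homD(1)[OF s(1) that] by simp
  have se: "s (e x) = x" if "x \<in> carrier P" for x
  proof -
    have "x \<in> s ` carrier P" using onto[OF s(1) ps] that by simp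
    then obtain y where "y \<in> carrier P" "x = s y" by blast
    then show ?thesis using s(2) by simp
  qed
  have "u \<in> lmod_hom R (P\<lparr>carrier := a_kernel P X p\<rparr>) (F\<lparr>carrier := a_kernel F Y q\<rparr>)"
    using u lmod_homD(1)[OF u(1)] hom_zero[OF X' Y i]
    by (intro hom_restrict) (auto simp: mem_kernel_iff)
  \<comment> \<open>\<open>v\<close> alone does not retract \<open>u\<close>, since
    \<open>v (u x) = e x\<close>; composing with the inverse \<open>s\<close> of \<open>e\<close>
    corrects this.\<close>
  moreover have "(\<lambda>z. s (v z)) \<in> lmod_hom R (F\<lparr>carrier := a_kernel F Y q\<rparr>) (P\<lparr>carrier := a_kernel P X p\<rparr>)"
    using v lmod_homD(1)[OF v(1)] lmod_homD(1)[OF s(1)] ps hom_zero[OF Y X' r]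
    by (intro hom_restrict hom_comp[OF v(1) s(1)]) (auto simp: mem_kernel_iff)
  ultimately show ?thesis
    unfolding retract_def using se unfolding e_def by (force simp: mem_kernel_iff)
qed

lemma (in finite_length_local_ring) retract_syzygy:
  assumes X: "fg_module R X" and Y: "fg_module R Y" and ret: "retract R X Y"
  shows "retract R (syzygy R X) (syzygy R Y)"
proof -
  have X': "left_module R X" and Y': "left_module R Y" using X Y by (auto simp: fg_module_def)
  obtain i r where i: "i \<in> lmod_hom R X Y" and r: "r \<in> lmod_hom R Y X"
    and ri: "\<And>x. x \<in> carrier X \<Longrightarrow> r (i x) = x" using ret unfolding retract_def by blast
  obtain P p where P: "projective_cover R P p X" "syzygy R X = P\<lparr>carrier := a_kernel P X p\<rparr>"
    using syzygy_cover[OF X] .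
  obtain Q q where Q: "projective_cover R Q q Y" "syzygy R Y = Q\<lparr>carrier := a_kernel Q Y q\<rparr>"
    using syzygy_cover[OF Y] .
  note P' = projective_coverD[OF P(1)] and Q' = projective_coverD[OF Q(1)]
  obtain u where u: "u \<in> lmod_hom R P Q" "\<And>x. x \<in> carrier P \<Longrightarrow> q (u x) = i (p x)"
    using projective_lift[OF P'(1) projective_cover_fg(1)[OF X P(1)] Q'(2) Y' Q'(3,4) hom_comp[OF P'(3) i]]
    by blast
  obtain v where v: "v \<in> lmod_hom R Q P" "\<And>x. x \<in> carrier Q \<Longrightarrow> p (v x) = r (q x)"
    using projective_lift[OF Q'(1) projective_cover_fg(1)[OF Y Q(1)] P'(2) X' P'(3,4) hom_comp[OF Q'(3) r]]
    by blast
  show ?thesis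
    unfolding P(2) Q(2)
    by (rule retract_kernel[OF X Y' Q'(2) P(1) Q'(3) i r _ u(1) _ v(1)]) (simp_all add: ri u v)
qed

section \<open>Extensions\<close>

text \<open>Direct sums are coded inside \<open>nat \<Rightarrow> 'b\<close>, on the even and the odd numbers, because an induction
  over iterated syzygies cannot change the type of the modules.\<close>

definition evens :: "(nat \<Rightarrow> 'a) \<Rightarrow> nat \<Rightarrow> 'a" where "evens h n = h (2 * n)"
definition odds :: "(nat \<Rightarrow> 'a) \<Rightarrow> nat \<Rightarrow> 'a" where "odds h n = h (Suc (2 * n))"
definition join :: "(nat \<Rightarrow> 'a) \<Rightarrow> (nat \<Rightarrow> 'a) \<Rightarrow> nat \<Rightarrow> 'a" where
  "join a b n = (if even n then a (n div 2) else b (n div 2))"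

lemma join_simps [simp]: "evens (join a b) = a" "odds (join a b) = b" "join (evens h) (odds h) = h"
  by (auto simp: fun_eq_iff evens_def odds_def join_def elim!: evenE oddE)

lemma join_eqI: "\<lbrakk>evens h = evens h'; odds h = odds h'\<rbrakk> \<Longrightarrow> h = h'"
  by (metis join_simps(3))

definition dsum :: "('a, nat \<Rightarrow> 'b) module \<Rightarrow> ('a, nat \<Rightarrow> 'b) module \<Rightarrow> ('a, nat \<Rightarrow> 'b) module" where
  "dsum P Q =
     \<lparr>carrier = {h. evens h \<in> carrier P \<and> odds h \<in> carrier Q}, mult = undefined, one = undefined,
      zero = join \<zero>\<^bsub>P\<^esub> \<zero>\<^bsub>Q\<^esub>,
      add = (\<lambda>h h'. join (evens h \<oplus>\<^bsub>P\<^esub> evens h') (odds h \<oplus>\<^bsub>Q\<^esub> odds h')),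
      smult = (\<lambda>a h. join (a \<odot>\<^bsub>P\<^esub> evens h) (a \<odot>\<^bsub>Q\<^esub> odds h))\<rparr>"

lemma dsum_simps [simp]:
  "h \<in> carrier (dsum P Q) \<longleftrightarrow> evens h \<in> carrier P \<and> odds h \<in> carrier Q"
  "zero (dsum P Q) = join \<zero>\<^bsub>P\<^esub> \<zero>\<^bsub>Q\<^esub>"
  "h \<oplus>\<^bsub>dsum P Q\<^esub> h' = join (evens h \<oplus>\<^bsub>P\<^esub> evens h') (odds h \<oplus>\<^bsub>Q\<^esub> odds h')"
  "a \<odot>\<^bsub>dsum P Q\<^esub> h = join (a \<odot>\<^bsub>P\<^esub> evens h) (a \<odot>\<^bsub>Q\<^esub> odds h)"
  by (auto simp: dsum_def)

lemma dsum_left_module: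
  assumes P: "left_module R P" and Q: "left_module R Q"
  shows "left_module R (dsum P Q)"
proof -
  interpret P: left_module R P by (rule P)
  interpret Q: left_module R Q by (rule Q)
  have "abelian_group (dsum P Q)"
  proof (rule abelian_groupI)
    fix h assume "h \<in> carrier (dsum P Q)"
    then show "\<exists>h'\<in>carrier (dsum P Q). h' \<oplus>\<^bsub>dsum P Q\<^esub> h = \<zero>\<^bsub>dsum P Q\<^esub>"
      by (intro bexI[of _ "join (\<ominus>\<^bsub>P\<^esub> evens h) (\<ominus>\<^bsub>Q\<^esub> odds h)"]) (auto simp: P.M.l_neg Q.M.l_neg)
  qed (auto simp: P.M.a_ac Q.M.a_ac)
  moreover have "left_module_axioms R (dsum P Q)"
    by unfold_locales
       (auto simp: P.smult_closed Q.smult_closed P.smult_l_distr Q.smult_l_distr P.smult_r_distr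
         Q.smult_r_distr P.smult_assoc Q.smult_assoc P.smult_one Q.smult_one)
  ultimately show ?thesis by (intro left_module.intro P.R.ring_axioms)
qed

lemma dsum_copair_hom:
  assumes M: "left_module R M" and u: "u \<in> lmod_hom R P M" and v: "v \<in> lmod_hom R Q M"
  shows "(\<lambda>h. u (evens h) \<oplus>\<^bsub>M\<^esub> v (odds h)) \<in> lmod_hom R (dsum P Q) M"
proof -
  interpret left_module R M by (rule M)
  show ?thesis
    by (rule lmod_homI) (auto simp: lmod_homD[OF u] lmod_homD[OF v] smult_r_distr M.a_ac)
qed

context finite_length_local_ring
begin

text \<open>Horseshoe lemma. The sum of the covers of \<open>L\<close> and \<open>N\<close> maps
  onto \<open>M\<close>, and the kernel \<open>K\<close> of this map is an extension of the two
  syzygies. The sum need not be minimal over \<open>M\<close>, so the syzygy of \<open>M\<close> is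
  only a retract of \<open>K\<close>.\<close>

lemma syzygy_extension:
  fixes L :: "('a, 'l) module" and M :: "('a, 'm) module" and N :: "('a, 'n) module"
  assumes L: "fg_module R L" and N: "fg_module R N" and M: "left_module R M"
    and f: "f \<in> lmod_hom R L M" "inj_on f (carrier L)" and g: "g \<in> lmod_hom R M N" "g ` carrier M = carrier N"
    and ex: "f ` carrier L = a_kernel M N g"
  obtains K :: "('a, nat \<Rightarrow> 'a) module" and f' g' where "left_module R K"
    "f' \<in> lmod_hom R (syzygy R L) K" "inj_on f' (carrier (syzygy R L))"
    "g' \<in> lmod_hom R K (syzygy R N)" "g' ` carrier K = carrier (syzygy R N)"
    "f' ` carrier (syzygy R L) = a_kernel K (syzygy R N) g'" "retract R (syzygy R M) K"
proof -
  have L': "left_module R L" and N': "left_module R N" using L N by (auto simp: fg_module_def)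
  have fgM: "fg_module R M" by (rule num_gens_extension(1)[OF L N M f(1) g ex])
  interpret L: left_module R L by (rule L')
  interpret M: left_module R M by (rule M)
  interpret N: left_module R N by (rule N')
  obtain P p where P: "projective_cover R P p L" "syzygy R L = P\<lparr>carrier := a_kernel P L p\<rparr>"
    using syzygy_cover[OF L] .
  obtain Q q where Q: "projective_cover R Q q N" "syzygy R N = Q\<lparr>carrier := a_kernel Q N q\<rparr>"
    using syzygy_cover[OF N] .
  obtain T t where T: "projective_cover R T t M" "syzygy R M = T\<lparr>carrier := a_kernel T M t\<rparr>"
    using syzygy_cover[OF fgM] .
  note P' = projective_coverD[OF P(1)] and Q' = projective_coverD[OF Q(1)] and T' = projective_coverD[OF T(1)]
  note fgP = projective_cover_fg(1)[OF L P(1)] and fgQ = projective_cover_fg(1)[OF N Q(1)]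
    and fgT = projective_cover_fg(1)[OF fgM T(1)]
  interpret P: left_module R P by (rule P'(2))
  interpret Q: left_module R Q by (rule Q'(2))
  have fp: "(\<lambda>x. f (p x)) \<in> lmod_hom R P M" by (rule hom_comp[OF P'(3) f(1)])
  obtain l where l: "l \<in> lmod_hom R Q M" "\<And>x. x \<in> carrier Q \<Longrightarrow> g (l x) = q x"
    using projective_lift[OF Q'(1) fgQ M N' g Q'(3)] by blast
  define F where "F = dsum P Q"
  have F: "left_module R F" unfolding F_def by (rule dsum_left_module[OF P'(2) Q'(2)])
  define w where "w = (\<lambda>h. f (p (evens h)) \<oplus>\<^bsub>M\<^esub> l (odds h))"
  have w: "w \<in> lmod_hom R F M" unfolding w_def F_def by (rule dsum_copair_hom[OF M fp l(1)])
  have gf: "g (f x) = \<zero>\<^bsub>N\<^esub>" if "x \<in> carrier L" for x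
    using ex that mem_kernel_iff[of "f x" M N g] by blast
  have gw: "g (w h) = q (odds h)" if "h \<in> carrier F" for h
    using that lmod_homD(2)[OF g(1), of "f (p (evens h))" "l (odds h)"] lmod_homD(1)[OF fp]
      lmod_homD(1)[OF l(1)] l(2) gf[of "p (evens h)"] lmod_homD(1)[OF P'(3)] lmod_homD(1)[OF Q'(3)]
    by (simp add: w_def F_def)
  have lift: "\<exists>a\<in>carrier P. y = f (p a)" if y: "y \<in> carrier M" "g y = \<zero>\<^bsub>N\<^esub>" for y
  proof -
    have "y \<in> f ` p ` carrier P" using y ex P'(4) by (simp add: mem_kernel_iff)
    then show ?thesis by blast
  qed
  \<comment> \<open>Prescribing the second component \<open>b\<close> serves twice: arbitrary
    \<open>y\<close> makes \<open>w\<close> onto, and \<open>y\<close> zero makes \<open>K\<close>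
    map onto the syzygy of \<open>N\<close>.\<close>
  have surj: "\<exists>h\<in>carrier F. w h = y \<and> odds h = b" if y: "y \<in> carrier M" and b: "b \<in> carrier Q" "g y = q b" for y b
  proof -
    have lb: "l b \<in> carrier M" using lmod_homD(1)[OF l(1) b(1)] .
    have "g (y \<ominus>\<^bsub>M\<^esub> l b) = \<zero>\<^bsub>N\<^esub>"
      using hom_minus[OF M N' g(1) y lb] l(2) b lmod_homD(1)[OF Q'(3) b(1)]
      by (simp add: a_minus_def N.M.r_neg)
    then obtain a where a: "a \<in> carrier P" "y \<ominus>\<^bsub>M\<^esub> l b = f (p a)"
      using lift[of "y \<ominus>\<^bsub>M\<^esub> l b"] y lb by auto
    have "w (join a b) = y"
      unfolding w_def using a(2)[symmetric] y lb by (simp add: a_minus_def M.M.a_assoc M.M.l_neg)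
    then show ?thesis using a b by (intro bexI[of _ "join a b"]) (auto simp: F_def)
  qed
  have ws: "w ` carrier F = carrier M"
  proof -
    have "y \<in> w ` carrier F" if y: "y \<in> carrier M" for y
    proof -
      have "g y \<in> q ` carrier Q" using Q'(4) lmod_homD(1)[OF g(1) y] by simp
      then show ?thesis using surj[OF y] by blast
    qed
    then show ?thesis using lmod_homD(1)[OF w] by blast
  qed
  obtain u where u: "u \<in> lmod_hom R T F" "\<And>x. x \<in> carrier T \<Longrightarrow> w (u x) = t x"
    using projective_lift[OF T'(1) fgT F M w ws T'(3)] by blast
  \<comment> \<open>The map from \<open>F\<close> back to \<open>T\<close> is assembled from lifts
    on the two summands, each a finitely generated projective module.\<close>
  obtain v1 where v1: "v1 \<in> lmod_hom R P T" "\<And>x. x \<in> carrier P \<Longrightarrow> t (v1 x) = f (p x)"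
    using projective_lift[OF P'(1) fgP T'(2) M T'(3,4) fp] by blast
  obtain v2 where v2: "v2 \<in> lmod_hom R Q T" "\<And>x. x \<in> carrier Q \<Longrightarrow> t (v2 x) = l x"
    using projective_lift[OF Q'(1) fgQ T'(2) M T'(3,4) l(1)] by blast
  define v where "v = (\<lambda>h. v1 (evens h) \<oplus>\<^bsub>T\<^esub> v2 (odds h))"
  have v: "v \<in> lmod_hom R F T" unfolding v_def F_def by (rule dsum_copair_hom[OF T'(2) v1(1) v2(1)])
  have tv: "t (v h) = w h" if "h \<in> carrier F" for h
    using that lmod_homD(2)[OF T'(3), of "v1 (evens h)" "v2 (odds h)"] lmod_homD(1)[OF v1(1)]
      lmod_homD(1)[OF v2(1)] v1(2) v2(2) by (simp add: v_def w_def F_def)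
  define K where "K = F\<lparr>carrier := a_kernel F M w\<rparr>"
  have kerS: "submodule (a_kernel F M w) R F" by (rule kernel_submodule[OF F M w])
  have K: "left_module R K" unfolding K_def by (rule left_module.submodule_left_module[OF F kerS])
  \<comment> \<open>The case of \<open>retract_kernel\<close> in which both modules are
    \<open>M\<close> and both maps are the identity: two surjections onto \<open>M\<close>, only one
    of them a projective cover.\<close>
  have retr: "retract R (syzygy R M) K"
    unfolding T(2) K_def
    by (rule retract_kernel[OF fgM M F T(1) w hom_id hom_id _ u(1) _ v]) (simp_all add: u tv)
  let ?i = "\<lambda>a. join a \<zero>\<^bsub>Q\<^esub>"
  have l0: "l \<zero>\<^bsub>Q\<^esub> = \<zero>\<^bsub>M\<^esub>" by (rule hom_zero[OF Q'(2) M l(1)])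
  have f0: "f \<zero>\<^bsub>L\<^esub> = \<zero>\<^bsub>M\<^esub>" by (rule hom_zero[OF L' M f(1)])
  have wi: "w (?i a) = f (p a)" if "a \<in> carrier P" for a
    using lmod_homD(1)[OF fp that] by (simp add: w_def l0)
  have fp0: "f (p a) = \<zero>\<^bsub>M\<^esub> \<longleftrightarrow> p a = \<zero>\<^bsub>L\<^esub>" if "a \<in> carrier P" for a
    using inj_onD[OF f(2), of "p a" "\<zero>\<^bsub>L\<^esub>"] f0 lmod_homD(1)[OF P'(3) that] by auto
  have iF: "?i \<in> lmod_hom R P F"
    by (rule lmod_homI) (auto simp: F_def)
  have i: "?i \<in> lmod_hom R (syzygy R L) K"
    unfolding P(2) K_def using wi fp0 f0
    by (intro hom_restrict iF) (auto simp: mem_kernel_iff F_def)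
  have "odds \<in> lmod_hom R F Q" by (rule lmod_homI) (auto simp: F_def)
  moreover have ok: "q (odds h) = \<zero>\<^bsub>N\<^esub>" if "h \<in> carrier F" "w h = \<zero>\<^bsub>M\<^esub>" for h
    using gw[OF that(1)] that(2) hom_zero[OF M N' g(1)] by simp
  ultimately have o: "odds \<in> lmod_hom R K (syzygy R N)"
    unfolding Q(2) K_def by (intro hom_restrict) (auto simp: mem_kernel_iff F_def)
  have inj: "inj_on ?i (carrier (syzygy R L))" by (rule inj_onI) (metis join_simps(1))
  have "b \<in> odds ` carrier K" if "b \<in> carrier (syzygy R N)" for b
  proof -
    have b: "b \<in> carrier Q" "q b = \<zero>\<^bsub>N\<^esub>" using that by (auto simp: Q(2) mem_kernel_iff)
    then obtain h where "h \<in> carrier F" "w h = \<zero>\<^bsub>M\<^esub>" "odds h = b"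
      using surj[of "\<zero>\<^bsub>M\<^esub>" b] hom_zero[OF M N' g(1)] by auto
    then have "h \<in> carrier K" "odds h = b" by (auto simp: K_def mem_kernel_iff)
    then show ?thesis by blast
  qed
  then have os: "odds ` carrier K = carrier (syzygy R N)" using lmod_homD(1)[OF o] by blast
  have "?i ` carrier (syzygy R L) = a_kernel K (syzygy R N) odds"
  proof (rule Set.set_eqI)
    fix h
    show "h \<in> ?i ` carrier (syzygy R L) \<longleftrightarrow> h \<in> a_kernel K (syzygy R N) odds"
    proof
      assume "h \<in> ?i ` carrier (syzygy R L)"
      then obtain a where "a \<in> carrier (syzygy R L)" "h = ?i a" by blast
      then show "h \<in> a_kernel K (syzygy R N) odds"
        using lmod_homD(1)[OF i, of a] by (simp add: mem_kernel_iff Q(2))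
    next
      assume "h \<in> a_kernel K (syzygy R N) odds"
      then have h: "h \<in> carrier F" "w h = \<zero>\<^bsub>M\<^esub>" "odds h = \<zero>\<^bsub>Q\<^esub>"
        by (auto simp: mem_kernel_iff Q(2) K_def)
      have hi: "h = ?i (evens h)" by (rule join_eqI) (simp_all add: h(3))
      have eP: "evens h \<in> carrier P" using h(1) by (simp add: F_def)
      have "p (evens h) = \<zero>\<^bsub>L\<^esub>" using h(2) hi wi[OF eP] fp0[OF eP] by simp
      then have "evens h \<in> carrier (syzygy R L)" using eP by (simp add: P(2) mem_kernel_iff)
      then show "h \<in> ?i ` carrier (syzygy R L)" using hi by blast
    qed
  qed
  then show thesis using that[OF K i inj o os _ retr] by blast
qed

section \<open>Betti numbers\<close>

text \<open>On finitely generated modules these are the numbers \<open>t_n(M)\<close>; numbers of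
  generators are easier to compare than lengths of tops.\<close>

definition betti :: "nat \<Rightarrow> ('a, 'm) module \<Rightarrow> nat" where
  "betti n M = (case n of 0 \<Rightarrow> num_gens R M | Suc m \<Rightarrow> num_gens R ((syzygy R ^^ m) (syzygy R M)))"

lemma betti_0: "betti 0 M = num_gens R M"
  by (simp add: betti_def)

text \<open>The syzygy closest to \<open>M\<close> is split off, so that inductions on
  \<open>n\<close> can generalise over the module.\<close>

lemma betti_Suc: "betti (Suc n) M = betti n (syzygy R M)"
  by (cases n) (simp_all add: betti_def funpow_swap1)

lemma fg_funpow_syzygy:
  fixes M :: "('a, nat \<Rightarrow> 'a) module"
  shows "fg_module R M \<Longrightarrow> fg_module R ((syzygy R ^^ m) M)"
  by (induction m) (auto intro: fg_syzygy)

lemma syzygy_top_length_eq: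
  assumes "fg_module R M" shows "syzygy_top_length R n M = betti n M"
  using top_length_eq[OF assms] top_length_eq[OF fg_funpow_syzygy[OF fg_syzygy[OF assms]]]
  by (cases n) (simp_all add: syzygy_top_length_def betti_def)

lemma betti_retract:
  assumes "fg_module R X" "fg_module R Y" "retract R X Y"
  shows "betti n X \<le> betti n Y"
proof -
  \<comment> \<open>The induction stays within the type of the syzygies; the case distinction below
    takes the first step from the given types.\<close>
  have *: "betti n X \<le> betti n Y" if "fg_module R X" "fg_module R Y" "retract R X Y"
    for n and X Y :: "('a, nat \<Rightarrow> 'a) module"
    using that
  proof (induction n arbitrary: X Y)
    case 0
    then show ?case using num_gens_retract[of R Y X] by (simp add: betti_0 fg_module_def)
  next
    case (Suc n)
    then show ?case unfolding betti_Suc by (intro Suc.IH fg_syzygy retract_syzygy)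
  qed
  show ?thesis
  proof (cases n)
    case 0
    then show ?thesis using num_gens_retract[of R Y X] assms by (simp add: betti_0 fg_module_def)
  next
    case (Suc m)
    then show ?thesis using *[of "syzygy R X" "syzygy R Y" m] assms
      by (simp add: betti_Suc fg_syzygy retract_syzygy)
  qed
qed

lemma betti_extension:
  fixes L :: "('a, 'l) module" and M :: "('a, 'm) module" and N :: "('a, 'n) module"
  assumes L: "fg_module R L" and N: "fg_module R N" and M: "left_module R M"
    and f: "f \<in> lmod_hom R L M" "inj_on f (carrier L)" and g: "g \<in> lmod_hom R M N" "g ` carrier M = carrier N"
    and ex: "f ` carrier L = a_kernel M N g"
  shows "betti n M \<le> betti n L + betti n N"
proof -
  have *: "betti n M \<le> betti n L + betti n N"
    if "fg_module R L" "fg_module R N" "left_module R M" "f \<in> lmod_hom R L M" "inj_on f (carrier L)"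
      "g \<in> lmod_hom R M N" "g ` carrier M = carrier N" "f ` carrier L = a_kernel M N g"
    for n and L M N :: "('a, nat \<Rightarrow> 'a) module" and f g
    using that
  proof (induction n arbitrary: L M N f g)
    case 0
    then show ?case unfolding betti_0 by (intro num_gens_extension(2))
  next
    case (Suc n)
    obtain K :: "('a, nat \<Rightarrow> 'a) module" and f' g' where K: "left_module R K"
      "f' \<in> lmod_hom R (syzygy R L) K" "inj_on f' (carrier (syzygy R L))"
      "g' \<in> lmod_hom R K (syzygy R N)" "g' ` carrier K = carrier (syzygy R N)"
      "f' ` carrier (syzygy R L) = a_kernel K (syzygy R N) g'" "retract R (syzygy R M) K"
      using syzygy_extension[OF Suc.prems] by metis
    note fg = fg_syzygy[OF Suc.prems(1)] fg_syzygy[OF Suc.prems(2)]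
    have fgK: "fg_module R K" by (rule num_gens_extension(1)[OF fg K(1,2,4-6)])
    have fgM: "fg_module R M" by (rule num_gens_extension(1)[OF Suc.prems(1-4,6-8)])
    \<comment> \<open>The induction hypothesis applies to the extension \<open>K\<close>; the syzygy
      of \<open>M\<close> is compared with it as a retract.\<close>
    have "betti n (syzygy R M) \<le> betti n K" by (rule betti_retract[OF fg_syzygy[OF fgM] fgK K(7)])
    also have "\<dots> \<le> betti n (syzygy R L) + betti n (syzygy R N)" by (rule Suc.IH[OF fg K(1-6)])
    finally show ?case by (simp add: betti_Suc)
  qed
  show ?thesis
  proof (cases n)
    case 0
    then show ?thesis using num_gens_extension(2)[OF L N M f(1) g ex] by (simp add: betti_0)
  next
    case (Suc m)
    obtain K :: "('a, nat \<Rightarrow> 'a) module" and f' g' where K: "left_module R K"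
      "f' \<in> lmod_hom R (syzygy R L) K" "inj_on f' (carrier (syzygy R L))"
      "g' \<in> lmod_hom R K (syzygy R N)" "g' ` carrier K = carrier (syzygy R N)"
      "f' ` carrier (syzygy R L) = a_kernel K (syzygy R N) g'" "retract R (syzygy R M) K"
      using syzygy_extension[OF assms] by metis
    note fg = fg_syzygy[OF L] fg_syzygy[OF N]
    have fgK: "fg_module R K" by (rule num_gens_extension(1)[OF fg K(1,2,4-6)])
    have fgM: "fg_module R M" by (rule num_gens_extension(1)[OF L N M f(1) g ex])
    have "betti m (syzygy R M) \<le> betti m K" by (rule betti_retract[OF fg_syzygy[OF fgM] fgK K(7)])
    also have "\<dots> \<le> betti m (syzygy R L) + betti m (syzygy R N)" by (rule *[OF fg K(1-6)])
    finally show ?thesis by (simp add: betti_Suc Suc)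
  qed
qed

lemma betti_le_power:
  assumes M: "fg_module R M" and q: "len_le R (regular_module R) J q"
  shows "betti n M \<le> q ^ n * num_gens R M"
proof -
  have *: "betti n M \<le> q ^ n * num_gens R M" if "fg_module R M" for n and M :: "('a, nat \<Rightarrow> 'a) module"
    using that
  proof (induction n arbitrary: M)
    case (Suc n)
    have "betti (Suc n) M \<le> q ^ n * num_gens R (syzygy R M)"
      unfolding betti_Suc by (rule Suc.IH[OF fg_syzygy[OF Suc.prems]])
    also have "\<dots> \<le> q ^ n * (q * num_gens R M)"
      using num_gens_syzygy_le[OF Suc.prems q] by (rule mult_le_mono2)
    finally show ?case by (simp add: mult_ac)
  qed (simp add: betti_0)
  show ?thesis
  proof (cases n)
    case (Suc m)
    have "betti n M \<le> q ^ m * num_gens R (syzygy R M)"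
      unfolding Suc betti_Suc by (rule *[OF fg_syzygy[OF M]])
    also have "\<dots> \<le> q ^ m * (q * num_gens R M)"
      using num_gens_syzygy_le[OF M q] by (rule mult_le_mono2)
    finally show ?thesis by (simp add: mult_ac Suc)
  qed (simp add: betti_0)
qed

text \<open>A maximal submodule splits off one composition factor, which is the residue module, and
  lowers the length bound by one. Submodules keep the type of \<open>M\<close>, so the induction can
  run in an arbitrary type.\<close>

lemma betti_le_length:
  fixes M :: "('a, 'm) module"
  assumes "fg_module R M" "len_le R M (carrier M) l"
  shows "betti n M \<le> l * betti n (residue_module R)"
  using assms
proof (induction l arbitrary: M rule: less_induct)
  case (less l)
  have M': "left_module R M" using less.prems by (simp add: fg_module_def)
  interpret M: left_module R M by (rule M')
  let ?S = "residue_module R"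
  show ?case
  proof (cases "carrier M = {\<zero>\<^bsub>M\<^esub>}")
    case True
    have "N = carrier M" if "submodule N R M" for N
      using submodule_subset[OF that] submodule_zero[OF that] unfolding True by blast
    then have "gens R M {}" by (auto simp: gens_def)
    then have "num_gens R M = 0" using num_gens_le by fastforce
    \<comment> \<open>The zero module has no generators, so an exponential bound with any base, here
      \<open>d\<close>, makes all its Betti numbers vanish.\<close>
    moreover have "len_le R (regular_module R) J d"
      by (rule len_le_mono[OF length_le]) (auto dest: J_subset)
    ultimately have "betti n M \<le> d ^ n * 0" using betti_le_power[OF less.prems(1)] by metis
    then show ?thesis by simp
  next
    case False
    obtain N where N: "max_submodule R M N"
      using max_submodule_fg[OF less.prems(1) M.zero_submodule] False by blast
    have N': "submodule N R M" and NM: "N \<subset> carrier M"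
      using N submodule_subset[of N R M] by (auto simp: max_submodule_def)
    obtain g where g: "g \<in> lmod_hom R M ?S" "g ` carrier M = carrier ?S" "a_kernel M ?S g = N"
      using max_submodule_quotient[OF M' N] .
    have l: "l > 0" "len_le R M N (l - 1)"
      using M.len_le_psubset[OF less.prems(2) M.carrier_submodule N' NM] by auto
    let ?L = "M\<lparr>carrier := N\<rparr>"
    have fgL: "fg_module R ?L" by (rule fg_submodule[OF less.prems(1) N'])
    have "len_le R ?L (carrier ?L) (l - 1)"
      using l(2) unfolding len_le_def M.submodule_of_submodule_iff[OF N'] by simp
    then have "betti n ?L \<le> (l - 1) * betti n ?S"
      using less.IH[of "l - 1" ?L] fgL l(1) by simp
    moreover have "betti n M \<le> betti n ?L + betti n ?S"
      using betti_extension[OF fgL fg_residue M' hom_inclusion[of N M R] _ g(1,2)] g(3) NM by auto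
    ultimately have "betti n M \<le> (l - 1) * betti n ?S + betti n ?S" by linarith
    then show ?thesis using l(1) by (cases l) auto
  qed
qed

end

section \<open>Exponential growth rates\<close>

text \<open>This is what gives a module and its syzygy the same growth: the sequence is shifted
  while the index of the root stays.\<close>

lemma limsup_root_Suc:
  fixes a :: "nat \<Rightarrow> nat"
  assumes bound: "\<And>n. a n \<le> q ^ n * C"
  shows "limsup (\<lambda>n. ereal (root n (real (a (Suc n))))) = limsup (\<lambda>n. ereal (root n (real (a n))))"
proof -
  define x where "x n = root (Suc n) (real (a (Suc n)))" for n
  \<comment> \<open>\<open>root n (x n ^ Suc n) = x n * root n (x n)\<close>, and \<open>x\<close> is bounded\<close>
  define c where "c n = (if a (Suc n) = 0 then 1 else root n (x n))" for n
  \<comment> \<open>The added ones make \<open>D\<close> at least 1 and let the power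
    \<open>D ^ Suc n\<close> absorb the factor \<open>C\<close>.\<close>
  define D where "D = real ((q + 1) * (C + 1))"
  have "a (Suc n) \<le> ((q + 1) * (C + 1)) ^ Suc n" for n
  proof -
    have "C + 1 \<le> (C + 1) ^ Suc n" by (rule self_le_power) auto
    then have "C \<le> (C + 1) ^ Suc n" by linarith
    moreover have "q ^ Suc n \<le> (q + 1) ^ Suc n" by (intro power_mono) auto
    ultimately have "q ^ Suc n * C \<le> (q + 1) ^ Suc n * (C + 1) ^ Suc n" by (intro mult_le_mono)
    also have "\<dots> = ((q + 1) * (C + 1)) ^ Suc n" by (rule power_mult_distrib[symmetric])
    finally show ?thesis using bound[of "Suc n"] by (rule order_trans[rotated])
  qed
  then have "real (a (Suc n)) \<le> D ^ Suc n" for n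
    unfolding D_def of_nat_power[symmetric] of_nat_le_iff .
  then have "x n \<le> root (Suc n) (D ^ Suc n)" for n
    unfolding x_def by (intro real_root_le_mono) auto
  moreover have "D \<ge> 0" by (simp add: D_def)
  ultimately have xD: "x n \<le> D" for n by (metis real_root_power_cancel zero_less_Suc)
  have "D \<ge> 1" by (simp add: D_def algebra_simps)
  \<comment> \<open>A nonzero natural number is at least 1, hence so are its roots. Where the
    sequence vanishes, the default value 1 of \<open>c\<close> keeps this bound and is harmless
    because \<open>x n = 0\<close>.\<close>
  have c1: "1 \<le> c n" if "n > 0" for n
    using that by (auto simp: c_def x_def)
  have c2: "c n \<le> root n D" if "n > 0" for n
    using that xD[of n] \<open>D \<ge> 1\<close> by (auto simp: c_def intro: real_root_le_mono)
  have "c \<longlonglongrightarrow> 1"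
  proof (rule tendsto_sandwich[of "\<lambda>_. 1" c _ "\<lambda>n. root n D"])
    show "\<forall>\<^sub>F n in sequentially. 1 \<le> c n" using c1 by (auto intro: eventually_sequentiallyI[of 1])
    show "\<forall>\<^sub>F n in sequentially. c n \<le> root n D" using c2 by (auto intro: eventually_sequentiallyI[of 1])
    show "(\<lambda>n. root n D) \<longlonglongrightarrow> 1" using \<open>D \<ge> 1\<close> by (intro LIMSEQ_root_const) auto
  qed auto
  then have c: "(\<lambda>n. ereal (c n)) \<longlonglongrightarrow> 1" unfolding one_ereal_def by (rule tendsto_ereal)
  have "root n (real (a (Suc n))) = c n * x n" if "n > 0" for n
  proof (cases "a (Suc n) = 0")
    case False
    have "x n ^ Suc n = real (a (Suc n))" unfolding x_def by (intro real_root_pow_pos2) auto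
    moreover have "x n \<ge> 0" by (simp add: x_def)
    ultimately have "root n (real (a (Suc n))) = root n (x n ^ n * x n)" by (simp add: mult.commute)
    also have "\<dots> = x n * root n (x n)"
      using that \<open>x n \<ge> 0\<close> by (simp add: real_root_mult real_root_power_cancel)
    finally show ?thesis using False by (simp add: c_def)
  qed (use that in \<open>simp add: c_def x_def\<close>)
  then have "\<forall>\<^sub>F n in sequentially. ereal (root n (real (a (Suc n)))) = ereal (c n) * ereal (x n)"
    by (auto intro: eventually_sequentiallyI[of 1])
  then have "limsup (\<lambda>n. ereal (root n (real (a (Suc n))))) = limsup (\<lambda>n. ereal (c n) * ereal (x n))"
    by (rule Limsup_eq)
  also have "\<dots> = 1 * limsup (\<lambda>n. ereal (x n))"
    using c by (rule ereal_limsup_lim_mult) auto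
  also have "\<dots> = limsup (\<lambda>n. ereal (root (n + 1) (real (a (n + 1)))))" by (simp add: x_def)
  also have "\<dots> = limsup (\<lambda>n. ereal (root n (real (a n))))" by (rule limsup_shift)
  finally show ?thesis .
qed

lemma limsup_root_mono:
  fixes a b :: "nat \<Rightarrow> nat"
  assumes "\<And>n. a n \<le> C * b n"
  shows "limsup (\<lambda>n. ereal (root n (real (a n)))) \<le> limsup (\<lambda>n. ereal (root n (real (b n))))"
proof -
  have "limsup (\<lambda>n. ereal (root n (real (a n))))
      \<le> limsup (\<lambda>n. ereal (root n (real (C + 1))) * ereal (root n (real (b n))))"
  proof (rule Limsup_mono, rule eventually_sequentiallyI[of 1])
    fix n :: nat assume "1 \<le> n"
    \<comment> \<open>\<open>C + 1\<close> is positive, so its roots tend to 1 and the factor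
      disappears in the limit.\<close>
    have "a n \<le> (C + 1) * b n" using assms[of n] by simp
    then have "real (a n) \<le> real (C + 1) * real (b n)" by (metis of_nat_le_iff of_nat_mult)
    then have "root n (real (a n)) \<le> root n (real (C + 1) * real (b n))"
      using \<open>1 \<le> n\<close> by (intro real_root_le_mono) auto
    then show "ereal (root n (real (a n))) \<le> ereal (root n (real (C + 1))) * ereal (root n (real (b n)))"
      by (simp add: real_root_mult)
  qed
  also have "\<dots> = 1 * limsup (\<lambda>n. ereal (root n (real (b n))))"
  proof (rule ereal_limsup_lim_mult)
    have "(\<lambda>n. root n (real (C + 1))) \<longlonglongrightarrow> 1" by (rule LIMSEQ_root_const) simp
    then show "(\<lambda>n. ereal (root n (real (C + 1)))) \<longlonglongrightarrow> 1" unfolding one_ereal_def by (rule tendsto_ereal)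
  qed auto
  finally show ?thesis by simp
qed

lemma limsup_root_le_power:
  fixes a :: "nat \<Rightarrow> nat"
  assumes "\<And>n. a n \<le> q ^ n"
  shows "limsup (\<lambda>n. ereal (root n (real (a n)))) \<le> ereal (real q)"
proof (rule Limsup_bounded, rule eventually_sequentiallyI[of 1])
  fix n :: nat assume n: "1 \<le> n"
  have "real (a n) \<le> real q ^ n" using assms[of n] by (metis of_nat_le_iff of_nat_power)
  then have "root n (real (a n)) \<le> root n (real q ^ n)" using n by (intro real_root_le_mono) auto
  then show "ereal (root n (real (a n))) \<le> ereal (real q)" using n by (simp add: real_root_power_cancel)
qed

text \<open>The retraction is the projection onto \<open>X\<close> along \<open>Y\<close> followed
  by the inverse of \<open>h\<close>. It is characterised by \<open>z - h (r z)\<close> lying in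
  \<open>Y\<close>, and its linearity is read off from uniqueness.\<close>

lemma summand_retract:
  assumes M: "left_module R M" and N: "left_module R N" and s: "is_summand R N M"
  shows "retract R N M"
proof -
  interpret M: left_module R M by (rule M)
  interpret N: left_module R N by (rule N)
  obtain X Y h where X: "submodule X R M" and Y: "submodule Y R M" and XY: "X \<inter> Y = {\<zero>\<^bsub>M\<^esub>}"
    "X <+>\<^bsub>M\<^esub> Y = carrier M" and h: "h \<in> lmod_hom R N (M\<lparr>carrier := X\<rparr>)" "bij_betw h (carrier N) X"
    using s unfolding is_summand_def lmod_iso_def by auto
  note XM = submodule_subset[OF X] and YM = submodule_subset[OF Y]
  have hM: "h \<in> lmod_hom R N M"
    using lmod_homD[OF h(1)] XM by (intro lmod_homI) auto
  define r where "r z = (SOME n. n \<in> carrier N \<and> (\<exists>y\<in>Y. z = h n \<oplus>\<^bsub>M\<^esub> y))" for z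
  have "\<exists>n. n \<in> carrier N \<and> (\<exists>y\<in>Y. z = h n \<oplus>\<^bsub>M\<^esub> y)" if "z \<in> carrier M" for z
  proof -
    have "z \<in> X <+>\<^bsub>M\<^esub> Y" using that XY(2) by simp
    then obtain x y where xy: "x \<in> X" "y \<in> Y" "z = x \<oplus>\<^bsub>M\<^esub> y" by (auto simp: mem_set_add_iff)
    then have "x \<in> h ` carrier N" using h(2) by (simp add: bij_betw_def)
    then show ?thesis using xy by blast
  qed
  then have r: "r z \<in> carrier N" "\<exists>y\<in>Y. z = h (r z) \<oplus>\<^bsub>M\<^esub> y" if "z \<in> carrier M" for z
    unfolding r_def using someI_ex[of "\<lambda>n. n \<in> carrier N \<and> (\<exists>y\<in>Y. z = h n \<oplus>\<^bsub>M\<^esub> y)"] that by auto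
  \<comment> \<open>Two such representations of \<open>z\<close> give a difference
    \<open>h n - h (r z)\<close> in both \<open>X\<close> and \<open>Y\<close>, hence zero, and
    \<open>h\<close> is injective.\<close>
  have uniq: "r z = n" if z: "z \<in> carrier M" and n: "n \<in> carrier N" and y: "y \<in> Y" "z = h n \<oplus>\<^bsub>M\<^esub> y" for z n y
  proof -
    obtain y' where y': "y' \<in> Y" "z = h (r z) \<oplus>\<^bsub>M\<^esub> y'" using r(2)[OF z] by blast
    have hX: "h n \<in> X" "h (r z) \<in> X" using lmod_homD(1)[OF h(1)] n r(1)[OF z] by auto
    have mem: "h n \<in> carrier M" "h (r z) \<in> carrier M" "y \<in> carrier M" "y' \<in> carrier M"
      using hX XM y y' YM by auto
    have "h n = (h (r z) \<oplus>\<^bsub>M\<^esub> y') \<ominus>\<^bsub>M\<^esub> y"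
      using y(2) y'(2) mem by (simp add: a_minus_def M.M.a_assoc M.M.r_neg)
    then have "h n = (y' \<ominus>\<^bsub>M\<^esub> y) \<oplus>\<^bsub>M\<^esub> h (r z)"
      using mem by (simp add: a_minus_def M.M.a_ac)
    then have "h n \<ominus>\<^bsub>M\<^esub> h (r z) = y' \<ominus>\<^bsub>M\<^esub> y"
      using mem by (simp add: a_minus_def M.M.a_assoc M.M.r_neg)
    then have "h n \<ominus>\<^bsub>M\<^esub> h (r z) \<in> X \<inter> Y"
      using submodule_minus[OF X hX] submodule_minus[OF Y y'(1) y(1)] by simp
    then have "h n = h (r z)" using XY(1) M.M.minus_eq_zeroD[OF mem(1,2)] by simp
    then show ?thesis using inj_onD[OF bij_betw_imp_inj_on[OF h(2)]] n r(1)[OF z] by simp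
  qed
  have "r \<in> lmod_hom R M N"
  proof (rule lmod_homI)
    fix z assume z: "z \<in> carrier M"
    then show "r z \<in> carrier N" by (rule r(1))
    obtain y where y: "y \<in> Y" "z = h (r z) \<oplus>\<^bsub>M\<^esub> y" using r(2)[OF z] by blast
    have mem: "h (r z) \<in> carrier M" "y \<in> carrier M" using lmod_homD(1)[OF hM r(1)[OF z]] y YM by auto
    fix a assume a: "a \<in> carrier R"
    show "r (a \<odot>\<^bsub>M\<^esub> z) = a \<odot>\<^bsub>N\<^esub> r z"
    proof (rule uniq)
      have "a \<odot>\<^bsub>M\<^esub> z = a \<odot>\<^bsub>M\<^esub> (h (r z) \<oplus>\<^bsub>M\<^esub> y)" using y by simp
      also have "\<dots> = h (a \<odot>\<^bsub>N\<^esub> r z) \<oplus>\<^bsub>M\<^esub> a \<odot>\<^bsub>M\<^esub> y"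
        using mem a lmod_homD(3)[OF hM a r(1)[OF z]] by (simp add: M.smult_r_distr)
      finally show "a \<odot>\<^bsub>M\<^esub> z = h (a \<odot>\<^bsub>N\<^esub> r z) \<oplus>\<^bsub>M\<^esub> a \<odot>\<^bsub>M\<^esub> y" .
    qed (use a z r(1) y submodule_smult[OF Y] in \<open>auto intro: M.smult_closed N.smult_closed\<close>)
  next
    fix z z' assume z: "z \<in> carrier M" "z' \<in> carrier M"
    obtain y where y: "y \<in> Y" "z = h (r z) \<oplus>\<^bsub>M\<^esub> y" using r(2)[OF z(1)] by blast
    obtain y' where y': "y' \<in> Y" "z' = h (r z') \<oplus>\<^bsub>M\<^esub> y'" using r(2)[OF z(2)] by blast
    have mem: "h (r z) \<in> carrier M" "y \<in> carrier M" "h (r z') \<in> carrier M" "y' \<in> carrier M"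
      using lmod_homD(1)[OF hM r(1)[OF z(1)]] lmod_homD(1)[OF hM r(1)[OF z(2)]] y y' YM by auto
    show "r (z \<oplus>\<^bsub>M\<^esub> z') = r z \<oplus>\<^bsub>N\<^esub> r z'"
    proof (rule uniq)
      have "z \<oplus>\<^bsub>M\<^esub> z' = (h (r z) \<oplus>\<^bsub>M\<^esub> y) \<oplus>\<^bsub>M\<^esub> (h (r z') \<oplus>\<^bsub>M\<^esub> y')" using y(2) y'(2) by simp
      also have "\<dots> = h (r z \<oplus>\<^bsub>N\<^esub> r z') \<oplus>\<^bsub>M\<^esub> (y \<oplus>\<^bsub>M\<^esub> y')"
        using mem lmod_homD(2)[OF hM r(1)[OF z(1)] r(1)[OF z(2)]] by (simp add: M.M.a_ac)
      finally show "z \<oplus>\<^bsub>M\<^esub> z' = h (r z \<oplus>\<^bsub>N\<^esub> r z') \<oplus>\<^bsub>M\<^esub> (y \<oplus>\<^bsub>M\<^esub> y')" .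
    qed (use z r(1) y y' submodule_add[OF Y] in auto)
  qed
  moreover have "r (h n) = n" if n: "n \<in> carrier N" for n
    using lmod_homD(1)[OF hM n] n submodule_zero[OF Y] by (intro uniq[of _ _ "\<zero>\<^bsub>M\<^esub>"]) auto
  ultimately show ?thesis unfolding retract_def using hM by blast
qed

section \<open>Growth over local rings of finite length\<close>

context finite_length_local_ring
begin

lemma omega_growth_eq:
  "fg_module R M \<Longrightarrow> omega_growth R M = limsup (\<lambda>n. ereal (root n (real (betti n M))))"
  by (simp add: omega_growth_def syzygy_top_length_eq)

lemma J_length: "len_le R (regular_module R) J d"
  by (rule len_le_mono[OF length_le]) (auto dest: J_subset)

lemma omega_growth_syzygy:
  assumes M: "fg_module R M"
  shows "omega_growth R (syzygy R M) = omega_growth R M"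
proof -
  have "limsup (\<lambda>n. ereal (root n (real (betti (Suc n) M)))) = limsup (\<lambda>n. ereal (root n (real (betti n M))))"
    by (rule limsup_root_Suc[of "\<lambda>n. betti n M" d "num_gens R M"]) (rule betti_le_power[OF M J_length])
  then show ?thesis
    by (simp only: omega_growth_eq[OF M] omega_growth_eq[OF fg_syzygy[OF M]] betti_Suc)
qed

lemma omega_growth_funpow:
  fixes M :: "('a, nat \<Rightarrow> 'a) module"
  shows "fg_module R M \<Longrightarrow> omega_growth R ((syzygy R ^^ m) M) = omega_growth R M"
  by (induction m) (simp_all add: omega_growth_syzygy fg_funpow_syzygy)

lemma omega_growth_le_local:
  assumes M: "fg_module R M"
  shows "omega_growth R M \<le> local_growth R"
  unfolding local_growth_def omega_growth_eq[OF M] omega_growth_eq[OF fg_residue]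
  \<comment> \<open>The constant factor is the length bound from \<open>fg_length\<close>.\<close>
  by (rule limsup_root_mono[of _ "num_gens R M * d"]) (rule betti_le_length[OF M fg_length[OF M]])

lemma local_growth_le_retract:
  assumes M: "fg_module R M" and r: "retract R (residue_module R) M"
  shows "local_growth R \<le> omega_growth R M"
  unfolding local_growth_def omega_growth_eq[OF M] omega_growth_eq[OF fg_residue]
  by (rule limsup_root_mono[of _ 1]) (use betti_retract[OF fg_residue M r] in simp)

lemma omega_growth_eq_local:
  assumes M: "fg_module R M" and s: "is_summand_of_syzygy R (residue_module R) n M"
  shows "omega_growth R M = local_growth R"
proof (rule antisym[OF omega_growth_le_local[OF M]])
  show "local_growth R \<le> omega_growth R M"
  proof (cases n)
    case 0
    then have "retract R (residue_module R) M"
      using M s residue_left_module by (simp add: is_summand_of_syzygy_def fg_module_def summand_retract)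
    then show ?thesis by (rule local_growth_le_retract[OF M])
  next
    case (Suc m)
    let ?K = "(syzygy R ^^ m) (syzygy R M)"
    have K: "fg_module R ?K" by (rule fg_funpow_syzygy[OF fg_syzygy[OF M]])
    then have "retract R (residue_module R) ?K"
      using s residue_left_module Suc by (simp add: is_summand_of_syzygy_def fg_module_def summand_retract)
    then have "local_growth R \<le> omega_growth R ?K" by (rule local_growth_le_retract[OF K])
    \<comment> \<open>Invariance of the growth under syzygies leads from \<open>?K\<close> back to
      \<open>M\<close>.\<close>
    then show ?thesis using omega_growth_funpow[OF fg_syzygy[OF M]] omega_growth_syzygy[OF M] by simp
  qed
qed

lemma local_growth_le_length:
  "local_growth R \<le> ereal_of_enat (module_length R ((regular_module R)\<lparr>carrier := J\<rparr>))"
proof -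
  note iff = module_length_submodule_le_iff[OF regular J_submodule]
  \<comment> \<open>The length of \<open>J\<close> is at most \<open>d\<close>, hence finite, and
    its exact value \<open>q\<close> serves as the base. The residue module has at most one
    generator, so no constant factor remains.\<close>
  obtain q where q: "module_length R ((regular_module R)\<lparr>carrier := J\<rparr>) = enat q"
    using iff[of d] J_length by (metis enat_ile)
  then have len: "len_le R (regular_module R) J q" using iff[of q] by simp
  have "betti n (residue_module R) \<le> q ^ n" for n
    using order_trans[OF betti_le_power[OF fg_residue len] mult_le_mono2[OF num_gens_residue]] by simp
  then have "local_growth R \<le> ereal (real q)"
    unfolding local_growth_def omega_growth_eq[OF fg_residue] by (rule limsup_root_le_power)
  then show ?thesis by (simp add: q)
qed

end

text \<open>The algebra is spanned by finitely many lines over the field, each of length at most 1,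
  so the size of a spanning set bounds all chains of subspaces and in particular those of left
  ideals.\<close>

lemma fd_algebra_length:
  fixes k :: "'k ring" and A :: "('k, 'a) module"
  assumes "fd_algebra k A"
  obtains d where "len_le A (regular_module A) (carrier A) d"
proof -
  interpret fd_algebra k A by (rule assms)
  have kA: "left_module k A"
    by (intro left_module.intro R.ring_axioms abelian_group_axioms left_module_axioms.intro)
       (auto simp: smult_l_distr smult_r_distr smult_assoc1)
  then interpret L: left_module k A .
  obtain B where B: "finite B" "B \<subseteq> carrier A"
    "\<And>x. x \<in> carrier A \<Longrightarrow> \<exists>c\<in>B \<rightarrow> carrier k. x = (\<Oplus>\<^bsub>A\<^esub>b\<in>B. c b \<odot>\<^bsub>A\<^esub> b)"
    using finite_dim by blast
  have sub: "submodule (carrier k) k (regular_module k)"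
    using left_module.carrier_submodule[OF regular_left_module[OF R.ring_axioms]] by simp
  have "len_le k A (lcomb A B (\<lambda>b. b) ` (B \<rightarrow> carrier k)) (card B * 1)"
  proof (rule len_le_lcomb[OF kA sub B(1,2)])
    fix b assume "b \<in> B"
    then have b: "b \<in> carrier A" using B by blast
    show "len_le k A ((\<lambda>a. a \<odot>\<^bsub>A\<^esub> b) ` carrier k) 1"
    proof (rule len_le_cyclic[OF kA b])
      fix a assume a: "a \<in> carrier k" "a \<odot>\<^bsub>A\<^esub> b \<noteq> \<zero>\<^bsub>A\<^esub>"
      then have "a \<noteq> \<zero>\<^bsub>k\<^esub>" using b by auto
      then have "a \<in> Units k" using a(1) field_Units by blast
      then show "\<exists>a'\<in>carrier k. a' \<otimes>\<^bsub>k\<^esub> a = \<one>\<^bsub>k\<^esub>" by (auto simp: Units_def)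
    qed
  qed
  moreover have "carrier A \<subseteq> lcomb A B (\<lambda>b. b) ` (B \<rightarrow> carrier k)"
    using B(3) unfolding lcomb_def by blast
  ultimately have len: "len_le k A (carrier A) (card B)" by (auto intro: len_le_mono)
  \<comment> \<open>A field scalar \<open>a\<close> acts as left multiplication by the algebra
    element \<open>a 1\<close>, so left ideals are subspaces.\<close>
  have left_ideal: "submodule I k A" if I: "submodule I A (regular_module A)" for I
  proof (rule L.submoduleI)
    have IA: "I \<subseteq> carrier A" using submodule_subset[OF I] by simp
    then show "I \<subseteq> carrier A" .
    show "\<zero>\<^bsub>A\<^esub> \<in> I" using submodule_zero[OF I] by simp
    show "x \<oplus>\<^bsub>A\<^esub> y \<in> I" if "x \<in> I" "y \<in> I" for x y using submodule_add[OF I that] by simp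
    show "a \<odot>\<^bsub>A\<^esub> x \<in> I" if "a \<in> carrier k" "x \<in> I" for a x
    proof -
      have x: "x \<in> carrier A" using that IA by blast
      have "(a \<odot>\<^bsub>A\<^esub> \<one>\<^bsub>A\<^esub>) \<otimes>\<^bsub>A\<^esub> x \<in> I" using submodule_smult[OF I _ that(2), of "a \<odot>\<^bsub>A\<^esub> \<one>\<^bsub>A\<^esub>"] that(1) by simp
      then show ?thesis using smult_assoc_left[OF that(1) _ x, of "\<one>\<^bsub>A\<^esub>"] x by simp
    qed
  qed
  have "len_le A (regular_module A) (carrier A) (card B)"
    using len left_ideal unfolding len_le_def by blast
  then show thesis by (rule that)
qed

theorem theorem1:
  fixes k :: "'k ring" and A :: "('k, 'a) module"
  assumes "fd_algebra k A" and "local_ring A"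
  shows "local_growth A \<le>
           ereal_of_enat (module_length A ((regular_module A)\<lparr>carrier := jacobson_radical A\<rparr>)) \<and>
         (\<forall>M :: ('a, 'm) module. finite_length_module A M \<longrightarrow>
           omega_growth A M = omega_growth A (syzygy A M) \<and>
           omega_growth A (syzygy A M) \<le> local_growth A) \<and>
         (\<forall>M :: ('a, 'm) module. finite_length_module A M \<longrightarrow>
           (\<exists>n. is_summand_of_syzygy A (residue_module A) n M) \<longrightarrow>
           omega_growth A M = local_growth A)"
proof -
  obtain d where "len_le A (regular_module A) (carrier A) d" using fd_algebra_length[OF assms(1)] .
  with assms(2) interpret finite_length_local_ring A d
    by (simp add: finite_length_local_ring_def finite_length_local_ring_axioms_def local_ring_def)
  show ?thesis
    using local_growth_le_length omega_growth_syzygy omega_growth_le_local omega_growth_eq_local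
      finite_length_imp_fg by metis
qed

end
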